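(* For any Noetherian local ring $(R,\mathfrak m)$ of dimension two and any $\mathfrak m$-primary $\mathfrak m$-full ideal $I$ which can be generated by $N$ elements, we have \[\operatorname{e}(I)\le 2\left(1-\frac{1}{2N-2}\right)\operatorname{e}(R)\,\ell(R/I).\]
   Context: Let $\mathfrak m=(x_1,\dots,x_n)$, $\widetilde R=R(t_1,\dots,t_n)=R[t_1,\dots,t_n]_{\mathfrak mR[t_1,\dots,t_n]}$, and $z=t_1x_1+\cdots+t_nx_n$. An ideal $I$ is $\mathfrak m$-full if $\mathfrak m I\widetilde R:_{\widetilde R} z=I\widetilde R$. $\operatorname{e}$ denotes Hilbert--Samuel multiplicity, $\operatorname{e}(R)=\operatorname{e}(\mathfrak m)$. (An $\mathfrak m$-primary ideal in a two-dimensional local ring needs at least two generators, so $N\ge2$.) *)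

theory Defs
  imports "HOL-Analysis.Analysis" "HOL-Library.Poly_Mapping" "HOL-Library.Extended_Nat"
begin

definition is_ideal :: "'a::comm_ring_1 set \<Rightarrow> bool" where
  "is_ideal I \<longleftrightarrow> 0 \<in> I \<and> (\<forall>x\<in>I. \<forall>y\<in>I. x + y \<in> I) \<and> (\<forall>r x. x \<in> I \<longrightarrow> r * x \<in> I)"

definition ideal_gen :: "'a::comm_ring_1 set \<Rightarrow> 'a set" where
  "ideal_gen S = \<Inter>{I. is_ideal I \<and> S \<subseteq> I}"

definition ideal_prod :: "'a::comm_ring_1 set \<Rightarrow> 'a set \<Rightarrow> 'a set" where
  "ideal_prod I J = ideal_gen {a * b | a b. a \<in> I \<and> b \<in> J}"

fun ideal_pow :: "'a::comm_ring_1 set \<Rightarrow> nat \<Rightarrow> 'a set" where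
  "ideal_pow I 0 = UNIV"
| "ideal_pow I (Suc n) = ideal_prod I (ideal_pow I n)"

definition prime_ideal :: "'a::comm_ring_1 set \<Rightarrow> bool" where
  "prime_ideal P \<longleftrightarrow> is_ideal P \<and> P \<noteq> UNIV \<and> (\<forall>a b. a * b \<in> P \<longrightarrow> a \<in> P \<or> b \<in> P)"

definition noetherian :: "'a::comm_ring_1 itself \<Rightarrow> bool" where
  "noetherian _ \<longleftrightarrow> (\<forall>I::'a set. is_ideal I \<longrightarrow> (\<exists>S. finite S \<and> I = ideal_gen S))"

text \<open>The set of non-units; the ring is local iff this set is an ideal
  (it is then the unique maximal ideal m).\<close>
definition max_ideal :: "'a::comm_ring_1 set" where
  "max_ideal = {x. \<not> x dvd 1}"

definition local_ring :: "'a::comm_ring_1 itself \<Rightarrow> bool" where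
  "local_ring _ \<longleftrightarrow> is_ideal (max_ideal :: 'a set)"

definition krull_dim :: "'a::comm_ring_1 itself \<Rightarrow> enat" where
  "krull_dim _ = Sup {enat k | k. \<exists>P :: nat \<Rightarrow> 'a set.
      (\<forall>i\<le>k. prime_ideal (P i)) \<and> (\<forall>i<k. P i \<subset> P (Suc i))}"

text \<open>Length of the R-module R/I: supremum of lengths of strict chains of
  ideals from I to R (submodules of R/I correspond to ideals containing I).\<close>
definition colength :: "'a::comm_ring_1 set \<Rightarrow> enat" where
  "colength I = Sup {enat k | k. \<exists>J :: nat \<Rightarrow> 'a set. J 0 = I \<and> J k = UNIV \<and>
      (\<forall>i\<le>k. is_ideal (J i)) \<and> (\<forall>i<k. J i \<subset> J (Suc i))}"

definition colen :: "'a::comm_ring_1 set \<Rightarrow> real" where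
  "colen I = real (the_enat (colength I))"

definition m_primary :: "'a::comm_ring_1 set \<Rightarrow> bool" where
  "m_primary I \<longleftrightarrow> is_ideal I \<and> I \<subseteq> max_ideal \<and> (\<forall>x\<in>max_ideal. \<exists>k. x ^ k \<in> I)"

definition hs_mult :: "nat \<Rightarrow> 'a::comm_ring_1 set \<Rightarrow> real" where
  "hs_mult d I = lim (\<lambda>n. fact d * colen (ideal_pow I n) / real n ^ d)"

type_synonym 'a mpoly = "(nat \<Rightarrow>\<^sub>0 nat) \<Rightarrow>\<^sub>0 'a"

definition const_poly :: "'a::comm_ring_1 \<Rightarrow> 'a mpoly" where
  "const_poly c = Poly_Mapping.single 0 c"

definition var_poly :: "nat \<Rightarrow> 'a::comm_ring_1 mpoly" where
  "var_poly i = Poly_Mapping.single (Poly_Mapping.single i 1) 1"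

definition ext_ideal :: "'a::comm_ring_1 set \<Rightarrow> 'a mpoly set" where
  "ext_ideal I = ideal_gen (const_poly ` I)"

text \<open>Contraction to R[t] of the extension J R(t), where
  R(t) = R[t] localized at the prime m R[t]:
  f/1 \<in> J R(t) iff s f \<in> J for some s \<notin> m R[t].  Ideals of R(t) are determined
  by their contractions to R[t] (and R[t] \<rightarrow> R(t) is injective).\<close>
definition loc_contr :: "'a::comm_ring_1 mpoly set \<Rightarrow> 'a mpoly set" where
  "loc_contr J = {f. \<exists>s. s \<notin> ext_ideal max_ideal \<and> s * f \<in> J}"

text \<open>m-fullness w.r.t. the generators xs = [x_1,...,x_n] of m, with
  z = t_1 x_1 + ... + t_n x_n: m I R(t) :_{R(t)} z = I R(t), compared via
  contractions to R[t].\<close>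
definition m_full :: "'a::comm_ring_1 list \<Rightarrow> 'a set \<Rightarrow> bool" where
  "m_full xs I \<longleftrightarrow>
     (let z = (\<Sum>i<length xs. var_poly i * const_poly (xs ! i)) in
      {f. z * f \<in> loc_contr (ext_ideal (ideal_prod max_ideal I))} = loc_contr (ext_ideal I))"

end

theory Submission
  imports Defs "HOL-Computational_Algebra.Polynomial"
begin

text \<open>
  Ideals of \<open>S = R(t)\<close> are represented by the ideals of \<open>R[t]\<close> that are saturated with respect
  to the complement of \<open>\<mm>R[t]\<close>.

  Fullness says that multiplication by \<open>z\<close> on \<open>S/\<mm>IS\<close> has kernel \<open>IS/\<mm>IS\<close>, so
  \<open>length(S/(\<mm>I + z)) = \<mu>(I) \<le> N\<close>. Hence \<open>length(S/(I + z)) \<le> k = N - 1\<close>, unless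
  \<open>I \<subseteq> \<mm>I + zS\<close>, which forces \<open>e(I) = 0\<close>.

  Let \<open>b\<^sub>i\<close> be the least \<open>j\<close> with \<open>\<mm>\<^sup>i \<subseteq> (I : z\<^sup>j) + (z)\<close>, so that \<open>b\<^sub>k = 0\<close>. Filtering \<open>S/IS\<close> by
  powers of \<open>z\<close> gives \<open>b\<^sub>0 + \<dots> + b\<^sub>k\<^sub>-\<^sub>1 \<le> length(R/I)\<close>. Multiplying the inclusions shows that
  \<open>\<mm>\<^sup>c \<subseteq> (I\<^sup>n : z\<^sup>j) + (z)\<close> above the polygon through the points \<open>(n b\<^sub>i, n i)\<close>, and the same filtration of
  \<open>S/I\<^sup>nS\<close>, with \<open>length(S/(\<mm>\<^sup>c + z)) \<le> e(R) c + O(1)\<close> because \<open>z\<close> is superficial, bounds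
  \<open>length(R/I\<^sup>n)\<close> by \<open>e(R)\<close> times the area under that polygon, which is
  \<open>n\<^sup>2 (b\<^sub>0 + \<dots> + b\<^sub>k\<^sub>-\<^sub>1 - b\<^sub>0/2)\<close>, up to \<open>O(n)\<close>. Finally \<open>b\<^sub>0 \<ge> (b\<^sub>0 + \<dots> + b\<^sub>k\<^sub>-\<^sub>1)/k\<close>.
\<close>

text \<open>\<open>hs_mult\<close> is a \<open>lim\<close>, which carries no information until
  convergence is known. Hence the Hilbert-Serre argument: lengths of \<open>R/I^n\<close> are
  eventually polynomial, and a two-element ideal containing a power of the maximal ideal (here the
  dimension enters) limits their growth to \<open>n^2\<close>. The same polynomial for the maximal
  ideal gives the lengths of its successive quotients, which superficiality of \<open>z\<close>
  transfers to \<open>S/(m^c + z)\<close>. Superficiality rests on the associated graded ring having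
  no socle in high degrees, once more a finiteness statement about the Rees algebra. That
  \<open>b k = 0\<close> comes from length: if \<open>S/L\<close> has length at most
  \<open>k\<close>, the images of the powers of \<open>m\<close> decrease strictly until they
  vanish, so \<open>m^k\<close> lies in \<open>L\<close>. Both sums in the estimate are lattice
  point counts read along the two axes: \<open>b i\<close> against the pieces of the filtration by
  powers of \<open>z\<close>, and the least exponents \<open>c\<close> against the polygon. The area
  is a sum of trapezoids \<open>(b i + b (i+1))/2\<close>; the missing \<open>b 0 / 2\<close>
  produces the gain \<open>1/(2k)\<close>.\<close>

section \<open>Ideals, their sums and colons\<close>

lemma is_ideal_0: "is_ideal J \<Longrightarrow> 0 \<in> J" by (simp add: is_ideal_def)
lemma is_ideal_add: "is_ideal J \<Longrightarrow> x \<in> J \<Longrightarrow> y \<in> J \<Longrightarrow> x + y \<in> J" by (simp add: is_ideal_def)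
lemma is_ideal_mult: "is_ideal J \<Longrightarrow> x \<in> J \<Longrightarrow> r * x \<in> J" by (simp add: is_ideal_def)
lemma is_ideal_mult': "is_ideal J \<Longrightarrow> x \<in> J \<Longrightarrow> x * r \<in> J" by (metis is_ideal_def mult.commute)
lemma is_ideal_minus: "is_ideal J \<Longrightarrow> x \<in> J \<Longrightarrow> - x \<in> J"
  using is_ideal_mult[of J x "-1"] by simp
lemma is_ideal_diff: "is_ideal J \<Longrightarrow> x \<in> J \<Longrightarrow> y \<in> J \<Longrightarrow> x - y \<in> J"
  using is_ideal_add[of J x "- y"] is_ideal_minus[of J y] by simp
lemma is_ideal_sum: "is_ideal J \<Longrightarrow> (\<And>a. a \<in> A \<Longrightarrow> f a \<in> J) \<Longrightarrow> sum f A \<in> J"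
  by (induction A rule: infinite_finite_induct) (auto simp: is_ideal_0 is_ideal_add)
lemma is_ideal_UNIV: "is_ideal UNIV" by (simp add: is_ideal_def)
lemma is_ideal_zero: "is_ideal {0}" by (simp add: is_ideal_def)
lemma is_ideal_Int: "is_ideal J \<Longrightarrow> is_ideal K \<Longrightarrow> is_ideal (J \<inter> K)" by (simp add: is_ideal_def)
lemma is_ideal_one: "is_ideal J \<Longrightarrow> 1 \<in> J \<Longrightarrow> J = UNIV"
  using is_ideal_mult[of J 1] by auto
lemmas is_ideal_rules = is_ideal_0 is_ideal_add is_ideal_mult is_ideal_mult' is_ideal_diff

lemma is_ideal_gen: "is_ideal (ideal_gen S)"
  unfolding ideal_gen_def is_ideal_def by blast
lemma ideal_gen_superset: "S \<subseteq> ideal_gen S"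
  unfolding ideal_gen_def by blast
lemma ideal_gen_least: "is_ideal K \<Longrightarrow> S \<subseteq> K \<Longrightarrow> ideal_gen S \<subseteq> K"
  unfolding ideal_gen_def by blast
lemma ideal_gen_empty: "ideal_gen {} = {0}"
  using ideal_gen_least[OF is_ideal_zero, of "{}"] is_ideal_0[OF is_ideal_gen] by blast

definition isum :: "'a::comm_ring_1 set \<Rightarrow> 'a set \<Rightarrow> 'a set" where
  "isum J K = {a + b | a b. a \<in> J \<and> b \<in> K}"

definition principal :: "'a::comm_ring_1 \<Rightarrow> 'a set" where
  "principal z = range ((*) z)"

lemma is_ideal_isum: assumes "is_ideal J" "is_ideal K" shows "is_ideal (isum J K)"
  unfolding is_ideal_def
proof (intro conjI ballI allI impI)
  show "0 \<in> isum J K" unfolding isum_def using assms is_ideal_0 by force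
next
  fix x y assume "x \<in> isum J K" "y \<in> isum J K"
  then obtain a b a' b' where "x = a + b" "y = a' + b'" "a \<in> J" "a' \<in> J" "b \<in> K" "b' \<in> K"
    unfolding isum_def by blast
  moreover have "a + b + (a' + b') = (a + a') + (b + b')" by simp
  ultimately show "x + y \<in> isum J K" unfolding isum_def using assms is_ideal_add by blast
next
  fix r x assume "x \<in> isum J K"
  then obtain a b where "x = a + b" "a \<in> J" "b \<in> K" unfolding isum_def by blast
  moreover have "r * (a + b) = r * a + r * b" by (rule distrib_left)
  ultimately show "r * x \<in> isum J K" unfolding isum_def using assms is_ideal_mult by blast
qed

lemma isum_upper1: "is_ideal K \<Longrightarrow> J \<subseteq> isum J K"
  unfolding isum_def using is_ideal_0 by force
lemma isum_upper2: "is_ideal J \<Longrightarrow> K \<subseteq> isum J K"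
  unfolding isum_def using is_ideal_0 by force
lemma isum_least: "is_ideal L \<Longrightarrow> J \<subseteq> L \<Longrightarrow> K \<subseteq> L \<Longrightarrow> isum J K \<subseteq> L"
  unfolding isum_def using is_ideal_add by blast
lemma isum_mono: "J \<subseteq> J' \<Longrightarrow> K \<subseteq> K' \<Longrightarrow> isum J K \<subseteq> isum J' K'"
  unfolding isum_def by blast

lemma is_ideal_image: assumes "is_ideal K" shows "is_ideal ((*) z ` K)"
  unfolding is_ideal_def
proof (intro conjI ballI allI impI)
  show "0 \<in> (*) z ` K" using assms is_ideal_0 by (intro image_eqI[of _ _ 0]) auto
next
  fix x y assume "x \<in> (*) z ` K" "y \<in> (*) z ` K"
  then obtain a b where "x = z * a" "y = z * b" "a \<in> K" "b \<in> K" by blast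
  then show "x + y \<in> (*) z ` K" using assms is_ideal_add
    by (intro image_eqI[of _ _ "a + b"]) (auto simp: distrib_left)
next
  fix r x assume "x \<in> (*) z ` K"
  then obtain a where "x = z * a" "a \<in> K" by blast
  then show "r * x \<in> (*) z ` K" using assms is_ideal_mult
    by (intro image_eqI[of _ _ "r * a"]) (auto simp: mult.left_commute)
qed

lemma is_ideal_principal: "is_ideal (principal z)"
  unfolding principal_def by (rule is_ideal_image[OF is_ideal_UNIV])
lemma principal_self: "z \<in> principal z" unfolding principal_def by (metis mult.right_neutral rangeI)
lemma principal_least: "is_ideal J \<Longrightarrow> z \<in> J \<Longrightarrow> principal z \<subseteq> J"
  unfolding principal_def by (auto simp: is_ideal_mult')

definition colon :: "'a::comm_ring_1 set \<Rightarrow> 'a \<Rightarrow> 'a set" where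
  "colon J z = {f. z * f \<in> J}"

lemma is_ideal_colon: "is_ideal J \<Longrightarrow> is_ideal (colon J z)"
  unfolding colon_def is_ideal_def by (auto simp: distrib_left mult.left_commute)

section \<open>Saturated ideals and length\<close>

definition sat :: "'a::comm_ring_1 set \<Rightarrow> 'a set \<Rightarrow> 'a set" where
  "sat W J = {f. \<exists>s\<in>W. s * f \<in> J}"

definition wideal :: "'a::comm_ring_1 set \<Rightarrow> 'a set \<Rightarrow> bool" where
  "wideal W J \<longleftrightarrow> is_ideal J \<and> (\<forall>s\<in>W. \<forall>f. s * f \<in> J \<longrightarrow> f \<in> J)"

definition chain :: "'a::comm_ring_1 set \<Rightarrow> (nat \<Rightarrow> 'a set) \<Rightarrow> nat \<Rightarrow> bool" where
  "chain W C k \<longleftrightarrow> (\<forall>i\<le>k. wideal W (C i)) \<and> (\<forall>i<k. C i \<subset> C (Suc i))"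

text \<open>The length of \<open>K/J\<close> over the localization at \<open>W\<close>: the lattice of ideals of the
  localization is the lattice of \<open>W\<close>-saturated ideals.\<close>
definition len :: "'a::comm_ring_1 set \<Rightarrow> 'a set \<Rightarrow> 'a set \<Rightarrow> enat" where
  "len W J K = Sup {enat k | k. \<exists>C. C 0 = J \<and> C k = K \<and> chain W C k}"

lemma wideal_one: "wideal {1} J \<longleftrightarrow> is_ideal J"
  by (auto simp: wideal_def)
lemma wideal_is_ideal: "wideal W J \<Longrightarrow> is_ideal J" by (simp add: wideal_def)
lemma wideal_cancel: "wideal W J \<Longrightarrow> s \<in> W \<Longrightarrow> s * f \<in> J \<Longrightarrow> f \<in> J" by (auto simp: wideal_def)
lemma wideal_UNIV: "wideal W UNIV" by (simp add: wideal_def is_ideal_UNIV)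
lemma wideal_Int: "wideal W J \<Longrightarrow> wideal W K \<Longrightarrow> wideal W (J \<inter> K)"
  by (simp add: wideal_def is_ideal_Int)
lemma wideal_colon: "wideal W J \<Longrightarrow> wideal W (colon J z)"
  by (simp add: wideal_def is_ideal_colon) (simp add: colon_def mult.left_commute)

text \<open>Localizing at \<open>{1}\<close> changes nothing, so one theory of \<open>len\<close>
  serves both \<open>R\<close> and \<open>R(t)\<close>.\<close>

lemma colength_eq_len: "colength I = len {1} I UNIV"
  unfolding colength_def len_def chain_def wideal_one by metis

lemma chain_mono: "chain W C k \<Longrightarrow> i \<le> j \<Longrightarrow> j \<le> k \<Longrightarrow> C i \<subseteq> C j"
proof (induction j)
  case (Suc j)
  show ?case
  proof (cases "i = Suc j")
    case False
    then have "C i \<subseteq> C j" using Suc by simp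
    also have "\<dots> \<subseteq> C (Suc j)" using Suc.prems unfolding chain_def by (metis Suc_le_eq psubset_imp_subset)
    finally show ?thesis .
  qed simp
qed simp

lemma chain_snoc: "chain W C k \<Longrightarrow> wideal W K \<Longrightarrow> C k \<subset> K \<Longrightarrow> chain W (C(Suc k := K)) (Suc k)"
  unfolding chain_def by (auto simp: le_Suc_eq less_Suc_eq)

lemma chain_append:
  assumes "chain W C k" "chain W D l" "C k = D 0"
  shows "chain W (\<lambda>i. if i \<le> k then C i else D (i - k)) (k + l)"
  unfolding chain_def
proof (intro conjI allI impI)
  fix i assume "i \<le> k + l"
  then show "wideal W (if i \<le> k then C i else D (i - k))" using assms by (auto simp: chain_def)
next
  fix i assume i: "i < k + l"
  consider "Suc i \<le> k" | "i = k" | "i > k" by linarith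
  then show "(if i \<le> k then C i else D (i - k)) \<subset> (if Suc i \<le> k then C (Suc i) else D (Suc i - k))"
  proof cases
    case 1 then show ?thesis using assms(1) by (auto simp: chain_def)
  next
    case 2
    then have "D 0 \<subset> D (Suc 0)" using assms(2) i unfolding chain_def by auto
    then show ?thesis using 2 assms by (simp add: Suc_diff_le)
  next
    case 3
    then have "D (i - k) \<subset> D (Suc (i - k))" using assms(2) i unfolding chain_def by auto
    then show ?thesis using 3 by (simp add: Suc_diff_le)
  qed
qed

lemma len_ge: "chain W C k \<Longrightarrow> C 0 = J \<Longrightarrow> C k = K \<Longrightarrow> enat k \<le> len W J K"
  unfolding len_def by (rule Sup_upper) blast

lemma len_least: "(\<And>C k. chain W C k \<Longrightarrow> C 0 = J \<Longrightarrow> C k = K \<Longrightarrow> enat k \<le> b) \<Longrightarrow> len W J K \<le> b"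
  unfolding len_def by (rule Sup_least) blast

lemma chain_exists:
  assumes "wideal W J" "wideal W K" "J \<subseteq> K"
  shows "\<exists>C k. chain W C k \<and> C 0 = J \<and> C k = K"
proof (cases "J = K")
  case True
  then show ?thesis using assms by (intro exI[of _ "\<lambda>_. J"] exI[of _ 0]) (auto simp: chain_def)
next
  case False
  then show ?thesis using assms
    by (intro exI[of _ "\<lambda>i. if i = 0 then J else K"] exI[of _ 1]) (auto simp: chain_def)
qed

text \<open>A supremum in \<open>enat\<close> may be infinite, but every finite number below it is
  still reached by an actual chain; this is what allows chains to be glued.\<close>

lemma len_ge_iff:
  assumes "wideal W J" "wideal W K" "J \<subseteq> K"
  shows "enat n \<le> len W J K \<longleftrightarrow> (\<exists>C k. n \<le> k \<and> chain W C k \<and> C 0 = J \<and> C k = K)"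
proof
  assume a: "enat n \<le> len W J K"
  show "\<exists>C k. n \<le> k \<and> chain W C k \<and> C 0 = J \<and> C k = K"
  proof (rule ccontr)
    assume neg: "\<not> ?thesis"
    then have "n > 0" using chain_exists[OF assms] by fastforce
    have "len W J K \<le> enat (n - 1)" 
    proof (rule len_least)
      fix C k assume "chain W C k" "C 0 = J" "C k = K"
      then have "\<not> n \<le> k" using neg by blast
      then show "enat k \<le> enat (n - 1)" by simp
    qed
    with a have "enat n \<le> enat (n - 1)" by (rule order_trans)
    with \<open>n > 0\<close> show False by simp
  qed
next
  assume "\<exists>C k. n \<le> k \<and> chain W C k \<and> C 0 = J \<and> C k = K"
  then show "enat n \<le> len W J K" using len_ge by (metis enat_ord_simps(1) order_trans)
qed

text \<open>Intersecting a strict chain with an ideal, or adding an ideal to it, can create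
  repetitions; dropping them leaves a strict chain whose length counts the surviving steps.\<close>

lemma weak_chain:
  assumes "\<forall>i\<le>k. wideal W (C i)" "\<forall>i<k. C i \<subseteq> C (Suc i)"
  shows "\<exists>D. chain W D (card {i. i < k \<and> C i \<noteq> C (Suc i)}) \<and> D 0 = C 0 \<and>
    D (card {i. i < k \<and> C i \<noteq> C (Suc i)}) = C k"
  using assms
proof (induction k)
  case 0
  then show ?case by (intro exI[of _ C]) (auto simp: chain_def)
next
  case (Suc k)
  let ?c = "card {i. i < k \<and> C i \<noteq> C (Suc i)}"
  obtain D where D: "chain W D ?c" "D 0 = C 0" "D ?c = C k" using Suc by auto
  show ?case
  proof (cases "C k = C (Suc k)")
    case True
    then have "{i. i < Suc k \<and> C i \<noteq> C (Suc i)} = {i. i < k \<and> C i \<noteq> C (Suc i)}"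
      by (auto simp: less_Suc_eq)
    with D True show ?thesis by auto
  next
    case False
    then have "{i. i < Suc k \<and> C i \<noteq> C (Suc i)} = insert k {i. i < k \<and> C i \<noteq> C (Suc i)}"
      by (auto simp: less_Suc_eq)
    then have c: "card {i. i < Suc k \<and> C i \<noteq> C (Suc i)} = Suc ?c" by simp
    have "chain W (D(Suc ?c := C (Suc k))) (Suc ?c)"
      using False Suc.prems D by (intro chain_snoc) auto
    moreover have "(D(Suc ?c := C (Suc k))) 0 = C 0" "(D(Suc ?c := C (Suc k))) (Suc ?c) = C (Suc k)"
      using D by auto
    ultimately show ?thesis unfolding c by blast
  qed
qed

lemma weak_chain_len:
  assumes "\<forall>i\<le>k. wideal W (C i)" "\<forall>i<k. C i \<subseteq> C (Suc i)"
  shows "enat (card {i. i < k \<and> C i \<noteq> C (Suc i)}) \<le> len W (C 0) (C k)"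
  using weak_chain[OF assms] by (elim exE conjE) (rule len_ge)

lemma len_le_map:
  assumes J: "wideal W J" and K: "wideal W K"
    and w: "\<And>L. wideal W L \<Longrightarrow> J \<subseteq> L \<Longrightarrow> L \<subseteq> K \<Longrightarrow> wideal V (F L)"
    and s: "\<And>L M. wideal W L \<Longrightarrow> wideal W M \<Longrightarrow> J \<subseteq> L \<Longrightarrow> L \<subset> M \<Longrightarrow> M \<subseteq> K \<Longrightarrow> F L \<subset> F M"
  shows "len W J K \<le> len V (F J) (F K)"
proof (rule len_least)
  fix C k assume c: "chain W C k" "C 0 = J" "C k = K"
  have b: "J \<subseteq> C i" "C i \<subseteq> K" if "i \<le> k" for i
    using chain_mono[OF c(1), of 0 i] chain_mono[OF c(1), of i k] c that by auto
  have "chain V (\<lambda>i. F (C i)) k" unfolding chain_def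
  proof (intro conjI allI impI)
    fix i assume "i \<le> k" then show "wideal V (F (C i))" using b c by (auto intro!: w simp: chain_def)
  next
    fix i assume i: "i < k" then show "F (C i) \<subset> F (C (Suc i))"
      using b c by (intro s) (auto simp: chain_def)
  qed
  then show "enat k \<le> len V (F J) (F K)" using c len_ge[of V "\<lambda>i. F (C i)" k] by simp
qed

section \<open>Length calculus in the lattice of saturated ideals\<close>

locale mult_set =
  fixes W :: "'a::comm_ring_1 set"
  assumes one_in: "1 \<in> W" and mult_in: "s \<in> W \<Longrightarrow> t \<in> W \<Longrightarrow> s * t \<in> W"
begin

lemma sat_upper: "J \<subseteq> sat W J"
  unfolding sat_def using one_in by force

lemma wideal_sat: assumes "is_ideal J" shows "wideal W (sat W J)"
  unfolding wideal_def is_ideal_def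
proof (intro conjI ballI allI impI)
  show "0 \<in> sat W J" using sat_upper assms is_ideal_0 by blast
next
  fix x y assume "x \<in> sat W J" "y \<in> sat W J"
  then obtain s t where st: "s \<in> W" "t \<in> W" "s * x \<in> J" "t * y \<in> J" unfolding sat_def by blast
  then have "t * (s * x) + s * (t * y) \<in> J" using assms is_ideal_add is_ideal_mult by blast
  then have "(s * t) * (x + y) \<in> J" by (simp add: algebra_simps)
  then show "x + y \<in> sat W J" unfolding sat_def using st mult_in by blast
next
  fix r x assume "x \<in> sat W J"
  then obtain s where "s \<in> W" "s * x \<in> J" unfolding sat_def by blast
  moreover have "s * (r * x) = r * (s * x)" by (rule mult.left_commute)
  ultimately show "r * x \<in> sat W J" unfolding sat_def using is_ideal_mult[OF assms, of "s * x" r] by (auto simp: mult.left_commute)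
next
  fix s f assume "s \<in> W" "s * f \<in> sat W J"
  then obtain t where "t \<in> W" "t * s * f \<in> J" unfolding sat_def by (auto simp: mult.assoc)
  then show "f \<in> sat W J" unfolding sat_def using \<open>s \<in> W\<close> mult_in by blast
qed

lemma sat_least: "wideal W K \<Longrightarrow> J \<subseteq> K \<Longrightarrow> sat W J \<subseteq> K"
  unfolding sat_def wideal_def by blast

lemma sat_mono: "J \<subseteq> K \<Longrightarrow> sat W J \<subseteq> sat W K"
  unfolding sat_def by blast

lemma sat_wideal: "wideal W K \<Longrightarrow> sat W K = K"
  using sat_least sat_upper by blast

text \<open>The join in the lattice of saturated ideals, that is, the sum taken in the localization;
  \<open>isum\<close> by itself may fail to be saturated.\<close>

definition wsum :: "'a set \<Rightarrow> 'a set \<Rightarrow> 'a set" where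
  "wsum J K = sat W (isum J K)"

lemma wideal_wsum: "is_ideal J \<Longrightarrow> is_ideal K \<Longrightarrow> wideal W (wsum J K)"
  unfolding wsum_def by (intro wideal_sat is_ideal_isum)
lemma wsum_upper1: "is_ideal K \<Longrightarrow> J \<subseteq> wsum J K"
  unfolding wsum_def using isum_upper1 sat_upper by blast
lemma wsum_upper2: "is_ideal J \<Longrightarrow> K \<subseteq> wsum J K"
  unfolding wsum_def using isum_upper2 sat_upper by blast
lemma wsum_least: "wideal W L \<Longrightarrow> J \<subseteq> L \<Longrightarrow> K \<subseteq> L \<Longrightarrow> wsum J K \<subseteq> L"
  unfolding wsum_def by (metis sat_least isum_least wideal_is_ideal)
lemma wsum_mono: "J \<subseteq> J' \<Longrightarrow> K \<subseteq> K' \<Longrightarrow> wsum J K \<subseteq> wsum J' K'"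
  unfolding wsum_def by (intro sat_mono isum_mono)
lemma wsum_absorb: "wideal W L \<Longrightarrow> is_ideal J \<Longrightarrow> J \<subseteq> L \<Longrightarrow> wsum J L = L"
  using wsum_least[of L J L] wsum_upper2[of J L] by blast
lemma wsum_absorb2: "wideal W L \<Longrightarrow> is_ideal J \<Longrightarrow> J \<subseteq> L \<Longrightarrow> wsum L J = L"
  using wsum_least[of L L J] wsum_upper1[of J L] by blast
lemma wsumE: assumes "x \<in> wsum J K" obtains s a b where "s \<in> W" "a \<in> J" "b \<in> K" "s * x = a + b"
  using assms unfolding wsum_def sat_def isum_def by blast
lemma wsumI: "s \<in> W \<Longrightarrow> a \<in> J \<Longrightarrow> b \<in> K \<Longrightarrow> s * x = a + b \<Longrightarrow> x \<in> wsum J K"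
  unfolding wsum_def sat_def isum_def by blast

text \<open>Modular law: up to a factor from \<open>W\<close>, an element of \<open>L\<close> is
  \<open>a + b\<close> with \<open>a\<close> in \<open>J\<close> and \<open>b\<close> in
  \<open>K\<close>; then \<open>b\<close> lies in \<open>L\<close> as well, hence in
  \<open>J\<close>.\<close>

lemma modular:
  assumes "wideal W J" "wideal W L" "is_ideal K" "J \<subseteq> L" "L \<inter> K \<subseteq> J" "L \<subseteq> wsum J K"
  shows "J = L"
proof
  show "L \<subseteq> J"
  proof
    fix x assume x: "x \<in> L"
    then obtain s a b where s: "s \<in> W" "a \<in> J" "b \<in> K" "s * x = a + b"
      using assms(6) by (meson subsetD wsumE)
    have "b = s * x - a" using s by simp
    also have "\<dots> \<in> L" using assms x s by (meson is_ideal_diff is_ideal_mult subsetD wideal_is_ideal)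
    finally have "b \<in> J" using assms s by blast
    then have "s * x \<in> J" using s assms wideal_is_ideal is_ideal_add by metis
    then show "x \<in> J" using s assms wideal_cancel by blast
  qed
qed fact

text \<open>For the upper bound a chain from \<open>J\<close> to \<open>L\<close> is projected to
  the interval below \<open>K\<close> by intersection and to the one above by summation; the lower
  bound concatenates chains.\<close>

lemma len_add:
  assumes J: "wideal W J" and K: "wideal W K" and L: "wideal W L" and "J \<subseteq> K" "K \<subseteq> L"
  shows "len W J L = len W J K + len W K L"
proof (rule antisym)
  show "len W J L \<le> len W J K + len W K L"
  proof (rule len_least)
    fix C k assume c: "chain W C k" "C 0 = J" "C k = L"
    have wi: "wideal W (C i)" if "i \<le> k" for i using c that by (auto simp: chain_def)
    let ?A = "{i. i < k \<and> C i \<inter> K \<noteq> C (Suc i) \<inter> K}"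
    let ?B = "{i. i < k \<and> wsum (C i) K \<noteq> wsum (C (Suc i)) K}"
    have A: "enat (card ?A) \<le> len W (C 0 \<inter> K) (C k \<inter> K)"
      using c wi K by (intro weak_chain_len[where C = "\<lambda>i. C i \<inter> K"]) (auto intro!: wideal_Int simp: chain_def)
    have B: "enat (card ?B) \<le> len W (wsum (C 0) K) (wsum (C k) K)"
    proof (rule weak_chain_len[where C = "\<lambda>i. wsum (C i) K"])
      show "\<forall>i\<le>k. wideal W (wsum (C i) K)"
        using wi K by (blast intro: wideal_wsum wideal_is_ideal)
      show "\<forall>i<k. wsum (C i) K \<subseteq> wsum (C (Suc i)) K"
      proof (intro allI impI)
        fix i assume "i < k"
        then have "C i \<subseteq> C (Suc i)" using c(1) by (auto simp: chain_def)
        then show "wsum (C i) K \<subseteq> wsum (C (Suc i)) K" by (rule wsum_mono) simp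
      qed
    qed
    have E: "C 0 \<inter> K = J" "C k \<inter> K = K" "wsum (C 0) K = K" "wsum (C k) K = L"
      using assms(4,5) c wsum_absorb[OF K wideal_is_ideal[OF J]] wsum_absorb2[OF L wideal_is_ideal[OF K]]
      by auto
    \<comment> \<open>By \<open>modular\<close>, a strict step cannot disappear both after
      intersecting with \<open>K\<close> and after adding \<open>K\<close>.\<close>
    have "{..<k} \<subseteq> ?A \<union> ?B"
    proof
      fix i assume "i \<in> {..<k}"
      then have i: "i < k" by simp
      then have ss: "C i \<subset> C (Suc i)" using c by (auto simp: chain_def)
      show "i \<in> ?A \<union> ?B"
      proof (rule ccontr)
        assume "i \<notin> ?A \<union> ?B"
        then have "C i \<inter> K = C (Suc i) \<inter> K" "wsum (C i) K = wsum (C (Suc i)) K" using i by auto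
        moreover have "C (Suc i) \<subseteq> wsum (C (Suc i)) K" using K by (intro wsum_upper1 wideal_is_ideal)
        ultimately have "C i = C (Suc i)" using ss wi i wideal_is_ideal[OF K]
          by (intro modular[of _ _ K]) auto
        with ss show False by simp
      qed
    qed
    then have "card {..<k} \<le> card ?A + card ?B"
      using card_mono[of "?A \<union> ?B" "{..<k}"] card_Un_le[of ?A ?B] by simp
    then have "enat k \<le> enat (card ?A) + enat (card ?B)" by simp
    also have "\<dots> \<le> len W J K + len W K L"
      using A B unfolding E by (rule add_mono)
    finally show "enat k \<le> len W J K + len W K L" .
  qed
next
  \<comment> \<open>Formulated with finite lower bounds, so that an infinite summand is handled by
    letting its bound grow.\<close>
  have *: "enat (n1 + n2) \<le> len W J L" if n: "enat n1 \<le> len W J K" "enat n2 \<le> len W K L" for n1 n2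
  proof -
    obtain C k where C: "n1 \<le> k" "chain W C k" "C 0 = J" "C k = K"
      using n len_ge_iff[OF J K] assms by auto
    obtain D l where D: "n2 \<le> l" "chain W D l" "D 0 = K" "D l = L"
      using n len_ge_iff[OF K L] assms by auto
    let ?E = "\<lambda>i. if i \<le> k then C i else D (i - k)"
    have "chain W ?E (k + l)" using C D by (intro chain_append) auto
    moreover have "?E (k + l) = L" using C D by (cases "l = 0") auto
    ultimately have "enat (k + l) \<le> len W J L" using C by (intro len_ge[of _ ?E]) auto
    moreover have "enat (n1 + n2) \<le> enat (k + l)" using C D by simp
    ultimately show ?thesis by (rule order_trans[rotated])
  qed
  show "len W J K + len W K L \<le> len W J L"
  proof (cases "len W J K")
    case (enat a)
    show ?thesis
    proof (cases "len W K L")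
      case (enat b) with \<open>len W J K = enat a\<close> show ?thesis using *[of a b] by simp
    next
      case infinity
      then have "enat n \<le> len W J L" for n using *[of 0 n] infinity by (simp flip: zero_enat_def)
      then have "len W J L = \<infinity>" by (metis enat.exhaust enat_ord_simps(1) Suc_n_not_le_n)
      then show ?thesis by simp
    qed
  next
    case infinity
    then have "enat n \<le> len W J L" for n using *[of n 0] infinity by (simp flip: zero_enat_def)
    then have "len W J L = \<infinity>" by (metis enat.exhaust enat_ord_simps(1) Suc_n_not_le_n)
    then show ?thesis by simp
  qed
qed

lemma len_refl: "len W J J = 0"
proof -
  have "k = 0" if "chain W C k" "C 0 = J" "C k = J" for C k
  proof (rule ccontr)
    assume "k \<noteq> 0"
    then have "C 0 \<subset> C (Suc 0)" "C (Suc 0) \<subseteq> C k"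
      using that chain_mono[OF that(1), of "Suc 0" k] by (auto simp: chain_def)
    then show False using that by auto
  qed
  then have "len W J J \<le> 0" by (intro len_least) (auto simp: zero_enat_def)
  then show ?thesis by simp
qed

lemma len_pos: assumes "wideal W J" "wideal W K" "J \<subset> K" shows "1 \<le> len W J K"
  using len_ge[of W "\<lambda>i. if i = 0 then J else K" 1 J K] assms by (auto simp: chain_def one_enat_def)

lemma len_mono:
  assumes "wideal W J" "wideal W J'" "wideal W K" "wideal W K'" "J \<subseteq> J'" "J' \<subseteq> K'" "K' \<subseteq> K"
  shows "len W J' K' \<le> len W J K"
proof -
  have "len W J K = len W J J' + (len W J' K' + len W K' K)"
    using len_add[of J J' K] len_add[of J' K' K] assms by simp
  also have "len W J' K' \<le> \<dots>" by (intro add_increasing add_increasing2) auto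
  finally show ?thesis .
qed

text \<open>Second isomorphism theorem: \<open>X/(X \<inter> Y)\<close> embeds in
  \<open>(X + Y)/Y\<close>.\<close>

lemma len_Int_le:
  assumes "wideal W X" "wideal W Y"
  shows "len W (X \<inter> Y) X \<le> len W Y (wsum X Y)"
proof -
  have "len W (X \<inter> Y) X \<le> len W (wsum (X \<inter> Y) Y) (wsum X Y)"
  proof (rule len_le_map)
    fix L assume "wideal W L" then show "wideal W (wsum L Y)" using assms by (intro wideal_wsum wideal_is_ideal)
  next
    fix L M assume LM: "wideal W L" "wideal W M" "X \<inter> Y \<subseteq> L" "L \<subset> M" "M \<subseteq> X"
    have "wsum L Y \<noteq> wsum M Y"
    proof
      assume e: "wsum L Y = wsum M Y"
      have "M \<subseteq> wsum M Y" using assms by (intro wsum_upper1 wideal_is_ideal)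
      then have "L = M" using LM assms e wideal_is_ideal[OF assms(2)]
        by (intro modular[of _ _ Y]) auto
      with LM show False by simp
    qed
    moreover have "wsum L Y \<subseteq> wsum M Y" using LM by (intro wsum_mono) auto
    ultimately show "wsum L Y \<subset> wsum M Y" by blast
  next
    show "wideal W (X \<inter> Y)" using assms by (intro wideal_Int)
  qed (use assms in auto)
  moreover have "wsum (X \<inter> Y) Y = Y" using assms by (intro wsum_absorb wideal_is_ideal[OF wideal_Int]) auto
  ultimately show ?thesis by simp
qed

text \<open>Multiplication by \<open>x\<close> induces an isomorphism from \<open>P/(P \<inter> (Q : x))\<close> to \<open>(Q + xP)/Q\<close>.\<close>
lemma len_mult_iso:
  assumes Q: "wideal W Q" and P: "wideal W P"
  shows "len W (P \<inter> colon Q x) P = len W Q (wsum Q ((*) x ` P))"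
proof (rule antisym)
  let ?F = "\<lambda>L. wsum Q ((*) x ` L)" and ?G = "\<lambda>L. P \<inter> colon L x"
  have iP: "is_ideal P" and iQ: "is_ideal Q" using P Q wideal_is_ideal by auto
  have wF: "wideal W (?F L)" if "is_ideal L" for L
    using that iQ by (intro wideal_wsum is_ideal_image)
  \<comment> \<open>\<open>?F\<close> and \<open>?G\<close> are the two directions of the lattice
    correspondence. Recovering \<open>L\<close> from \<open>?F L\<close> makes \<open>?F\<close>
    strictly monotone.\<close>
  have GF: "?G (?F L) = L" if L: "wideal W L" "P \<inter> colon Q x \<subseteq> L" "L \<subseteq> P" for L
  proof
    show "?G (?F L) \<subseteq> L"
    proof
      fix p assume "p \<in> ?G (?F L)"
      then have p: "p \<in> P" "x * p \<in> ?F L" by (auto simp: colon_def)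
      then obtain s a b where s: "s \<in> W" "a \<in> Q" "b \<in> L" "s * (x * p) = a + x * b"
        by (auto elim!: wsumE)
      then have "x * (s * p - b) = a" by (simp add: algebra_simps)
      moreover have "s * p - b \<in> P" using p s L iP by (blast intro: is_ideal_rules)
      ultimately have "s * p - b \<in> L" using L s by (auto simp: colon_def)
      then have "(s * p - b) + b \<in> L" using s L wideal_is_ideal is_ideal_add by blast
      then show "p \<in> L" using wideal_cancel[OF L(1) s(1)] by simp
    qed
    show "L \<subseteq> ?G (?F L)" using L wsum_upper2[OF iQ, of "(*) x ` L"] by (auto simp: colon_def)
  qed
  have "len W (P \<inter> colon Q x) P \<le> len W (?F (P \<inter> colon Q x)) (?F P)"
  proof (rule len_le_map)
    fix L M assume LM: "wideal W L" "wideal W M" "P \<inter> colon Q x \<subseteq> L" "L \<subset> M" "M \<subseteq> P"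
    have g: "?G (?F L) = L" "?G (?F M) = M" by (rule GF; use LM in auto)+
    have "?F L \<noteq> ?F M"
    proof
      assume "?F L = ?F M"
      then have "?G (?F L) = ?G (?F M)" by (rule arg_cong)
      then show False using LM unfolding g by simp
    qed
    moreover have "?F L \<subseteq> ?F M" using LM by (intro wsum_mono) auto
    ultimately show "?F L \<subset> ?F M" by blast
  next
    show "wideal W (P \<inter> colon Q x)" using P Q by (intro wideal_Int wideal_colon)
    show "wideal W P" by (rule P)
    fix L assume "wideal W L" then show "wideal W (?F L)" by (intro wF wideal_is_ideal)
  qed
  moreover have "?F (P \<inter> colon Q x) = Q"
  proof
    show "?F (P \<inter> colon Q x) \<subseteq> Q" using Q by (intro wsum_least) (auto simp: colon_def)
    show "Q \<subseteq> ?F (P \<inter> colon Q x)" using P Q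
      by (intro wsum_upper1 is_ideal_image is_ideal_Int is_ideal_colon wideal_is_ideal)
  qed
  ultimately show "len W (P \<inter> colon Q x) P \<le> len W Q (?F P)" by simp
  have "len W Q (?F P) \<le> len W (?G Q) (?G (?F P))"
  proof (rule len_le_map)
    fix L M assume LM: "wideal W L" "wideal W M" "Q \<subseteq> L" "L \<subset> M" "M \<subseteq> ?F P"
    have FG: "N \<subseteq> ?F (?G N)" if N: "wideal W N" "Q \<subseteq> N" "N \<subseteq> ?F P" for N
    proof
      fix l assume l: "l \<in> N"
      then obtain s a b where s: "s \<in> W" "a \<in> Q" "b \<in> P" "s * l = a + x * b"
        using N by (auto elim!: wsumE dest!: subsetD)
      have "x * b = s * l - a" using s by simp
      also have "\<dots> \<in> N" using l s N wideal_is_ideal by (blast intro: is_ideal_rules)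
      finally have "b \<in> ?G N" using s by (auto simp: colon_def)
      then show "l \<in> ?F (?G N)" using s by (intro wsumI[of s a _ "x * b"]) auto
    qed
    have "?F (?G L) \<subseteq> L" using LM by (intro wsum_least) (auto simp: colon_def)
    moreover have "M \<subseteq> ?F (?G M)" using LM by (intro FG) auto
    moreover have "?F (?G L) = ?F (?G M)" if "?G L = ?G M" using that by (rule arg_cong)
    ultimately have "?G L \<noteq> ?G M" using \<open>L \<subset> M\<close> by blast
    moreover have "?G L \<subseteq> ?G M" using LM by (auto simp: colon_def)
    ultimately show "?G L \<subset> ?G M" by blast
  next
    show "wideal W Q" by (rule Q)
    show "wideal W (?F P)" using iP by (rule wF)
    fix L assume "wideal W L" then show "wideal W (?G L)" using P by (intro wideal_Int wideal_colon)
  qed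
  also have "?G (?F P) = P" using GF[of P] P by auto
  finally show "len W Q (?F P) \<le> len W (P \<inter> colon Q x) P" .
qed

lemma len_colon: assumes "wideal W J" shows "len W (colon J x) UNIV = len W J (wsum J (principal x))"
  using len_mult_iso[OF assms wideal_UNIV, of x] by (simp add: principal_def)

text \<open>The exact sequence \<open>0 -> S/(J : x) -> S/J -> S/(J + xS) -> 0\<close>, whose first
  map is multiplication by \<open>x\<close>.\<close>

lemma len_colon_add:
  assumes "wideal W J"
  shows "len W J UNIV = len W (colon J x) UNIV + len W (wsum J (principal x)) UNIV"
  using len_add[of J "wsum J (principal x)" UNIV] assms
  by (simp add: len_colon wideal_wsum wideal_is_ideal is_ideal_principal wideal_UNIV wsum_upper1)

text \<open>The generators are added one at a time; each contributes a cyclic module annihilated by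
  \<open>q\<close>, hence a quotient of \<open>S/q\<close>.\<close>

lemma len_span_le:
  assumes J: "wideal W J" and q: "wideal W q" and fin: "finite G"
    and mul: "\<And>a g. a \<in> q \<Longrightarrow> g \<in> G \<Longrightarrow> a * g \<in> J"
  shows "len W J (sat W (isum J (ideal_gen G))) \<le> of_nat (card G) * len W q UNIV"
  using fin mul
proof (induction G)
  case empty
  have "isum J {0} = J" unfolding isum_def by simp
  then show ?case using J by (simp add: ideal_gen_empty sat_wideal len_refl)
next
  case (insert g G)
  let ?K = "wsum J (ideal_gen G)" and ?K' = "wsum J (ideal_gen (insert g G))"
  have iJ: "is_ideal J" using J wideal_is_ideal by auto
  have wK: "wideal W ?K" "wideal W ?K'" using iJ by (auto intro!: wideal_wsum is_ideal_gen)
  have sub: "ideal_gen G \<subseteq> ideal_gen (insert g G)"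
    using ideal_gen_superset[of "insert g G"] by (intro ideal_gen_least is_ideal_gen) auto
  have KK: "?K \<subseteq> ?K'" using sub by (intro wsum_mono) auto
  have JK: "J \<subseteq> ?K" by (intro wsum_upper1 is_ideal_gen)
  have gK: "ideal_gen (insert g G) \<subseteq> wsum ?K (principal g)"
  proof (rule ideal_gen_least)
    show "is_ideal (wsum ?K (principal g))"
      using wK by (intro wideal_is_ideal[OF wideal_wsum] is_ideal_principal wideal_is_ideal)
    have "G \<subseteq> ?K" using ideal_gen_superset[of G] wsum_upper2[OF iJ] by (rule order_trans)
    also have "\<dots> \<subseteq> wsum ?K (principal g)" by (rule wsum_upper1[OF is_ideal_principal])
    finally show "insert g G \<subseteq> wsum ?K (principal g)"
      using wsum_upper2[OF wideal_is_ideal[OF wK(1)], of "principal g"] principal_self[of g] by auto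
  qed
  have e: "?K' \<subseteq> wsum ?K (principal g)"
  proof (rule wsum_least)
    show "wideal W (wsum ?K (principal g))"
      using wK by (intro wideal_wsum is_ideal_principal wideal_is_ideal)
    show "J \<subseteq> wsum ?K (principal g)"
      using JK wsum_upper1[OF is_ideal_principal] by (rule order_trans)
  qed (rule gK)
  have "q \<subseteq> colon ?K g" using insert.prems JK by (auto simp: colon_def mult.commute)
  then have "len W (colon ?K g) UNIV \<le> len W q UNIV"
    using q wK by (intro len_mono wideal_colon wideal_UNIV) auto
  moreover have "len W ?K ?K' \<le> len W ?K (wsum ?K (principal g))"
    by (rule len_mono) (use e KK wK in \<open>auto intro: wideal_wsum is_ideal_principal wideal_is_ideal\<close>)
  ultimately have 1: "len W ?K ?K' \<le> len W q UNIV" using len_colon[OF wK(1)] by simp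
  have "len W J ?K' = len W J ?K + len W ?K ?K'"
    using J wK KK JK by (intro len_add) auto
  also have "\<dots> \<le> of_nat (card G) * len W q UNIV + len W q UNIV"
    using insert 1 by (intro add_mono) (auto simp: wsum_def)
  also have "\<dots> = of_nat (card (insert g G)) * len W q UNIV"
    using insert by (simp add: distrib_right add.commute)
  finally show ?case by (simp add: wsum_def)
qed

end

section \<open>Products and powers of ideals\<close>

lemma ideal_prod_mem: "a \<in> I \<Longrightarrow> b \<in> J \<Longrightarrow> a * b \<in> ideal_prod I J"
  unfolding ideal_prod_def by (rule subsetD[OF ideal_gen_superset]) blast
lemma ideal_prod_least: "is_ideal K \<Longrightarrow> (\<And>a b. a \<in> I \<Longrightarrow> b \<in> J \<Longrightarrow> a * b \<in> K) \<Longrightarrow> ideal_prod I J \<subseteq> K"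
  unfolding ideal_prod_def by (rule ideal_gen_least) auto
lemma is_ideal_prod: "is_ideal (ideal_prod I J)"
  unfolding ideal_prod_def by (rule is_ideal_gen)
lemma is_ideal_pow: "is_ideal (ideal_pow I n)"
  by (cases n) (simp_all add: is_ideal_UNIV is_ideal_prod)
lemma ideal_prod_mono: "I \<subseteq> I' \<Longrightarrow> J \<subseteq> J' \<Longrightarrow> ideal_prod I J \<subseteq> ideal_prod I' J'"
  by (rule ideal_prod_least[OF is_ideal_prod]) (auto intro: ideal_prod_mem)
lemma ideal_prod_subset: "is_ideal J \<Longrightarrow> ideal_prod I J \<subseteq> J"
  by (rule ideal_prod_least) (auto intro: is_ideal_mult)

lemma ideal_prod_gen_least:
  assumes "is_ideal K" "\<And>g b. g \<in> G \<Longrightarrow> b \<in> J \<Longrightarrow> g * b \<in> K"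
  shows "ideal_prod (ideal_gen G) J \<subseteq> K"
proof (rule ideal_prod_least[OF assms(1)])
  fix a b assume a: "a \<in> ideal_gen G" and b: "b \<in> J"
  have "ideal_gen G \<subseteq> colon K b"
    using assms b by (intro ideal_gen_least is_ideal_colon) (auto simp: colon_def mult.commute)
  then show "a * b \<in> K" using a by (auto simp: colon_def mult.commute)
qed

lemma ideal_pow_one: "is_ideal I \<Longrightarrow> ideal_pow I 1 = I"
proof -
  assume I: "is_ideal I"
  have "ideal_prod I UNIV \<subseteq> I" using I by (intro ideal_prod_least) (auto intro: is_ideal_mult')
  moreover have "I \<subseteq> ideal_prod I UNIV"
  proof
    fix x assume "x \<in> I"
    then show "x \<in> ideal_prod I UNIV" using ideal_prod_mem[of x I 1 UNIV] by simp
  qed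
  ultimately show ?thesis by simp
qed

lemma ideal_pow_Suc_subset: "ideal_pow I (Suc n) \<subseteq> ideal_pow I n"
  using ideal_prod_subset[OF is_ideal_pow] by simp

lemma ideal_pow_antimono: "m \<le> n \<Longrightarrow> ideal_pow I n \<subseteq> ideal_pow I m"
  by (rule lift_Suc_antimono_le[of "ideal_pow I"]) (rule ideal_pow_Suc_subset)

lemma ideal_pow_mono: "I \<subseteq> J \<Longrightarrow> ideal_pow I n \<subseteq> ideal_pow J n"
  by (induction n) (simp_all add: ideal_prod_mono)

lemma ideal_pow_mult: "x \<in> ideal_pow I m \<Longrightarrow> y \<in> ideal_pow I n \<Longrightarrow> x * y \<in> ideal_pow I (m + n)"
proof (induction m arbitrary: x)
  case 0
  then show ?case using is_ideal_mult[OF is_ideal_pow] by simp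
next
  case (Suc m)
  have "ideal_pow I (Suc m) \<subseteq> colon (ideal_pow I (Suc m + n)) y"
    unfolding ideal_pow.simps(2)
  proof (rule ideal_prod_least)
    show "is_ideal (colon (ideal_pow I (Suc m + n)) y)" by (intro is_ideal_colon is_ideal_pow)
    fix a b assume "a \<in> I" "b \<in> ideal_pow I m"
    then have "a * (b * y) \<in> ideal_pow I (Suc m + n)" using Suc by (simp add: ideal_prod_mem)
    then show "a * b \<in> colon (ideal_pow I (Suc m + n)) y" by (simp add: colon_def ac_simps)
  qed
  then show ?case using Suc.prems by (auto simp: colon_def mult.commute)
qed

definition ideal_prod_list :: "'a::comm_ring_1 set list \<Rightarrow> 'a set" where
  "ideal_prod_list Ps = foldr ideal_prod Ps UNIV"

lemma ideal_prod_list_simps: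
  "ideal_prod_list [] = UNIV" "ideal_prod_list (P # Ps) = ideal_prod P (ideal_prod_list Ps)"
  by (simp_all add: ideal_prod_list_def)

text \<open>Induction on the first list with \<open>K\<close> replaced by \<open>colon K a\<close>,
  which avoids expanding elements of a product ideal into sums of products.\<close>

lemma ideal_prod_list_append_least:
  assumes "is_ideal K" "\<And>x y. x \<in> ideal_prod_list Ps \<Longrightarrow> y \<in> ideal_prod_list Qs \<Longrightarrow> x * y \<in> K"
  shows "ideal_prod_list (Ps @ Qs) \<subseteq> K"
  using assms
proof (induction Ps arbitrary: K)
  case Nil
  show ?case
  proof
    fix y assume "y \<in> ideal_prod_list ([] @ Qs)"
    then show "y \<in> K" using Nil(2)[of 1 y] by (simp add: ideal_prod_list_simps)
  qed
next
  case (Cons P Ps)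
  have "ideal_prod P (ideal_prod_list (Ps @ Qs)) \<subseteq> K"
  proof (rule ideal_prod_least[OF Cons.prems(1)])
    fix a b assume a: "a \<in> P" and b: "b \<in> ideal_prod_list (Ps @ Qs)"
    have "ideal_prod_list (Ps @ Qs) \<subseteq> colon K a"
    proof (rule Cons.IH[OF is_ideal_colon[OF Cons.prems(1)]])
      fix x y assume "x \<in> ideal_prod_list Ps" "y \<in> ideal_prod_list Qs"
      then have "(a * x) * y \<in> K"
        using a by (intro Cons.prems(2)) (auto simp: ideal_prod_list_simps intro: ideal_prod_mem)
      then show "x * y \<in> colon K a" by (simp add: colon_def mult.assoc)
    qed
    then show "a * b \<in> K" using b by (auto simp: colon_def)
  qed
  then show ?case by (simp add: ideal_prod_list_simps)
qed

lemma ideal_prod_list_same: "(\<And>P. P \<in> set Ps \<Longrightarrow> P = M) \<Longrightarrow> ideal_prod_list Ps = ideal_pow M (length Ps)"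
  by (induction Ps) (auto simp: ideal_prod_list_simps)

lemma ideal_pow_add_least:
  assumes "is_ideal K" "\<And>x y. x \<in> ideal_pow I m \<Longrightarrow> y \<in> ideal_pow I n \<Longrightarrow> x * y \<in> K"
  shows "ideal_pow I (m + n) \<subseteq> K"
proof -
  have "ideal_pow I k = ideal_prod_list (replicate k I)" for k
    using ideal_prod_list_same[of "replicate k I" I] by simp
  then show ?thesis
    using ideal_prod_list_append_least[of K "replicate m I" "replicate n I"] assms by (simp add: replicate_add)
qed

lemma ideal_pow_pow_subset: "ideal_pow M c \<subseteq> I \<Longrightarrow> ideal_pow M (c * n) \<subseteq> ideal_pow I n"
proof (induction n)
  case (Suc n)
  have "ideal_pow M (c + c * n) \<subseteq> ideal_pow I (Suc n)"
  proof (rule ideal_pow_add_least[OF is_ideal_pow])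
    fix x y assume "x \<in> ideal_pow M c" "y \<in> ideal_pow M (c * n)"
    then show "x * y \<in> ideal_pow I (Suc n)" using Suc by (auto intro: ideal_prod_mem)
  qed
  then show ?case by simp
qed simp

lemma power_mem_ideal_pow: "x \<in> I \<Longrightarrow> x ^ n \<in> ideal_pow I n"
  by (induction n) (auto intro: ideal_prod_mem)

section \<open>Noetherian subrings and the Rees algebra\<close>

text \<open>Carrier-based notions are used because the Rees algebra is a subset of
  \<open>'a poly\<close> and not a type, whereas \<open>noetherian\<close> speaks of a whole
  type.\<close>

definition subring :: "'a::comm_ring_1 set \<Rightarrow> bool" where
  "subring A \<longleftrightarrow> 1 \<in> A \<and> (\<forall>x\<in>A. \<forall>y\<in>A. x - y \<in> A \<and> x * y \<in> A)"

definition submodule_over :: "'a::comm_ring_1 set \<Rightarrow> 'a set \<Rightarrow> bool" where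
  "submodule_over A J \<longleftrightarrow> 0 \<in> J \<and> (\<forall>x\<in>J. \<forall>y\<in>J. x + y \<in> J) \<and> (\<forall>a\<in>A. \<forall>x\<in>J. a * x \<in> J)"

definition span_over :: "'a::comm_ring_1 set \<Rightarrow> 'a set \<Rightarrow> 'a set" where
  "span_over A S = \<Inter>{J. submodule_over A J \<and> S \<subseteq> J}"

definition noetherian_subring :: "'a::comm_ring_1 set \<Rightarrow> bool" where
  "noetherian_subring A \<longleftrightarrow>
    (\<forall>J. submodule_over A J \<and> J \<subseteq> A \<longrightarrow> (\<exists>F. finite F \<and> F \<subseteq> J \<and> J \<subseteq> span_over A F))"

lemma submodule_span: "submodule_over A (span_over A S)"
  unfolding span_over_def submodule_over_def by blast
lemma span_over_superset: "S \<subseteq> span_over A S"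
  unfolding span_over_def by blast
lemma span_over_least: "submodule_over A J \<Longrightarrow> S \<subseteq> J \<Longrightarrow> span_over A S \<subseteq> J"
  unfolding span_over_def by blast

lemma subring_closed:
  assumes "subring A"
  shows "1 \<in> A" "0 \<in> A" "x \<in> A \<Longrightarrow> y \<in> A \<Longrightarrow> x * y \<in> A" "x \<in> A \<Longrightarrow> y \<in> A \<Longrightarrow> x - y \<in> A"
    "x \<in> A \<Longrightarrow> - x \<in> A" "x \<in> A \<Longrightarrow> y \<in> A \<Longrightarrow> x + y \<in> A"
proof -
  have one: "1 \<in> A" and mult: "x \<in> A \<Longrightarrow> y \<in> A \<Longrightarrow> x * y \<in> A"
    and diff: "x \<in> A \<Longrightarrow> y \<in> A \<Longrightarrow> x - y \<in> A" for x y
    using assms by (auto simp: subring_def)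
  have zero: "0 \<in> A" using diff[OF one one] by simp
  have minus: "- x \<in> A" if "x \<in> A" for x using diff[OF zero that] by simp
  show "1 \<in> A" "0 \<in> A" "x \<in> A \<Longrightarrow> y \<in> A \<Longrightarrow> x * y \<in> A" "x \<in> A \<Longrightarrow> y \<in> A \<Longrightarrow> x - y \<in> A"
    "x \<in> A \<Longrightarrow> - x \<in> A" by (fact one zero mult diff minus)+
  show "x \<in> A \<Longrightarrow> y \<in> A \<Longrightarrow> x + y \<in> A" using diff[of x "- y"] minus[of y] by simp
qed

text \<open>The values at \<open>x\<close> of polynomials over \<open>A\<close> of degree below
  \<open>d\<close>. Representations need not be unique, so leading coefficients belong to
  representations rather than to elements.\<close>

fun polys_below :: "'a::comm_ring_1 set \<Rightarrow> 'a \<Rightarrow> nat \<Rightarrow> 'a set" where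
  "polys_below A x 0 = {0}"
| "polys_below A x (Suc d) = {a * x ^ d + q | a q. a \<in> A \<and> q \<in> polys_below A x d}"

definition adjoin :: "'a::comm_ring_1 set \<Rightarrow> 'a \<Rightarrow> 'a set" where
  "adjoin A x = (\<Union>d. polys_below A x d)"

context
  fixes A :: "'a::comm_ring_1 set" and x :: 'a
  assumes A: "subring A"
begin

abbreviation "polys \<equiv> polys_below A x"

lemma polys_below_Suc_I: "a \<in> A \<Longrightarrow> q \<in> polys d \<Longrightarrow> a * x ^ d + q \<in> polys (Suc d)"
  by auto

lemma polys_below_Suc: "y \<in> polys d \<Longrightarrow> y \<in> polys (Suc d)"
  using polys_below_Suc_I[of 0 y d] subring_closed[OF A] by simp

lemma polys_below_mono: "d \<le> e \<Longrightarrow> polys d \<subseteq> polys e"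
  by (rule lift_Suc_mono_le[of "polys"]) (rule subsetI, rule polys_below_Suc)

lemma polys_below_add:
  "y \<in> polys d \<Longrightarrow> z \<in> polys d \<Longrightarrow> y + z \<in> polys d"
proof (induction d arbitrary: y z)
  case (Suc d)
  then obtain a q b r where "y = a * x ^ d + q" "z = b * x ^ d + r" "a \<in> A" "b \<in> A"
    "q \<in> polys d" "r \<in> polys d" by auto
  then show ?case using polys_below_Suc_I[of "a + b" "q + r" d] Suc.IH[of q r] subring_closed[OF A]
    by (simp add: algebra_simps del: polys_below.simps)
qed simp

lemma polys_below_scale:
  "c \<in> A \<Longrightarrow> y \<in> polys d \<Longrightarrow> c * y \<in> polys d"
proof (induction d arbitrary: y)
  case (Suc d)
  then obtain a q where "y = a * x ^ d + q" "a \<in> A" "q \<in> polys d" by auto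
  then show ?case using polys_below_Suc_I[of "c * a" "c * q" d] Suc subring_closed[OF A]
    by (simp add: algebra_simps del: polys_below.simps)
qed simp

lemma polys_below_0: "0 \<in> polys d"
  using polys_below_mono[of 0 d] by auto

lemma polys_below_diff:
  assumes "y \<in> polys d" "z \<in> polys d" shows "y - z \<in> polys d"
  using polys_below_add[OF assms(1) polys_below_scale[OF _ assms(2), of "-1"]] subring_closed[OF A] by simp

lemma polys_below_mult_var: "y \<in> polys d \<Longrightarrow> x * y \<in> polys (Suc d)"
proof (induction d arbitrary: y)
  case 0
  then show ?case using polys_below_0[of 1] by (simp del: polys_below.simps(2))
next
  case (Suc d)
  then obtain a q where "y = a * x ^ d + q" "a \<in> A" "q \<in> polys d" by auto
  then show ?case using polys_below_Suc_I[of a "x * q" "Suc d"] Suc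
    by (simp add: algebra_simps del: polys_below.simps)
qed

lemma polys_below_mult_power: "y \<in> polys d \<Longrightarrow> x ^ k * y \<in> polys (d + k)"
  by (induction k) (auto simp: mult.assoc dest: polys_below_mult_var simp del: polys_below.simps)

lemma adjoin_add: assumes "y \<in> adjoin A x" "z \<in> adjoin A x" shows "y + z \<in> adjoin A x"
proof -
  obtain d e where "y \<in> polys d" "z \<in> polys e" using assms by (auto simp: adjoin_def)
  then have "y \<in> polys (max d e)" "z \<in> polys (max d e)"
    using polys_below_mono[of d "max d e"] polys_below_mono[of e "max d e"] by auto
  then show ?thesis using polys_below_add unfolding adjoin_def by blast
qed

lemma adjoin_mult: assumes "y \<in> adjoin A x" "z \<in> adjoin A x" shows "y * z \<in> adjoin A x"
proof -
  have "y * z \<in> adjoin A x" if "y \<in> polys d" for d y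
    using that
  proof (induction d arbitrary: y)
    case 0
    then show ?case using polys_below_0 by (auto simp: adjoin_def)
  next
    case (Suc d)
    then obtain a q where y: "y = a * x ^ d + q" "a \<in> A" "q \<in> polys d" by auto
    obtain e where "z \<in> polys e" using assms by (auto simp: adjoin_def)
    then have "a * (x ^ d * z) \<in> polys (e + d)"
      by (intro polys_below_scale polys_below_mult_power y(2))
    then have "a * (x ^ d * z) \<in> adjoin A x" unfolding adjoin_def by blast
    moreover have "q * z \<in> adjoin A x" using Suc y by simp
    ultimately have "a * (x ^ d * z) + q * z \<in> adjoin A x" by (rule adjoin_add)
    then show ?case using y by (simp add: algebra_simps)
  qed
  then show ?thesis using assms by (auto simp: adjoin_def)
qed

lemma adjoin_superset: "A \<subseteq> adjoin A x"
proof
  fix a assume "a \<in> A"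
  then have "a \<in> polys (Suc 0)" by simp
  then show "a \<in> adjoin A x" unfolding adjoin_def by blast
qed

lemma adjoin_var: "x \<in> adjoin A x"
proof -
  have "x \<in> polys (Suc (Suc 0))"
    using polys_below_Suc_I[of 1 0 1] polys_below_0 subring_closed[OF A] by (simp del: polys_below.simps)
  then show ?thesis unfolding adjoin_def by blast
qed

lemma subring_adjoin: "subring (adjoin A x)"
proof -
  have "- y \<in> adjoin A x" if "y \<in> adjoin A x" for y
  proof -
    have "-1 \<in> adjoin A x" using adjoin_superset subring_closed[OF A] by blast
    then show ?thesis using adjoin_mult[of "-1" y] that by simp
  qed
  then have "y - z \<in> adjoin A x" if "y \<in> adjoin A x" "z \<in> adjoin A x" for y z
    using adjoin_add[of y "- z"] that by simp
  then show ?thesis unfolding subring_def using adjoin_mult adjoin_superset subring_closed[OF A] by blast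
qed

definition leading_coeffs :: "'a set \<Rightarrow> nat \<Rightarrow> 'a set" where
  "leading_coeffs K d = {a\<in>A. \<exists>q\<in>polys d. a * x ^ d + q \<in> K}"

lemma leading_coeffsI:
  "a \<in> A \<Longrightarrow> q \<in> polys d \<Longrightarrow> a * x ^ d + q \<in> K \<Longrightarrow> a \<in> leading_coeffs K d"
  unfolding leading_coeffs_def by blast

lemma leading_coeffsE:
  assumes "a \<in> leading_coeffs K d"
  obtains q where "a \<in> A" "q \<in> polys d" "a * x ^ d + q \<in> K"
  using assms unfolding leading_coeffs_def by blast

lemma submodule_leading_coeffs:
  assumes K: "submodule_over (adjoin A x) K" shows "submodule_over A (leading_coeffs K d)"
  unfolding submodule_over_def
proof (intro conjI ballI)
  note closed = subring_closed[OF A]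
  have Kadd: "y + z \<in> K" if "y \<in> K" "z \<in> K" for y z using K that by (auto simp: submodule_over_def)
  have Kmul: "r * y \<in> K" if "r \<in> adjoin A x" "y \<in> K" for r y using K that by (auto simp: submodule_over_def)
  have K0: "0 \<in> K" using K by (auto simp: submodule_over_def)
  show "0 \<in> leading_coeffs K d" by (rule leading_coeffsI[of 0 0]) (auto simp: polys_below_0 K0 closed)
  show "a + b \<in> leading_coeffs K d" if a: "a \<in> leading_coeffs K d" and b: "b \<in> leading_coeffs K d" for a b
  proof -
    obtain q where q: "a \<in> A" "q \<in> polys d" "a * x ^ d + q \<in> K" using a by (rule leading_coeffsE)
    obtain r where r: "b \<in> A" "r \<in> polys d" "b * x ^ d + r \<in> K" using b by (rule leading_coeffsE)
    have "(a * x ^ d + q) + (b * x ^ d + r) \<in> K" using q(3) r(3) by (rule Kadd)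
    then have "(a + b) * x ^ d + (q + r) \<in> K" by (simp add: algebra_simps)
    then show ?thesis using closed(6)[OF q(1) r(1)] polys_below_add[OF q(2) r(2)] by (intro leading_coeffsI)
  qed
  show "c * a \<in> leading_coeffs K d" if c: "c \<in> A" and a: "a \<in> leading_coeffs K d" for c a
  proof -
    obtain q where q: "a \<in> A" "q \<in> polys d" "a * x ^ d + q \<in> K" using a by (rule leading_coeffsE)
    then have "c * (a * x ^ d + q) \<in> K" using c adjoin_superset by (intro Kmul) auto
    then have "(c * a) * x ^ d + (c * q) \<in> K" by (simp add: algebra_simps)
    then show ?thesis using closed(3)[OF c q(1)] polys_below_scale[OF c q(2)] by (intro leading_coeffsI)
  qed
qed

text \<open>Hilbert's basis theorem; \<open>x\<close> need not be transcendental over \<open>A\<close>.\<close>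
lemma noetherian_adjoin:
  assumes noeth: "noetherian_subring A"
  shows "noetherian_subring (adjoin A x)"
  unfolding noetherian_subring_def
proof (intro allI impI, elim conjE)
  fix J assume J: "submodule_over (adjoin A x) J" "J \<subseteq> adjoin A x"
  have Jadd: "y + z \<in> J" if "y \<in> J" "z \<in> J" for y z using J that by (auto simp: submodule_over_def)
  have Jmul: "r * y \<in> J" if "r \<in> adjoin A x" "y \<in> J" for r y using J that by (auto simp: submodule_over_def)
  define L where "L = leading_coeffs J"
  have L_I: "a \<in> L d" if "a \<in> A" "q \<in> polys d" "a * x ^ d + q \<in> J" for a q d
    unfolding L_def using that by (rule leading_coeffsI)
  have L_mod: "submodule_over A (L d)" for d
    unfolding L_def using J(1) by (rule submodule_leading_coeffs)
  have L_Suc: "L d \<subseteq> L (Suc d)" for d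
  proof
    fix a assume "a \<in> L d"
    then obtain q where q: "a \<in> A" "q \<in> polys d" "a * x ^ d + q \<in> J"
      unfolding L_def by (rule leading_coeffsE)
    then have "x * (a * x ^ d + q) \<in> J" by (intro Jmul adjoin_var)
    then have "a * x ^ Suc d + x * q \<in> J" by (simp add: algebra_simps)
    then show "a \<in> L (Suc d)" using q polys_below_mult_var by (intro L_I)
  qed
  have L_mono: "L d \<subseteq> L e" if "d \<le> e" for d e using L_Suc that by (rule lift_Suc_mono_le[of L])
  have L_A: "L d \<subseteq> A" for d unfolding L_def leading_coeffs_def by blast
  have "\<exists>F. finite F \<and> F \<subseteq> L d \<and> L d \<subseteq> span_over A F" for d
    using noeth L_mod[of d] L_A[of d] unfolding noetherian_subring_def by blast
  then obtain F where F: "finite (F d)" "F d \<subseteq> L d" "L d \<subseteq> span_over A (F d)" for d by metis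
  have U_mod: "submodule_over A (\<Union>d. L d)"
    unfolding submodule_over_def
  proof (intro conjI ballI)
    show "0 \<in> (\<Union>d. L d)" using L_mod[of 0] by (auto simp: submodule_over_def)
  next
    fix a b assume "a \<in> (\<Union>d. L d)" "b \<in> (\<Union>d. L d)"
    then obtain d e where "a \<in> L d" "b \<in> L e" by blast
    then have "a \<in> L (max d e)" "b \<in> L (max d e)" using L_mono[of d "max d e"] L_mono[of e "max d e"] by auto
    then show "a + b \<in> (\<Union>d. L d)" using L_mod[of "max d e"] unfolding submodule_over_def by blast
  next
    fix c a assume "c \<in> A" "a \<in> (\<Union>d. L d)"
    then show "c * a \<in> (\<Union>d. L d)" using L_mod unfolding submodule_over_def by blast
  qed
  then obtain H where H: "finite H" "H \<subseteq> (\<Union>d. L d)" "(\<Union>d. L d) \<subseteq> span_over A H"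
    using noeth L_A unfolding noetherian_subring_def by (metis UN_least)
  \<comment> \<open>The union of the ascending ideals of leading coefficients is finitely generated,
    so it is already attained in some degree \<open>D\<close>.\<close>
  have "\<exists>D. H \<subseteq> L D" using H(1,2)
  proof (induction H)
    case (insert h H)
    then obtain D e where "H \<subseteq> L D" "h \<in> L e" by blast
    then show ?case using L_mono[of D "max D e"] L_mono[of e "max D e"] by (intro exI[of _ "max D e"]) auto
  qed simp
  then obtain D where "H \<subseteq> L D" by blast
  then have LD: "L d \<subseteq> L D" for d using span_over_least[OF L_mod, of H D] H(3) by blast
  \<comment> \<open>For each generator of \<open>L d\<close>, an element of \<open>J\<close> with
    that leading coefficient; those of degree at most \<open>D\<close> will generate
    \<open>J\<close>.\<close>
  define wit where "wit d a = (SOME y. y \<in> J \<and> (\<exists>q\<in>polys d. y = a * x ^ d + q))" for d a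
  have wit: "wit d a \<in> J" "\<exists>q\<in>polys d. wit d a = a * x ^ d + q" if "a \<in> F d" for a d
  proof -
    have "\<exists>y. y \<in> J \<and> (\<exists>q\<in>polys d. y = a * x ^ d + q)"
      using that F(2)[of d] unfolding L_def leading_coeffs_def by blast
    from someI_ex[OF this] show "wit d a \<in> J" "\<exists>q\<in>polys d. wit d a = a * x ^ d + q"
      unfolding wit_def by blast+
  qed
  define G where "G = (\<Union>d\<le>D. wit d ` F d)"
  let ?S = "span_over (adjoin A x) G"
  have S: "submodule_over (adjoin A x) ?S" by (rule submodule_span)
  have G: "finite G" "G \<subseteq> J" unfolding G_def using F(1) wit(1) by auto
  have SJ: "?S \<subseteq> J" using G J by (intro span_over_least)
  have lead: "L d \<subseteq> leading_coeffs ?S d" if d: "d \<le> D" for d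
  proof -
    have "F d \<subseteq> leading_coeffs ?S d"
    proof
      fix a assume a: "a \<in> F d"
      have "wit d a \<in> ?S" using span_over_superset[of G] a d unfolding G_def by blast
      moreover obtain q where q: "q \<in> polys d" "wit d a = a * x ^ d + q" using wit(2)[OF a] by blast
      moreover have "a \<in> A" using F(2) L_A a by blast
      ultimately show "a \<in> leading_coeffs ?S d" by (intro leading_coeffsI[of a q]) simp_all
    qed
    with F(3)[of d] show ?thesis using span_over_least[OF submodule_leading_coeffs[OF S]] by blast
  qed
  have "y \<in> ?S" if "y \<in> J" "y \<in> polys d" for y d
    using that
  proof (induction d arbitrary: y)
    case 0
    then show ?case using S by (auto simp: submodule_over_def)
  next
    case (Suc d)
    then obtain a q where y: "y = a * x ^ d + q" "a \<in> A" "q \<in> polys d" by auto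
    \<comment> \<open>Beyond degree \<open>D\<close> the leading coefficient already occurs in
      degree \<open>D\<close>, and the missing factor \<open>x ^ (d - e)\<close> is multiplied on
      before subtracting.\<close>
    define e where "e = min d D"
    have "a \<in> L d" using y Suc.prems(1) by (intro L_I) auto
    then have "a \<in> L e" using LD[of d] unfolding e_def by (auto simp: min_def)
    then have "a \<in> leading_coeffs ?S e" using lead[of e] by (auto simp: e_def)
    then obtain r where r: "r \<in> polys e" "a * x ^ e + r \<in> ?S" by (rule leading_coeffsE)
    have "x ^ k \<in> adjoin A x" for k
      by (induction k) (auto simp: subring_closed[OF subring_adjoin] adjoin_var)
    then have S': "x ^ (d - e) * (a * x ^ e + r) \<in> ?S" using r S unfolding submodule_over_def by blast
    have "x ^ (d - e) * x ^ e = x ^ d" by (simp add: e_def flip: power_add)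
    then have eq: "x ^ (d - e) * (a * x ^ e + r) = a * x ^ d + x ^ (d - e) * r"
      by (simp add: distrib_left mult.left_commute)
    define z where "z = x ^ (d - e) * r"
    have z: "a * x ^ d + z \<in> ?S" using S' unfolding eq z_def .
    have "z \<in> polys d"
      using polys_below_mult_power[OF r(1), of "d - e"] by (simp add: e_def z_def)
    then have d: "q - z \<in> polys d" using y polys_below_diff by blast
    have "(-1) * (a * x ^ d + z) \<in> J"
      using z SJ subring_closed[OF subring_adjoin] by (intro Jmul) auto
    then have "y + (-1) * (a * x ^ d + z) \<in> J" using Suc.prems Jadd by blast
    then have "q - z \<in> J" using y by (simp add: algebra_simps)
    then have "q - z \<in> ?S" using d Suc.IH by blast
    then have "(q - z) + (a * x ^ d + z) \<in> ?S" using z S unfolding submodule_over_def by blast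
    then show ?case using y by (simp add: algebra_simps)
  qed
  then have "J \<subseteq> ?S" using J(2) unfolding adjoin_def by blast
  then show "\<exists>F. finite F \<and> F \<subseteq> J \<and> J \<subseteq> span_over (adjoin A x) F" using G by blast
qed

end

fun adjoin_list :: "'a::comm_ring_1 set \<Rightarrow> 'a list \<Rightarrow> 'a set" where
  "adjoin_list A [] = A"
| "adjoin_list A (x # xs) = adjoin (adjoin_list A xs) x"

lemma adjoin_list:
  assumes "subring A"
  shows "subring (adjoin_list A xs)" and "noetherian_subring A \<Longrightarrow> noetherian_subring (adjoin_list A xs)"
    and "A \<subseteq> adjoin_list A xs" and "set xs \<subseteq> adjoin_list A xs"
proof (induction xs)
  case (Cons x xs)
  { case 1 then show ?case using Cons subring_adjoin by simp }
  { case 2 then show ?case using Cons noetherian_adjoin by simp }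
  { case 3 then show ?case using Cons adjoin_superset[OF Cons.IH(1)] by auto }
  { case 4 then show ?case using Cons adjoin_superset[OF Cons.IH(1)] adjoin_var[OF Cons.IH(1)] by auto }
qed (use assms in auto)

lemma adjoin_list_least:
  assumes "subring B" "A \<subseteq> B" "set xs \<subseteq> B"
  shows "adjoin_list A xs \<subseteq> B"
  using assms(3)
proof (induction xs)
  case (Cons x xs)
  have "y \<in> B" if "y \<in> polys_below (adjoin_list A xs) x d" for y d
    using that
  proof (induction d arbitrary: y)
    case (Suc d)
    then obtain a q where "y = a * x ^ d + q" "a \<in> adjoin_list A xs" "q \<in> polys_below (adjoin_list A xs) x d"
      by auto
    moreover have "x ^ d \<in> B" using Cons.prems by (induction d) (auto simp: subring_closed[OF assms(1)])
    ultimately show ?case using Suc.IH Cons.IH Cons.prems by (auto intro!: subring_closed(3,6)[OF assms(1)])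
  qed (simp add: subring_closed[OF assms(1)])
  then show ?case by (auto simp: adjoin_def)
qed (use assms in simp)

section \<open>The Rees algebra inside the polynomial ring\<close>

definition const_polys :: "'a::comm_ring_1 poly set" where
  "const_polys = range (\<lambda>c. [:c:])"

lemma subring_const_polys: "subring const_polys"
  unfolding subring_def const_polys_def by (auto simp: one_pCons)

lemma noetherian_const_polys:
  assumes "noetherian TYPE('a::comm_ring_1)"
  shows "noetherian_subring (const_polys :: 'a poly set)"
  unfolding noetherian_subring_def
proof (intro allI impI, elim conjE)
  fix J :: "'a poly set" assume J: "submodule_over const_polys J" "J \<subseteq> const_polys"
  have ideal: "is_ideal {c. [:c:] \<in> K}" if "submodule_over const_polys K" for K :: "'a poly set"
    unfolding is_ideal_def
  proof (intro conjI ballI allI impI)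
    show "0 \<in> {c. [:c:] \<in> K}" using that by (simp add: submodule_over_def)
  next
    fix a b assume "a \<in> {c. [:c:] \<in> K}" "b \<in> {c. [:c:] \<in> K}"
    then have "[:a:] + [:b:] \<in> K" using that by (auto simp: submodule_over_def simp del: add_pCons)
    then show "a + b \<in> {c. [:c:] \<in> K}" by simp
  next
    fix r c assume "c \<in> {c. [:c:] \<in> K}"
    then have "[:r:] * [:c:] \<in> K" using that unfolding submodule_over_def const_polys_def by blast
    then show "r * c \<in> {c. [:c:] \<in> K}" by (simp add: mult.commute)
  qed
  obtain S where S: "finite S" "{c. [:c:] \<in> J} = ideal_gen S"
    using assms ideal[OF J(1)] unfolding noetherian_def by blast
  let ?F = "(\<lambda>c. [:c:]) ` S"
  have "S \<subseteq> {c. [:c:] \<in> span_over const_polys ?F}" using span_over_superset[of ?F const_polys] by auto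
  then have "ideal_gen S \<subseteq> {c. [:c:] \<in> span_over const_polys ?F}"
    using ideal[OF submodule_span] by (intro ideal_gen_least)
  then have "J \<subseteq> span_over const_polys ?F" using J(2) S(2) by (auto simp: const_polys_def)
  moreover have "?F \<subseteq> J" using S ideal_gen_superset[of S] by auto
  ultimately show "\<exists>F. finite F \<and> F \<subseteq> J \<and> J \<subseteq> span_over const_polys F" using S by blast
qed

definition rees :: "'a::comm_ring_1 list \<Rightarrow> 'a poly set" where
  "rees gs = adjoin_list const_polys (map (\<lambda>g. monom g 1) gs)"

text \<open>Joins two views of the Rees algebra: generated by finitely many \<open>g X\<close>, it
  is Noetherian by the basis theorem; described by coefficients, it is ready for graded
  families.\<close>

lemma rees_eq: "rees gs = {p. \<forall>n. coeff p n \<in> ideal_pow (ideal_gen (set gs)) n}"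
proof
  let ?I = "ideal_gen (set gs)"
  let ?B = "{p. \<forall>n. coeff p n \<in> ideal_pow ?I n}"
  have I: "is_ideal ?I" by (rule is_ideal_gen)
  have "subring ?B"
    unfolding subring_def
  proof (intro conjI ballI)
    show "1 \<in> ?B" by (auto simp: one_pCons coeff_pCons split: nat.split intro: is_ideal_0[OF is_ideal_pow] simp del: ideal_pow.simps(2))
  next
    fix p q assume pq: "p \<in> ?B" "q \<in> ?B"
    then show "p - q \<in> ?B" by (auto intro: is_ideal_diff[OF is_ideal_pow])
    have "coeff p i * coeff q (n - i) \<in> ideal_pow ?I n" if "i \<le> n" for i n
      using ideal_pow_mult[of "coeff p i" ?I i "coeff q (n - i)" "n - i"] pq that by simp
    then show "p * q \<in> ?B" by (auto simp: coeff_mult intro!: is_ideal_sum[OF is_ideal_pow])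
  qed
  moreover have "const_polys \<subseteq> ?B"
    by (auto simp: const_polys_def coeff_pCons split: nat.split intro: is_ideal_0[OF is_ideal_pow] simp del: ideal_pow.simps(2))
  moreover have "monom g 1 \<in> ?B" if "g \<in> set gs" for g
  proof -
    have "g \<in> ideal_pow ?I 1" unfolding ideal_pow_one[OF I] using ideal_gen_superset that by blast
    then show ?thesis by (simp add: is_ideal_0[OF is_ideal_pow] del: ideal_pow.simps)
  qed
  then have "set (map (\<lambda>g. monom g 1) gs) \<subseteq> ?B" by auto
  ultimately show "rees gs \<subseteq> ?B" unfolding rees_def by (rule adjoin_list_least)
  have R: "subring (rees gs)" unfolding rees_def by (intro adjoin_list subring_const_polys)
  have const: "[:c:] \<in> rees gs" for c
    using adjoin_list(3)[OF subring_const_polys] unfolding rees_def const_polys_def by blast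
  have ideal: "is_ideal {c. monom c n \<in> rees gs}" for n
    unfolding is_ideal_def
  proof (intro conjI ballI allI impI)
    show "0 \<in> {c. monom c n \<in> rees gs}" using subring_closed[OF R] by simp
    show "a + b \<in> {c. monom c n \<in> rees gs}" if "a \<in> {c. monom c n \<in> rees gs}" "b \<in> {c. monom c n \<in> rees gs}" for a b
      using that subring_closed[OF R] by (simp flip: add_monom)
    show "r * c \<in> {c. monom c n \<in> rees gs}" if "c \<in> {c. monom c n \<in> rees gs}" for r c
      using that subring_closed(3)[OF R const[of r], of "monom c n"] by (simp add: smult_monom)
  qed
  have gen: "?I \<subseteq> {c. monom c 1 \<in> rees gs}"
    using adjoin_list(4)[OF subring_const_polys, of "map (\<lambda>g. monom g 1) gs"] unfolding rees_def[symmetric]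
    by (intro ideal_gen_least ideal) auto
  have pow: "ideal_pow ?I n \<subseteq> {c. monom c n \<in> rees gs}" for n
  proof (induction n)
    case 0
    then show ?case using const by (auto simp: monom_0)
  next
    case (Suc n)
    show ?case unfolding ideal_pow.simps
    proof (rule ideal_prod_least[OF ideal])
      fix a b assume "a \<in> ?I" "b \<in> ideal_pow ?I n"
      then have "monom a 1 * monom b n \<in> rees gs" using gen Suc subring_closed(3)[OF R] by blast
      then show "a * b \<in> {c. monom c (Suc n) \<in> rees gs}" by (simp add: mult_monom)
    qed
  qed
  have sum: "sum f X \<in> rees gs" if "\<And>i. i \<in> X \<Longrightarrow> f i \<in> rees gs" for f and X :: "nat set"
    using that by (induction X rule: infinite_finite_induct) (auto simp: subring_closed[OF R])
  show "?B \<subseteq> rees gs"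
  proof
    fix p assume "p \<in> ?B"
    then have "(\<Sum>i\<le>degree p. monom (coeff p i) i) \<in> rees gs" using pow by (intro sum) blast
    then show "p \<in> rees gs" by (simp add: poly_as_sum_of_monoms)
  qed
qed

text \<open>Homogeneous ideals of the Rees algebra, given by their graded components.\<close>
definition rees_family :: "'a::comm_ring_1 set \<Rightarrow> (nat \<Rightarrow> 'a set) \<Rightarrow> bool" where
  "rees_family I P \<longleftrightarrow> (\<forall>n. is_ideal (P n) \<and> P n \<subseteq> ideal_pow I n) \<and>
    (\<forall>n. \<forall>x\<in>I. \<forall>y\<in>P n. x * y \<in> P (Suc n))"

lemma rees_family_mult:
  assumes "rees_family I P" "y \<in> P n"
  shows "x \<in> ideal_pow I m \<Longrightarrow> x * y \<in> P (m + n)"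
proof (induction m arbitrary: x)
  case 0
  then show ?case using assms by (auto simp: rees_family_def intro: is_ideal_mult)
next
  case (Suc m)
  have "ideal_pow I (Suc m) \<subseteq> colon (P (Suc m + n)) y"
    unfolding ideal_pow.simps(2)
  proof (rule ideal_prod_least)
    show "is_ideal (colon (P (Suc m + n)) y)" using assms by (intro is_ideal_colon) (auto simp: rees_family_def)
    fix a b assume ab: "a \<in> I" "b \<in> ideal_pow I m"
    then have "b * y \<in> P (m + n)" using Suc by blast
    then have "a * (b * y) \<in> P (Suc m + n)" using assms ab by (auto simp: rees_family_def)
    then show "a * b \<in> colon (P (Suc m + n)) y" by (simp add: colon_def ac_simps)
  qed
  then show ?case using Suc.prems by (auto simp: colon_def mult.commute)
qed

text \<open>The polynomials with \<open>n\<close>-th coefficient in \<open>P n\<close> form an ideal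
  of the Noetherian Rees algebra. Above the degrees of its finitely many generators, everything
  arises by multiplication with elements of positive degree. This is the mechanism of the Artin-Rees
  lemma.\<close>

lemma rees_family_stable:
  assumes noeth: "noetherian TYPE('a::comm_ring_1)" and fam: "rees_family (ideal_gen (set gs)) P"
  shows "\<exists>n0. \<forall>n\<ge>n0. P (Suc n) \<subseteq> ideal_prod (ideal_gen (set gs)) (P n :: 'a set)"
proof -
  let ?I = "ideal_gen (set gs)"
  have iP: "is_ideal (P n)" and Psub: "P n \<subseteq> ideal_pow ?I n" for n using fam by (auto simp: rees_family_def)
  define J where "J = {p. \<forall>n. coeff p n \<in> P n}"
  have J: "submodule_over (rees gs) J" unfolding submodule_over_def
  proof (intro conjI ballI)
    show "0 \<in> J" using iP is_ideal_0 by (auto simp: J_def)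
    show "p + q \<in> J" if "p \<in> J" "q \<in> J" for p q using that is_ideal_add[OF iP] by (auto simp: J_def)
    show "r * p \<in> J" if "r \<in> rees gs" "p \<in> J" for r p
    proof -
      have "coeff r i * coeff p (n - i) \<in> P n" if "i \<le> n" for i n
        using rees_family_mult[OF fam, of "coeff p (n - i)" "n - i" "coeff r i" i] \<open>r \<in> rees gs\<close> \<open>p \<in> J\<close> that
        by (auto simp: J_def rees_eq)
      then show ?thesis by (auto simp: J_def coeff_mult intro!: is_ideal_sum[OF iP])
    qed
  qed
  have "J \<subseteq> rees gs" unfolding J_def rees_eq using Psub by blast
  moreover have "noetherian_subring (rees gs)"
    unfolding rees_def by (intro adjoin_list subring_const_polys noetherian_const_polys noeth)
  ultimately obtain G where G: "finite G" "G \<subseteq> J" "J \<subseteq> span_over (rees gs) G"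
    unfolding noetherian_subring_def using J by meson
  define n0 where "n0 = (\<Sum>g\<in>G. degree g)"
  have deg: "degree g \<le> n0" if "g \<in> G" for g unfolding n0_def using that G(1) by (intro member_le_sum) auto
  \<comment> \<open>The condition is imposed only in degrees \<open>n > n0\<close>, so
    \<open>n - 1\<close> is never truncated; the generators have zero coefficients there and satisfy
    it trivially.\<close>
  let ?Q = "\<lambda>n. ideal_prod ?I (P (n - 1))"
  have iQ: "is_ideal (?Q n)" for n by (rule is_ideal_prod)
  let ?K = "{p\<in>J. \<forall>n>n0. coeff p n \<in> ?Q n}"
  have "submodule_over (rees gs) ?K" unfolding submodule_over_def
  proof (intro conjI ballI)
    show "0 \<in> ?K" using J is_ideal_0[OF iQ] by (auto simp: submodule_over_def)
    show "p + q \<in> ?K" if "p \<in> ?K" "q \<in> ?K" for p q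
      using that J is_ideal_add[OF iQ] by (auto simp: submodule_over_def)
    show "r * p \<in> ?K" if r: "r \<in> rees gs" and p: "p \<in> ?K" for r p
    proof -
      have "coeff r i * coeff p (n - i) \<in> ?Q n" if n: "n > n0" "i \<le> n" for i n
      proof (cases i)
        case 0
        then show ?thesis using p n by (auto intro: is_ideal_mult is_ideal_prod)
      next
        case (Suc k)
        \<comment> \<open>A coefficient of positive degree \<open>i\<close> supplies one factor from
          \<open>?I\<close>; its other \<open>i - 1\<close> factors raise
          \<open>coeff p (n - i)\<close> into degree \<open>n - 1\<close>.\<close>
        have "ideal_pow ?I i \<subseteq> colon (?Q n) (coeff p (n - i))"
          unfolding Suc ideal_pow.simps
        proof (rule ideal_prod_least[OF is_ideal_colon[OF iQ]])
          fix a b assume ab: "a \<in> ?I" "b \<in> ideal_pow ?I k"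
          have "b * coeff p (n - i) \<in> P (k + (n - i))"
            using p ab by (intro rees_family_mult[OF fam]) (auto simp: J_def)
          moreover have "k + (n - i) = n - 1" using Suc n by simp
          ultimately have "a * (b * coeff p (n - i)) \<in> ?Q n" using ab by (intro ideal_prod_mem) auto
          then show "a * b \<in> colon (?Q n) (coeff p (n - Suc k))" using Suc by (simp add: colon_def ac_simps)
        qed
        then show ?thesis using r by (auto simp: rees_eq colon_def mult.commute)
      qed
      moreover have "r * p \<in> J" using J r p by (auto simp: submodule_over_def)
      ultimately show ?thesis by (auto simp: coeff_mult intro!: is_ideal_sum[OF is_ideal_prod])
    qed
  qed
  moreover have "G \<subseteq> ?K"
  proof -
    have "coeff g n \<in> ?Q n" if "g \<in> G" "n > n0" for g n
      using deg[OF that(1)] that(2) is_ideal_0[OF iQ] by (simp add: coeff_eq_0)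
    then show ?thesis using G(2) by auto
  qed
  ultimately have K: "J \<subseteq> ?K" using G(3) span_over_least[of "rees gs" ?K G] by blast
  have "P (Suc n) \<subseteq> ideal_prod ?I (P n)" if "n \<ge> n0" for n
  proof
    fix c assume c: "c \<in> P (Suc n)"
    then have "monom c (Suc n) \<in> J" using iP is_ideal_0 by (auto simp: J_def)
    then have "monom c (Suc n) \<in> ?K" by (rule subsetD[OF K])
    moreover have "Suc n > n0" using that by simp
    ultimately have "coeff (monom c (Suc n)) (Suc n) \<in> ?Q (Suc n)" by blast
    then show "c \<in> ideal_prod ?I (P n)" by simp
  qed
  then show ?thesis by blast
qed

section \<open>Hilbert--Samuel polynomials\<close>

global_interpretation one: mult_set "{1 :: 'a::comm_ring_1}"
  by standard auto

lemma sat_one: "sat {1} J = J" by (simp add: sat_def)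
lemma wsum_one: "one.wsum J K = isum J K" by (simp add: one.wsum_def sat_one)

section \<open>Eventually polynomial functions\<close>

definition eventually_poly :: "(nat \<Rightarrow> real) \<Rightarrow> bool" where
  "eventually_poly f \<longleftrightarrow> (\<exists>q. \<forall>\<^sub>F n in sequentially. f n = poly q (real n))"

lemma eventually_poly_diff:
  assumes "eventually_poly f" "eventually_poly g"
  shows "eventually_poly (\<lambda>n. f n - g n)"
proof -
  obtain p q where "\<forall>\<^sub>F n in sequentially. f n = poly p (real n)" "\<forall>\<^sub>F n in sequentially. g n = poly q (real n)"
    using assms by (auto simp: eventually_poly_def)
  then have "\<forall>\<^sub>F n in sequentially. f n - g n = poly (p - q) (real n)"
    by eventually_elim simp
  then show ?thesis unfolding eventually_poly_def by blast
qed

lemma eventually_poly_Suc: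
  assumes "eventually_poly f" shows "eventually_poly (\<lambda>n. f (Suc n))"
proof -
  obtain p where "\<forall>\<^sub>F n in sequentially. f n = poly p (real n)"
    using assms by (auto simp: eventually_poly_def)
  then have "\<forall>\<^sub>F n in sequentially. f (Suc n) = poly p (real (Suc n))"
    by (subst eventually_sequentially_Suc)
  then have "\<forall>\<^sub>F n in sequentially. f (Suc n) = poly (pcompose p [:1, 1:]) (real n)"
    by eventually_elim (simp add: poly_pcompose)
  then show ?thesis unfolding eventually_poly_def by blast
qed

lemma poly_antidifference: "\<exists>q. \<forall>x. poly q (x + 1) - poly q x = poly p (x :: real)"
proof -
  have mon: "\<exists>q. \<forall>x::real. poly q (x + 1) - poly q x = x ^ n" for n
  proof (induction n rule: less_induct)
    case (less n)
    then have "\<forall>k\<in>{..<n}. \<exists>q. \<forall>x::real. poly q (x + 1) - poly q x = x ^ k" by blast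
    then obtain Q where Q: "\<And>k x. k < n \<Longrightarrow> poly (Q k) (x + 1) - poly (Q k) x = (x::real) ^ k"
      by (auto dest!: bchoice)
    \<comment> \<open>The binomial expansion of \<open>(x + 1)^(n + 1) - x^(n + 1)\<close> is
      \<open>(n + 1) x^n\<close> plus lower powers, whose antidifferences \<open>Q k\<close> are
      subtracted.\<close>
    define q where "q = smult (1 / real (Suc n)) (monom 1 (Suc n) - (\<Sum>k<n. smult (real (Suc n choose k)) (Q k)))"
    have "poly q (x + 1) - poly q x = x ^ n" for x
    proof -
      have "(x + 1) ^ Suc n = (\<Sum>k\<le>Suc n. real (Suc n choose k) * x ^ k)"
        by (subst binomial_ring) simp
      also have "\<dots> = (\<Sum>k<n. real (Suc n choose k) * x ^ k) + real (Suc n) * x ^ n + x ^ Suc n"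
        by (simp add: lessThan_Suc_atMost[symmetric] del: power_Suc)
      finally have e: "(x + 1) ^ Suc n - x ^ Suc n - (\<Sum>k<n. real (Suc n choose k) * x ^ k) = real (Suc n) * x ^ n"
        by simp
      have s: "(\<Sum>k<n. real (Suc n choose k) * poly (Q k) (x + 1)) - (\<Sum>k<n. real (Suc n choose k) * poly (Q k) x)
        = (\<Sum>k<n. real (Suc n choose k) * x ^ k)"
        using Q by (simp flip: sum_subtractf right_diff_distrib)
      have pq: "poly q y = (y ^ Suc n - (\<Sum>k<n. real (Suc n choose k) * poly (Q k) y)) / real (Suc n)" for y
        unfolding q_def by (simp add: poly_monom poly_sum del: power_Suc binomial_Suc_Suc)
      have "real (Suc n) * (poly q (x + 1) - poly q x) =
        (x + 1) ^ Suc n - x ^ Suc n - ((\<Sum>k<n. real (Suc n choose k) * poly (Q k) (x + 1)) -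
          (\<Sum>k<n. real (Suc n choose k) * poly (Q k) x))"
        unfolding pq diff_divide_distrib[symmetric] by (simp del: power_Suc binomial_Suc_Suc of_nat_Suc)
      also have "\<dots> = real (Suc n) * x ^ n" unfolding s by (rule e)
      finally show ?thesis by (subst (asm) mult_cancel_left) auto
    qed
    then show ?case by blast
  qed
  then obtain Q where Q: "poly (Q k) (x + 1) - poly (Q k) x = x ^ k" for k and x :: real by metis
  have "poly (\<Sum>k\<le>degree p. smult (coeff p k) (Q k)) (x + 1) - poly (\<Sum>k\<le>degree p. smult (coeff p k) (Q k)) x
    = poly p x" for x
    using Q by (simp add: poly_sum poly_altdef[of p] flip: sum_subtractf right_diff_distrib)
  then show ?thesis by blast
qed

lemma eventually_poly_sum:
  assumes "eventually_poly (\<lambda>n. f (Suc n) - f n)" shows "eventually_poly f"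
proof -
  obtain p where "\<forall>\<^sub>F n in sequentially. f (Suc n) - f n = poly p (real n)"
    using assms by (auto simp: eventually_poly_def)
  then obtain N where N: "f (Suc n) - f n = poly p (real n)" if "n \<ge> N" for n
    by (auto simp: eventually_sequentially)
  obtain q where q: "poly q (x + 1) - poly q x = poly p x" for x using poly_antidifference by blast
  have "f n = poly (q + [:f N - poly q (real N):]) (real n)" if "n \<ge> N" for n
    using that
  proof (induction n rule: dec_induct)
    case (step n)
    then show ?case using N[of n] q[of "real n"] by (simp add: add.commute)
  qed simp
  then show ?thesis unfolding eventually_poly_def eventually_sequentially by blast
qed

text \<open>Splitting off the three lowest coefficients leaves \<open>x^2\<close> times
  \<open>poly (pCons 0 r) x\<close>, which is unbounded relative to \<open>x^2\<close> unless
  \<open>r = 0\<close>.\<close>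

lemma eventually_poly_quadratic:
  assumes "eventually_poly f" and bound: "\<And>n. \<bar>f n\<bar> \<le> C * (real n + 1)\<^sup>2"
  shows "\<exists>a b c. \<forall>\<^sub>F n in sequentially. f n = a * (real n)\<^sup>2 + b * real n + c"
proof -
  obtain q where q: "\<forall>\<^sub>F n in sequentially. f n = poly q (real n)"
    using assms by (auto simp: eventually_poly_def)
  obtain c q1 where q1: "q = pCons c q1" by (rule pCons_cases)
  obtain b q2 where q2: "q1 = pCons b q2" by (rule pCons_cases)
  obtain a r where r: "q2 = pCons a r" by (rule pCons_cases)
  have eq: "poly q x = c + b * x + a * x\<^sup>2 + x\<^sup>2 * poly (pCons 0 r) x" for x
    by (simp add: q1 q2 r power2_eq_square algebra_simps)
  have C: "C \<ge> 0" using bound[of 0] by simp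
  have r0: "r = 0"
  proof (rule ccontr)
    assume "r \<noteq> 0"
    then have "filterlim (poly (pCons 0 r)) at_infinity at_infinity"
      by (intro filterlim_poly_at_infinity) simp
    then have "filterlim (\<lambda>n. poly (pCons 0 r) (real n)) at_infinity sequentially"
      by (rule filterlim_compose) (rule filterlim_real_at_infinity_sequentially)
    \<comment> \<open>The threshold is chosen for a contradiction: \<open>4 * C\<close> covers
      \<open>(n + 1)^2 \<le> 4 n^2\<close>, the absolute values cover the split-off terms, and the
      final \<open>1\<close> is the excess.\<close>
    then have "\<forall>\<^sub>F n in sequentially. norm (poly (pCons 0 r) (real n)) \<ge> 4 * C + \<bar>a\<bar> + \<bar>b\<bar> + \<bar>c\<bar> + 1"
      unfolding filterlim_at_infinity[OF order_refl] using C by (elim allE impE) auto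
    with q have "\<forall>\<^sub>F n in sequentially. False"
      using eventually_ge_at_top[of 1]
    proof eventually_elim
      case (elim n)
      let ?x = "real n"
      have x1: "1 \<le> ?x" using elim by simp
      have x: "1 \<le> ?x" "?x \<le> ?x\<^sup>2" "1 \<le> ?x\<^sup>2"
        using x1 self_le_power[OF x1, of 2] one_le_power[OF x1, of 2] by simp_all
      have "?x\<^sup>2 * (4 * C + \<bar>a\<bar> + \<bar>b\<bar> + \<bar>c\<bar> + 1) \<le> ?x\<^sup>2 * \<bar>poly (pCons 0 r) ?x\<bar>"
        using elim by (intro mult_left_mono) auto
      also have "\<dots> = \<bar>f n - (c + b * ?x + a * ?x\<^sup>2)\<bar>" using elim eq[of ?x] by (simp add: abs_mult)
      also have "\<dots> \<le> \<bar>f n\<bar> + (\<bar>c\<bar> + \<bar>b\<bar> * ?x + \<bar>a\<bar> * ?x\<^sup>2)"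
        by (rule order_trans[OF abs_triangle_ineq4]) (auto simp: abs_mult intro!: order_trans[OF abs_triangle_ineq] add_mono)
      also have "\<dots> \<le> C * (4 * ?x\<^sup>2) + (\<bar>c\<bar> * ?x\<^sup>2 + \<bar>b\<bar> * ?x\<^sup>2 + \<bar>a\<bar> * ?x\<^sup>2)"
      proof (intro add_mono)
        have "(?x + 1)\<^sup>2 \<le> (2 * ?x)\<^sup>2" using x by (intro power_mono) auto
        then have "C * (?x + 1)\<^sup>2 \<le> C * (4 * ?x\<^sup>2)" using C by (intro mult_left_mono) (auto simp: power_mult_distrib)
        then show "\<bar>f n\<bar> \<le> C * (4 * ?x\<^sup>2)" using bound[of n] by linarith
        show "\<bar>c\<bar> \<le> \<bar>c\<bar> * ?x\<^sup>2" using mult_left_mono[OF x(3), of "\<bar>c\<bar>"] by simp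
        show "\<bar>b\<bar> * ?x \<le> \<bar>b\<bar> * ?x\<^sup>2" using mult_left_mono[OF x(2), of "\<bar>b\<bar>"] by simp
      qed simp
      also have "\<dots> = ?x\<^sup>2 * (4 * C + \<bar>a\<bar> + \<bar>b\<bar> + \<bar>c\<bar>)" by (simp add: algebra_simps)
      finally have "?x\<^sup>2 \<le> 0" by (simp add: algebra_simps)
      then show False using x by linarith
    qed
    then show False by simp
  qed
  from q have "\<forall>\<^sub>F n in sequentially. f n = a * (real n)\<^sup>2 + b * real n + c"
    by eventually_elim (simp add: eq r0)
  then show ?thesis by blast
qed

section \<open>The Hilbert-Serre theorem for graded families\<close>

definition rlen :: "'a::comm_ring_1 set \<Rightarrow> 'a set \<Rightarrow> real" where
  "rlen J K = real (the_enat (len {1} J K))"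

lemma enat_le_finite: "a \<le> b \<Longrightarrow> b \<noteq> \<infinity> \<Longrightarrow> a \<noteq> (\<infinity>::enat)"
  by (cases a; cases b) simp_all

lemma the_enat_add: "a \<noteq> \<infinity> \<Longrightarrow> b \<noteq> \<infinity> \<Longrightarrow> the_enat (a + b) = the_enat a + the_enat b"
  by (cases a; cases b) auto

lemma rlen_add:
  assumes "is_ideal J" "is_ideal K" "is_ideal L" "J \<subseteq> K" "K \<subseteq> L" "len {1} J L \<noteq> \<infinity>"
  shows "rlen J L = rlen J K + rlen K L"
proof -
  have eq: "len {1} J L = len {1} J K + len {1} K L"
    using assms by (intro one.len_add) (simp_all add: wideal_one)
  then have "len {1} J K \<noteq> \<infinity>" "len {1} K L \<noteq> \<infinity>" using assms(6) plus_eq_infty_iff_enat by auto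
  then show ?thesis by (simp add: rlen_def eq the_enat_add)
qed

text \<open>The Hilbert--Serre argument, by induction on the set of generators of \<open>I\<close> that
  are not known to annihilate \<open>P/Q\<close>.\<close>
lemma hilbert_serre:
  assumes noeth: "noetherian TYPE('a::comm_ring_1)" and "finite G"
  shows "rees_family (ideal_gen (set gs)) P \<Longrightarrow> rees_family (ideal_gen (set gs)) Q \<Longrightarrow>
    (\<And>n. Q n \<subseteq> P n) \<Longrightarrow> (\<And>n. len {1} (Q n) (P n :: 'a set) \<noteq> \<infinity>) \<Longrightarrow>
    (\<And>g n y. g \<in> set gs - G \<Longrightarrow> y \<in> P n \<Longrightarrow> g * y \<in> Q (Suc n)) \<Longrightarrow>
    eventually_poly (\<lambda>n. rlen (Q n) (P n))"
  using assms(2)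
proof (induction G arbitrary: P Q rule: finite_induct)
  case empty
  let ?I = "ideal_gen (set gs)"
  obtain n0 where n0: "P (Suc n) \<subseteq> ideal_prod ?I (P n)" if "n \<ge> n0" for n
    using rees_family_stable[OF noeth empty.prems(1)] by blast
  have "rlen (Q n) (P n) = poly 0 (real n)" if "n \<ge> Suc n0" for n
  proof -
    obtain m where m: "n = Suc m" "m \<ge> n0" using \<open>n \<ge> Suc n0\<close> by (cases n) auto
    have "ideal_prod ?I (P m) \<subseteq> Q (Suc m)"
      using empty.prems by (intro ideal_prod_gen_least) (auto simp: rees_family_def)
    then have "P n = Q n" using n0[OF m(2)] m(1) empty.prems(3)[of n] by auto
    then show ?thesis by (simp add: rlen_def one.len_refl zero_enat_def)
  qed
  then show ?case unfolding eventually_poly_def eventually_sequentially by blast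
next
  case (insert x G)
  let ?I = "ideal_gen (set gs)"
  show ?case
  proof (cases "x \<in> set gs")
    case False
    then show ?thesis using insert.prems by (intro insert.IH) auto
  next
    case True
    then have xI: "x \<in> ?I" using ideal_gen_superset by blast
    have iP: "is_ideal (P n)" "is_ideal (Q n)" and P_sub: "P n \<subseteq> ideal_pow ?I n" for n
      using insert.prems by (auto simp: rees_family_def)
    have P_mult: "a * y \<in> P (Suc n)" if "a \<in> ?I" "y \<in> P n" for a y n
      using insert.prems(1) that by (auto simp: rees_family_def)
    have Q_mult: "a * y \<in> Q (Suc n)" if "a \<in> ?I" "y \<in> Q n" for a y n
      using insert.prems(2) that by (auto simp: rees_family_def)
    note QP = insert.prems(3)
    \<comment> \<open>\<open>K n / Q n\<close> is the kernel, and \<open>E n / Q (Suc n)\<close> the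
      image, of multiplication by \<open>x\<close> from \<open>P n / Q n\<close> to
      \<open>P (Suc n) / Q (Suc n)\<close>.\<close>
    define K where "K n = P n \<inter> colon (Q (Suc n)) x" for n
    define E where "E n = isum (Q (Suc n)) ((*) x ` P n)" for n
    \<comment> \<open>The image indexed by its own degree; nothing is mapped into degree 0, hence
      \<open>Q 0\<close> there.\<close>
    define C where "C n = (case n of 0 \<Rightarrow> Q 0 | Suc m \<Rightarrow> E m)" for n
    have iK: "is_ideal (K n)" for n unfolding K_def using iP by (intro is_ideal_Int is_ideal_colon)
    have iE: "is_ideal (E n)" for n unfolding E_def using iP by (intro is_ideal_isum is_ideal_image)
    have iC: "is_ideal (C n)" for n using iE iP by (auto simp: C_def split: nat.split)
    have QK: "Q n \<subseteq> K n" for n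
      using QP Q_mult[OF xI] by (auto simp: K_def colon_def)
    have KP: "K n \<subseteq> P n" for n by (simp add: K_def)
    have EP: "E n \<subseteq> P (Suc n)" for n
      unfolding E_def using iP QP P_mult[OF xI] by (intro isum_least) auto
    have QE: "Q (Suc n) \<subseteq> E n" for n
      unfolding E_def using iP by (intro isum_upper1 is_ideal_image)
    have xE: "x * y \<in> E n" if "y \<in> P n" for y n
      unfolding E_def using isum_upper2[OF iP(2), of "(*) x ` P n"] that by blast
    have CP: "C n \<subseteq> P n" for n using EP QP by (auto simp: C_def split: nat.split)
    have QC: "Q n \<subseteq> C n" for n using QE by (auto simp: C_def split: nat.split)
    have famK: "rees_family ?I K"
      unfolding rees_family_def
    proof (intro conjI allI ballI)
      show "K n \<subseteq> ideal_pow ?I n" for n using KP P_sub by blast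
      fix n a y assume a: "a \<in> ?I" and y: "y \<in> K n"
      have "a * (x * y) \<in> Q (Suc (Suc n))" using y by (intro Q_mult[OF a]) (auto simp: K_def colon_def)
      then show "a * y \<in> K (Suc n)" using P_mult[OF a] y by (auto simp: K_def colon_def mult.left_commute)
    qed (rule iK)
    have famC: "rees_family ?I C"
      unfolding rees_family_def
    proof (intro conjI allI ballI)
      show "C n \<subseteq> ideal_pow ?I n" for n using CP P_sub by blast
      fix n a y assume a: "a \<in> ?I" and y: "y \<in> C n"
      show "a * y \<in> C (Suc n)"
      proof (cases n)
        case 0
        then show ?thesis using Q_mult[OF a, of y 0] y QE[of 0] by (auto simp: C_def)
      next
        case (Suc m)
        then obtain q p where qp: "y = q + x * p" "q \<in> Q n" "p \<in> P m"
          using y by (auto simp: C_def E_def isum_def)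
        have "a * q \<in> E n" using Q_mult[OF a qp(2)] QE by blast
        moreover have "x * (a * p) \<in> E n" using P_mult[OF a qp(3)] Suc by (intro xE) simp
        ultimately have "a * q + x * (a * p) \<in> E n" by (rule is_ideal_add[OF iE])
        then show ?thesis using qp by (simp add: C_def algebra_simps)
      qed
    qed (rule iC)
    have fin: "len {1} (Q n) (P n) \<noteq> \<infinity>" for n by (rule insert.prems(4))
    have finK: "len {1} (Q n) (K n) \<noteq> \<infinity>" for n
      by (rule enat_le_finite[OF one.len_mono fin[of n]]) (simp_all add: wideal_one iP iK QK KP)
    have finC: "len {1} (C n) (P n) \<noteq> \<infinity>" for n
      by (rule enat_le_finite[OF one.len_mono fin[of n]]) (simp_all add: wideal_one iP iC QC CP)
    \<comment> \<open>\<open>x\<close> annihilates both the kernel \<open>K/Q\<close> and the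
      cokernel \<open>P/C\<close>, so the induction hypothesis applies to each with \<open>x\<close>
      removed from the remaining generators.\<close>
    have K: "eventually_poly (\<lambda>n. rlen (Q n) (K n))"
    proof (rule insert.IH[OF famK insert.prems(2) QK finK])
      fix g n y assume g: "g \<in> set gs - G" "y \<in> K n"
      show "g * y \<in> Q (Suc n)"
        using insert.prems(5)[of g y n] g by (cases "g = x") (auto simp: K_def colon_def)
    qed
    have C: "eventually_poly (\<lambda>n. rlen (C n) (P n))"
    proof (rule insert.IH[OF insert.prems(1) famC CP finC])
      fix g n y assume g: "g \<in> set gs - G" "y \<in> P n"
      show "g * y \<in> C (Suc n)"
        using insert.prems(5)[of g y n] g QC[of "Suc n"] xE[of y n] by (cases "g = x") (auto simp: C_def)
    qed
    \<comment> \<open>The four-term exact sequence of multiplication by \<open>x\<close>: the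
      lengths in adjacent degrees differ by cokernel minus kernel.\<close>
    have "rlen (Q (Suc n)) (P (Suc n)) - rlen (Q n) (P n) = rlen (C (Suc n)) (P (Suc n)) - rlen (Q n) (K n)" for n
    proof -
      have "rlen (K n) (P n) = rlen (Q (Suc n)) (C (Suc n))"
        using one.len_mult_iso[of "Q (Suc n)" "P n" x] iP
        by (simp add: rlen_def K_def C_def E_def wsum_one wideal_one)
      moreover have "rlen (Q n) (P n) = rlen (Q n) (K n) + rlen (K n) (P n)"
        using iP iK QK KP fin by (intro rlen_add)
      moreover have "rlen (Q (Suc n)) (P (Suc n)) = rlen (Q (Suc n)) (C (Suc n)) + rlen (C (Suc n)) (P (Suc n))"
        using iP iC QC CP fin by (intro rlen_add)
      ultimately show ?thesis by simp
    qed
    then have "eventually_poly (\<lambda>n. rlen (Q (Suc n)) (P (Suc n)) - rlen (Q n) (P n))"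
      using eventually_poly_diff[OF eventually_poly_Suc[OF C] K] by simp
    then show ?thesis by (rule eventually_poly_sum)
  qed
qed

text \<open>Hilbert-Serre for the associated graded ring, with \<open>P n = I^n\<close> and
  \<open>Q n = I^(n+1)\<close>; the successive quotients are then summed.\<close>

lemma eventually_poly_colength:
  assumes noeth: "noetherian TYPE('a::comm_ring_1)" and I: "is_ideal (I :: 'a set)"
    and fin: "\<And>n. len {1} (ideal_pow I n) UNIV \<noteq> \<infinity>"
  shows "eventually_poly (\<lambda>n. rlen (ideal_pow I n) UNIV)"
proof -
  obtain S where S: "finite S" "I = ideal_gen S" using noeth I unfolding noetherian_def by blast
  then obtain gs where gs: "set gs = S" using finite_list by blast
  have Ig: "I = ideal_gen (set gs)" using S gs by simp
  have sub: "ideal_pow I (Suc n) \<subseteq> ideal_pow I n" for n by (rule ideal_pow_Suc_subset)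
  have "eventually_poly (\<lambda>n. rlen (ideal_pow I (Suc n)) (ideal_pow I n))"
  proof (rule hilbert_serre[OF noeth finite_set[of gs], of gs "ideal_pow I" "\<lambda>n. ideal_pow I (Suc n)"])
    show "rees_family (ideal_gen (set gs)) (ideal_pow I)"
      unfolding rees_family_def Ig[symmetric] by (auto intro: is_ideal_pow ideal_prod_mem)
    show "rees_family (ideal_gen (set gs)) (\<lambda>n. ideal_pow I (Suc n))"
      unfolding rees_family_def Ig[symmetric] using sub
      by (auto intro: is_ideal_pow ideal_prod_mem is_ideal_prod simp del: ideal_pow.simps) (simp add: ideal_prod_mem)
    show "ideal_pow I (Suc n) \<subseteq> ideal_pow I n" for n by (rule sub)
    show "len {1} (ideal_pow I (Suc n)) (ideal_pow I n) \<noteq> \<infinity>" for n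
    proof -
      have "len {1} (ideal_pow I (Suc n)) (ideal_pow I n) \<le> len {1} (ideal_pow I (Suc n)) UNIV"
        using sub[of n] by (intro one.len_mono) (simp_all add: wideal_one is_ideal_pow is_ideal_UNIV is_ideal_prod)
      then show ?thesis using fin by (rule enat_le_finite)
    qed
  qed simp
  moreover have "rlen (ideal_pow I (Suc n)) UNIV = rlen (ideal_pow I (Suc n)) (ideal_pow I n) + rlen (ideal_pow I n) UNIV" for n
    by (intro rlen_add is_ideal_pow is_ideal_UNIV sub fin subset_UNIV)
  ultimately have "eventually_poly (\<lambda>n. rlen (ideal_pow I (Suc n)) UNIV - rlen (ideal_pow I n) UNIV)"
    by simp
  then show ?thesis by (rule eventually_poly_sum)
qed

section \<open>Finite lengths in a Noetherian local ring\<close>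

lemma max_ideal_mem: "x \<in> max_ideal \<longleftrightarrow> \<not> x dvd 1" by (simp add: max_ideal_def)

lemma proper_subset_max_ideal: assumes "is_ideal J" "J \<noteq> UNIV" shows "J \<subseteq> max_ideal"
proof
  fix x assume x: "x \<in> J"
  show "x \<in> max_ideal" unfolding max_ideal_mem
  proof
    assume "x dvd 1"
    then obtain y where "1 = x * y" by (rule dvdE)
    then have "1 \<in> J" using is_ideal_mult'[OF assms(1) x, of y] by simp
    then show False using is_ideal_one assms by blast
  qed
qed

lemma one_notin_max_ideal: "1 \<notin> max_ideal" by (simp add: max_ideal_mem)

lemma (in mult_set) len_maximal_le:
  assumes "\<And>L. wideal W L \<Longrightarrow> m \<subset> L \<Longrightarrow> L = UNIV"
  shows "len W m UNIV \<le> 1"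
proof (rule len_least)
  fix C k assume c: "chain W C k" "C 0 = m" "C k = UNIV"
  show "enat k \<le> 1"
  proof (rule ccontr)
    assume "\<not> ?thesis"
    then have k: "k \<ge> 2" by (simp add: one_enat_def)
    then have "C 0 \<subset> C (Suc 0)" "C (Suc 0) \<subset> C (Suc (Suc 0))" "wideal W (C (Suc 0))"
      using c(1) by (auto simp: chain_def)
    then show False using assms[of "C (Suc 0)"] c by auto
  qed
qed

lemma len_max_ideal_le: "len {1} max_ideal UNIV \<le> 1"
  by (rule one.len_maximal_le) (use proper_subset_max_ideal in \<open>auto simp: wideal_one\<close>)

lemma max_ideal_is_ideal: "local_ring TYPE('a::comm_ring_1) \<Longrightarrow> is_ideal (max_ideal :: 'a set)"
  by (simp add: local_ring_def)

lemma enat_mult_finite: "b \<noteq> \<infinity> \<Longrightarrow> of_nat k * b \<noteq> (\<infinity>::enat)"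
  by (cases b) (simp_all add: of_nat_eq_enat)

text \<open>\<open>I^n/I^(n+1)\<close> is generated by the elements of \<open>G\<close>, each of
  which is annihilated by \<open>I\<close>.\<close>

lemma len_pow_step:
  assumes I: "is_ideal I" and G: "finite G" "ideal_pow I n = ideal_gen G"
  shows "len {1} (ideal_pow I (Suc n)) (ideal_pow I n) \<le> of_nat (card G) * len {1} I UNIV"
    and "len {1} (ideal_pow I (Suc n)) UNIV =
      len {1} (ideal_pow I (Suc n)) (ideal_pow I n) + len {1} (ideal_pow I n) UNIV"
proof -
  have sub: "ideal_pow I (Suc n) \<subseteq> ideal_pow I n" by (rule ideal_pow_Suc_subset)
  have "len {1} (ideal_pow I (Suc n)) (sat {1} (isum (ideal_pow I (Suc n)) (ideal_gen G)))
    \<le> of_nat (card G) * len {1} I UNIV"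
  proof (rule one.len_span_le[OF _ _ G(1)])
    fix a g assume "a \<in> I" "g \<in> G"
    then show "a * g \<in> ideal_pow I (Suc n)"
      using G ideal_gen_superset[of G] by (auto intro!: ideal_prod_mem)
  qed (simp_all add: wideal_one I is_ideal_prod)
  also have "isum (ideal_pow I (Suc n)) (ideal_gen G) = ideal_pow I n"
    unfolding G(2)[symmetric] using isum_least[OF is_ideal_pow sub order_refl] isum_upper2[OF is_ideal_pow]
    by blast
  finally show "len {1} (ideal_pow I (Suc n)) (ideal_pow I n) \<le> of_nat (card G) * len {1} I UNIV"
    by (simp add: sat_one)
  show "len {1} (ideal_pow I (Suc n)) UNIV =
      len {1} (ideal_pow I (Suc n)) (ideal_pow I n) + len {1} (ideal_pow I n) UNIV"
    using sub by (intro one.len_add) (simp_all add: wideal_one is_ideal_pow is_ideal_UNIV is_ideal_prod)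
qed

lemma len_max_pow_finite:
  assumes noeth: "noetherian TYPE('a::comm_ring_1)" and loc: "local_ring TYPE('a)"
  shows "len {1} (ideal_pow max_ideal n) (UNIV :: 'a set) \<noteq> \<infinity>"
proof (induction n)
  case 0
  then show ?case by (simp add: one.len_refl)
next
  case (Suc n)
  obtain G where G: "finite G" "ideal_pow (max_ideal :: 'a set) n = ideal_gen G"
    using noeth is_ideal_pow unfolding noetherian_def by blast
  note step = len_pow_step[OF max_ideal_is_ideal[OF loc] G]
  have "of_nat (card G) * len {1} (max_ideal :: 'a set) UNIV \<noteq> \<infinity>"
    by (intro enat_mult_finite enat_le_finite[OF len_max_ideal_le]) simp
  with step(1) have "len {1} (ideal_pow max_ideal (Suc n)) (ideal_pow (max_ideal :: 'a set) n) \<noteq> \<infinity>"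
    by (rule enat_le_finite)
  then show ?case using Suc step(2) plus_eq_infty_iff_enat by metis
qed

lemma len_finite_mono:
  assumes "is_ideal J" "is_ideal K" "J \<subseteq> K" "len {1} J UNIV \<noteq> \<infinity>"
  shows "len {1} K UNIV \<noteq> \<infinity>"
  by (rule enat_le_finite[OF one.len_mono assms(4)]) (simp_all add: wideal_one is_ideal_UNIV assms(1-3))

section \<open>Primes over an ideal of a Noetherian ring\<close>

lemma noetherian_wf:
  assumes "noetherian TYPE('a::comm_ring_1)"
  shows "wf {(K, J :: 'a set). is_ideal J \<and> is_ideal K \<and> J \<subset> K}"
  unfolding wf_iff_no_infinite_down_chain
proof
  assume "\<exists>f. \<forall>i. (f (Suc i), f i) \<in> {(K, J :: 'a set). is_ideal J \<and> is_ideal K \<and> J \<subset> K}"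
  then obtain f :: "nat \<Rightarrow> 'a set" where
    chain: "\<forall>i. (f (Suc i), f i) \<in> {(K, J). is_ideal J \<and> is_ideal K \<and> J \<subset> K}" by (elim exE)
  then have f: "is_ideal (f i)" "f i \<subset> f (Suc i)" for i by simp_all
  have mono: "f i \<subseteq> f j" if "i \<le> j" for i j
    using that
  proof (induction rule: dec_induct)
    case (step n)
    then show ?case using f(2)[of n] by simp
  qed simp
  have "is_ideal (\<Union>i. f i)"
    unfolding is_ideal_def
  proof (intro conjI ballI allI impI)
    show "0 \<in> (\<Union>i. f i)" using is_ideal_0[OF f(1)] by blast
  next
    fix x y assume "x \<in> (\<Union>i. f i)" "y \<in> (\<Union>i. f i)"
    then obtain i j where "x \<in> f i" "y \<in> f j" by blast
    then have "x \<in> f (max i j)" "y \<in> f (max i j)" using mono[of i "max i j"] mono[of j "max i j"] by auto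
    then show "x + y \<in> (\<Union>i. f i)" using is_ideal_add[OF f(1)] by blast
  next
    fix r x assume "x \<in> (\<Union>i. f i)"
    then show "r * x \<in> (\<Union>i. f i)" using is_ideal_mult[OF f(1)] by blast
  qed
  then obtain S where S: "finite S" "(\<Union>i. f i) = ideal_gen S"
    using assms unfolding noetherian_def by blast
  have "S \<subseteq> (\<Union>i. f i)" using S ideal_gen_superset by blast
  with S(1) have "\<exists>n. S \<subseteq> f n"
  proof (induction S)
    case (insert s S)
    then obtain n k where "S \<subseteq> f n" "s \<in> f k" by blast
    then show ?case using mono[of n "max n k"] mono[of k "max n k"] by (intro exI[of _ "max n k"]) auto
  qed simp
  then obtain n where "S \<subseteq> f n" by blast
  then have "ideal_gen S \<subseteq> f n" by (intro ideal_gen_least f)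
  then have "f (Suc n) \<subseteq> f n" using S by blast
  then show False using f(2)[of n] by blast
qed

text \<open>Noetherian induction: if \<open>a * b\<close> is in \<open>J\<close> but
  \<open>a\<close> and \<open>b\<close> are not, the lists for \<open>J + (a)\<close> and
  \<open>J + (b)\<close> are concatenated. A finite list with this property contains every minimal
  prime over \<open>J\<close>, which is how it is used.\<close>

lemma prime_product_subset:
  assumes noeth: "noetherian TYPE('a::comm_ring_1)"
  shows "is_ideal (J :: 'a set) \<Longrightarrow> \<exists>Ps. (\<forall>P\<in>set Ps. prime_ideal P \<and> J \<subseteq> P) \<and> ideal_prod_list Ps \<subseteq> J"
proof (induction J rule: wf_induct_rule[OF noetherian_wf[OF noeth]])
  case (1 J)
  note J = \<open>is_ideal J\<close>
  consider "J = UNIV" | "prime_ideal J" | "J \<noteq> UNIV" "\<not> prime_ideal J" by blast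
  then show ?case
  proof cases
    case 1
    then show ?thesis by (intro exI[of _ "[]"]) (simp add: ideal_prod_list_simps)
  next
    case 2
    have "ideal_prod J UNIV \<subseteq> J" using J by (intro ideal_prod_least) (auto intro: is_ideal_mult')
    then show ?thesis using 2 by (intro exI[of _ "[J]"]) (simp add: ideal_prod_list_simps)
  next
    case 3
    then obtain a b where ab: "a * b \<in> J" "a \<notin> J" "b \<notin> J" using J unfolding prime_ideal_def by blast
    have *: "\<exists>Ps. (\<forall>P\<in>set Ps. prime_ideal P \<and> isum J (principal c) \<subseteq> P) \<and> ideal_prod_list Ps \<subseteq> isum J (principal c)"
      if "c \<notin> J" for c
    proof (rule "1.IH")
      have "c \<in> isum J (principal c)" using isum_upper2[OF J, of "principal c"] principal_self[of c] by blast
      then show "(isum J (principal c), J) \<in> {(K, J). is_ideal J \<and> is_ideal K \<and> J \<subset> K}"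
        using J that is_ideal_isum[OF J is_ideal_principal] isum_upper1[OF is_ideal_principal, of J c] by blast
    qed (intro is_ideal_isum J is_ideal_principal)
    obtain Ps Qs where PQ: "\<forall>P\<in>set Ps. prime_ideal P \<and> isum J (principal a) \<subseteq> P"
      "ideal_prod_list Ps \<subseteq> isum J (principal a)" "\<forall>P\<in>set Qs. prime_ideal P \<and> isum J (principal b) \<subseteq> P"
      "ideal_prod_list Qs \<subseteq> isum J (principal b)" using *[OF ab(2)] *[OF ab(3)] by blast
    have "ideal_prod_list (Ps @ Qs) \<subseteq> J"
    proof (rule ideal_prod_list_append_least[OF J])
      fix x y assume "x \<in> ideal_prod_list Ps" "y \<in> ideal_prod_list Qs"
      then have "x \<in> isum J (principal a)" "y \<in> isum J (principal b)" using PQ by auto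
      then obtain j r k s where xy: "x = j + a * r" "y = k + b * s" "j \<in> J" "k \<in> J"
        unfolding isum_def principal_def by blast
      have "x * y = j * y + (a * r) * k + (r * s) * (a * b)" unfolding xy by (simp add: algebra_simps)
      also have "\<dots> \<in> J" using J ab xy by (blast intro: is_ideal_rules)
      finally show "x * y \<in> J" .
    qed
    moreover have "\<forall>P\<in>set (Ps @ Qs). prime_ideal P \<and> J \<subseteq> P"
    proof
      fix P assume "P \<in> set (Ps @ Qs)"
      then have "prime_ideal P" "isum J (principal a) \<subseteq> P \<or> isum J (principal b) \<subseteq> P" using PQ by auto
      then show "prime_ideal P \<and> J \<subseteq> P" using isum_upper1[OF is_ideal_principal, of J] by (meson order_trans)
    qed
    ultimately show ?thesis by blast
  qed
qed

lemma prime_contains_factor: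
  assumes "prime_ideal P" "ideal_prod_list Ps \<subseteq> P" shows "\<exists>Q\<in>set Ps. Q \<subseteq> P"
  using assms(2)
proof (induction Ps)
  case Nil
  then show ?case using assms(1) by (auto simp: ideal_prod_list_simps prime_ideal_def)
next
  case (Cons Q Qs)
  show ?case
  proof (cases "Q \<subseteq> P")
    case False
    then obtain a where a: "a \<in> Q" "a \<notin> P" by blast
    have "ideal_prod_list Qs \<subseteq> P"
    proof
      fix b assume "b \<in> ideal_prod_list Qs"
      then have "a * b \<in> P" using Cons.prems a by (auto simp: ideal_prod_list_simps intro: ideal_prod_mem)
      then show "b \<in> P" using assms(1) a by (auto simp: prime_ideal_def)
    qed
    then show ?thesis using Cons.IH by auto
  qed auto
qed

lemma prime_avoidance:
  assumes "is_ideal A" "finite F" "\<And>P. P \<in> F \<Longrightarrow> prime_ideal P \<and> \<not> A \<subseteq> P"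
  shows "\<exists>x\<in>A. \<forall>P\<in>F. x \<notin> P"
  using assms(2,3)
proof (induction F rule: finite_psubset_induct)
  case (psubset F)
  show ?case
  proof (cases "F = {}")
    case True
    then show ?thesis using is_ideal_0[OF assms(1)] by blast
  next
    case False
    then obtain P where P: "P \<in> F" by blast
    have prime: "prime_ideal P" "\<not> A \<subseteq> P" using psubset.prems P by auto
    \<comment> \<open>Members of \<open>F\<close> contained in \<open>P\<close> are avoided as soon
      as \<open>P\<close> is; only the others need attention.\<close>
    define F' where "F' = {Q\<in>F. \<not> Q \<subseteq> P}"
    have "F' \<subset> F" using P by (auto simp: F'_def)
    then obtain x where x: "x \<in> A" "\<forall>Q\<in>F'. x \<notin> Q" using psubset.IH[of F'] psubset.prems by blast
    show ?thesis
    proof (cases "x \<in> P")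
      case False
      then show ?thesis using x unfolding F'_def by blast
    next
      case True
      have fin: "finite F'" using psubset.hyps by (simp add: F'_def)
      \<comment> \<open>The witness is a product with one factor from each member of
        \<open>H\<close>, kept outside \<open>P\<close> by primality. Adding it to \<open>x\<close>
        leaves \<open>P\<close> without entering any member of \<open>F'\<close>.\<close>
      have "\<exists>y\<in>A. y \<notin> P \<and> (\<forall>Q\<in>H. y \<in> Q)" if "finite H" "H \<subseteq> F'" for H
        using that
      proof (induction H rule: finite_induct)
        case empty
        then show ?case using prime(2) by blast
      next
        case (insert Q H)
        then obtain y where y: "y \<in> A" "y \<notin> P" "\<forall>Q\<in>H. y \<in> Q" by blast
        have Q: "Q \<in> F" "\<not> Q \<subseteq> P" using insert.prems by (auto simp: F'_def)
        then obtain a where a: "a \<in> Q" "a \<notin> P" by blast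
        have ideal: "is_ideal K" if "K \<in> F" for K using psubset.prems[OF that] by (simp add: prime_ideal_def)
        have "y * a \<notin> P" using prime(1) y(2) a(2) unfolding prime_ideal_def by blast
        moreover have "y * a \<in> A" using y(1) assms(1) is_ideal_mult' by blast
        moreover have "y * a \<in> K" if "K \<in> insert Q H" for K
        proof (cases "K = Q")
          case True
          then show ?thesis using is_ideal_mult[OF ideal[OF Q(1)] a(1)] by simp
        next
          case False
          then have "K \<in> H" using that by simp
          moreover from this have "K \<in> F" using insert.prems by (auto simp: F'_def)
          ultimately show ?thesis using is_ideal_mult'[OF ideal] y(3) by blast
        qed
        ultimately show ?case by blast
      qed
      from this[OF fin order_refl] obtain y where y: "y \<in> A" "y \<notin> P" "\<forall>Q\<in>F'. y \<in> Q" by blast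
      have xyP: "x + y \<notin> P"
      proof
        assume "x + y \<in> P"
        then have "(x + y) - x \<in> P" using True prime(1) is_ideal_diff unfolding prime_ideal_def by blast
        then show False using y(2) by simp
      qed
      have "x + y \<notin> Q" if "Q \<in> F" for Q
      proof (cases "Q \<subseteq> P")
        case True
        then show ?thesis using xyP by blast
      next
        case False
        then have Q: "Q \<in> F'" using that by (simp add: F'_def)
        have "is_ideal Q" using psubset.prems[OF that] by (simp add: prime_ideal_def)
        then have "x \<in> Q" if "x + y \<in> Q" using is_ideal_diff[OF _ that, of y] y(3) Q by simp
        then show ?thesis using x(2) Q by blast
      qed
      moreover have "x + y \<in> A" using x(1) y(1) assms(1) is_ideal_add by blast
      ultimately show ?thesis by blast
    qed
  qed
qed

lemma max_pow_subset_of_primes: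
  assumes noeth: "noetherian TYPE('a::comm_ring_1)" and J: "is_ideal (J :: 'a set)"
    and only: "\<And>P. prime_ideal P \<Longrightarrow> J \<subseteq> P \<Longrightarrow> P = max_ideal"
  shows "\<exists>c. ideal_pow max_ideal c \<subseteq> J"
proof -
  obtain Ps where Ps: "\<forall>P\<in>set Ps. prime_ideal P \<and> J \<subseteq> P" "ideal_prod_list Ps \<subseteq> J"
    using prime_product_subset[OF noeth J] by blast
  have "ideal_prod_list Ps = ideal_pow max_ideal (length Ps)"
    using Ps only by (intro ideal_prod_list_same) auto
  then show ?thesis using Ps by auto
qed

lemma prime_subset_max: "prime_ideal P \<Longrightarrow> P \<subseteq> max_ideal"
  using proper_subset_max_ideal by (auto simp: prime_ideal_def)

lemma m_primary_max_pow:
  assumes noeth: "noetherian TYPE('a::comm_ring_1)" and I: "m_primary (I :: 'a set)"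
  shows "\<exists>c. ideal_pow max_ideal c \<subseteq> I"
proof (rule max_pow_subset_of_primes[OF noeth])
  show "is_ideal I" using I by (simp add: m_primary_def)
  fix P assume P: "prime_ideal P" "I \<subseteq> P"
  have "max_ideal \<subseteq> P"
  proof
    fix x :: 'a assume "x \<in> max_ideal"
    then obtain k where "x ^ k \<in> I" using I by (auto simp: m_primary_def)
    then have "x ^ k \<in> P" using P by blast
    then show "x \<in> P"
    proof (induction k)
      case 0
      then show ?case using P(1) is_ideal_one by (auto simp: prime_ideal_def)
    next
      case (Suc k)
      then show ?case using P(1) by (auto simp: prime_ideal_def)
    qed
  qed
  then show "P = max_ideal" using prime_subset_max[OF P(1)] by blast
qed

section \<open>Dimension two: parameters and quadratic growth\<close>

text \<open>\<open>x\<close> avoids the non-maximal primes of a list with product zero,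
  \<open>y\<close> those of a list for \<open>(x)\<close>. A non-maximal prime over both would then
  be too high in a chain of primes, so the maximal ideal is the only prime over
  \<open>(x, y)\<close>.\<close>

lemma system_of_parameters:
  assumes noeth: "noetherian TYPE('a::comm_ring_1)" and loc: "local_ring TYPE('a)"
    and dim: "krull_dim TYPE('a) \<le> 2"
  shows "\<exists>x y :: 'a. x \<in> max_ideal \<and> y \<in> max_ideal \<and> (\<exists>c. ideal_pow max_ideal c \<subseteq> ideal_gen {x, y})"
proof -
  let ?m = "max_ideal :: 'a set"
  have m: "is_ideal ?m" by (rule max_ideal_is_ideal[OF loc])
  have avoid: "\<exists>x\<in>?m. \<forall>P\<in>set Ps. P \<noteq> ?m \<longrightarrow> x \<notin> P" if "\<forall>P\<in>set Ps. prime_ideal P" for Ps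
  proof -
    have "\<exists>x\<in>?m. \<forall>P\<in>{P\<in>set Ps. P \<noteq> ?m}. x \<notin> P"
      using that prime_subset_max by (intro prime_avoidance[OF m]) auto
    then show ?thesis by blast
  qed
  obtain Ps where Ps: "\<forall>P\<in>set Ps. prime_ideal P \<and> {0::'a} \<subseteq> P" "ideal_prod_list Ps \<subseteq> {0}"
    using prime_product_subset[OF noeth is_ideal_zero] by blast
  obtain x where x: "x \<in> ?m" "\<forall>P\<in>set Ps. P \<noteq> ?m \<longrightarrow> x \<notin> P" using avoid[of Ps] Ps(1) by auto
  obtain Qs where Qs: "\<forall>P\<in>set Qs. prime_ideal P \<and> principal x \<subseteq> P" "ideal_prod_list Qs \<subseteq> principal x"
    using prime_product_subset[OF noeth is_ideal_principal] by blast
  obtain y where y: "y \<in> ?m" "\<forall>P\<in>set Qs. P \<noteq> ?m \<longrightarrow> y \<notin> P" using avoid[of Qs] Qs(1) by auto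
  have "\<exists>c. ideal_pow max_ideal c \<subseteq> ideal_gen {x, y}"
  proof (rule max_pow_subset_of_primes[OF noeth is_ideal_gen], rule ccontr)
    fix P assume P: "prime_ideal P" "ideal_gen {x, y} \<subseteq> P" "P \<noteq> ?m"
    have iP: "is_ideal P" using P(1) by (simp add: prime_ideal_def)
    have xy: "x \<in> P" "y \<in> P" using P(2) ideal_gen_superset[of "{x, y}"] by auto
    have "ideal_prod_list Qs \<subseteq> P" using Qs(2) principal_least[OF iP xy(1)] by blast
    then obtain P1 where P1: "P1 \<in> set Qs" "P1 \<subseteq> P" using prime_contains_factor[OF P(1)] by blast
    have Pm: "P \<subset> ?m" using P prime_subset_max by blast
    then have "P1 \<noteq> ?m" using P1 by blast
    then have P1P: "P1 \<subset> P" using y(2) P1 xy(2) by blast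
    have prime1: "prime_ideal P1" "x \<in> P1" using Qs(1) P1(1) principal_self[of x] by auto
    have "ideal_prod_list Ps \<subseteq> P1" using Ps(2) prime1 is_ideal_0 by (auto simp: prime_ideal_def)
    then obtain P0 where P0: "P0 \<in> set Ps" "P0 \<subseteq> P1" using prime_contains_factor[OF prime1(1)] by blast
    have "P0 \<noteq> ?m" using P0 P1P Pm by blast
    then have P01: "P0 \<subset> P1" using x(2) P0 prime1(2) by blast
    have prime_m: "prime_ideal ?m" unfolding prime_ideal_def
    proof (intro conjI allI impI)
      show "?m \<noteq> UNIV" using one_notin_max_ideal by blast
      fix a b :: 'a assume "a * b \<in> ?m"
      then show "a \<in> ?m \<or> b \<in> ?m" using mult_dvd_mono[of a 1 b 1] by (auto simp: max_ideal_mem)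
    qed (rule m)
    \<comment> \<open>The chain \<open>P0 \<subset> P1 \<subset> P \<subset> ?m\<close> of length 3:
      the first inclusion is strict because of \<open>x\<close>, the second because of
      \<open>y\<close>.\<close>
    let ?C = "\<lambda>i::nat. if i = 0 then P0 else if i = 1 then P1 else if i = 2 then P else ?m"
    have "enat 3 \<le> krull_dim TYPE('a)"
      unfolding krull_dim_def
    proof (rule Sup_upper, intro CollectI exI conjI)
      show "enat 3 = enat 3" ..
      show "\<forall>i\<le>3. prime_ideal (?C i)" using P P0 Ps prime1 prime_m by simp
      show "\<forall>i<3. ?C i \<subset> ?C (Suc i)"
      proof (intro allI impI)
        fix i :: nat assume "i < 3"
        then consider "i = 0" | "i = 1" | "i = 2" by linarith
        then show "?C i \<subset> ?C (Suc i)" by cases (simp_all add: P01 P1P Pm)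
      qed
    qed
    with dim have "enat 3 \<le> 2" by (rule order_trans[rotated])
    then show False by (simp add: numeral_eq_enat)
  qed
  then show ?thesis using x y by blast
qed

lemma two_generated_pow:
  "ideal_pow (ideal_gen {x, y}) n = ideal_gen {x ^ i * y ^ (n - i) | i. i \<le> n}"
proof
  let ?G = "\<lambda>n. {x ^ i * y ^ (n - i) | i. i \<le> n}"
  let ?q = "ideal_gen {x, y}"
  show "ideal_pow ?q n \<subseteq> ideal_gen (?G n)"
  proof (induction n)
    case 0
    have "1 \<in> ideal_gen (?G 0)" by (rule subsetD[OF ideal_gen_superset]) simp
    then show ?case using is_ideal_one[OF is_ideal_gen] by auto
  next
    case (Suc n)
    have "ideal_prod ?q (ideal_pow ?q n) \<subseteq> ideal_gen (?G (Suc n))"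
    proof (rule ideal_prod_gen_least[OF is_ideal_gen])
      fix g b assume g: "g \<in> {x, y}" and b: "b \<in> ideal_pow ?q n"
      have "?G n \<subseteq> colon (ideal_gen (?G (Suc n))) g"
      proof
        fix h assume "h \<in> ?G n"
        then obtain i where i: "i \<le> n" "h = x ^ i * y ^ (n - i)" by blast
        have "g * h \<in> ?G (Suc n)"
        proof (cases "g = x")
          case True
          then show ?thesis using i by (intro CollectI exI[of _ "Suc i"]) (simp add: ac_simps)
        next
          case False
          then have "g = y" using g by simp
          then show ?thesis using i by (intro CollectI exI[of _ i]) (simp add: Suc_diff_le ac_simps)
        qed
        then have "g * h \<in> ideal_gen (?G (Suc n))" by (rule subsetD[OF ideal_gen_superset])
        then show "h \<in> colon (ideal_gen (?G (Suc n))) g" unfolding colon_def by (rule CollectI)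
      qed
      then have "ideal_gen (?G n) \<subseteq> colon (ideal_gen (?G (Suc n))) g"
        by (intro ideal_gen_least is_ideal_colon is_ideal_gen)
      then show "g * b \<in> ideal_gen (?G (Suc n))" using Suc b by (auto simp: colon_def)
    qed
    then show ?case by simp
  qed
  have xy: "x \<in> ?q" "y \<in> ?q" using ideal_gen_superset[of "{x, y}"] by auto
  show "ideal_gen (?G n) \<subseteq> ideal_pow ?q n"
  proof (rule ideal_gen_least[OF is_ideal_pow], safe)
    fix i assume "i \<le> n"
    then show "x ^ i * y ^ (n - i) \<in> ideal_pow ?q n"
      using ideal_pow_mult[OF power_mem_ideal_pow[OF xy(1), of i] power_mem_ideal_pow[OF xy(2), of "n - i"]] by simp
  qed
qed

text \<open>\<open>q^n\<close> has at most \<open>n + 1\<close> generators, so the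
  \<open>n\<close>-th quotient has length at most \<open>(n + 1) * L\<close>. The crude sum
  \<open>n^2 * L\<close> is enough, as only the order of growth matters.\<close>

lemma two_generated_len:
  assumes q: "q = ideal_gen {x, y}" and L: "len {1} q UNIV = enat L"
  shows "len {1} (ideal_pow q n) UNIV \<le> enat (n\<^sup>2 * L)"
proof (induction n)
  case 0
  then show ?case by (simp add: one.len_refl)
next
  case (Suc n)
  let ?G = "{x ^ i * y ^ (n - i) | i. i \<le> n}"
  have G: "?G = (\<lambda>i. x ^ i * y ^ (n - i)) ` {..n}" by auto
  then have fin: "finite ?G" and card: "card ?G \<le> Suc n" using card_image_le[of "{..n}" "\<lambda>i. x ^ i * y ^ (n - i)"] by auto
  have gen: "ideal_pow q n = ideal_gen ?G" unfolding q by (rule two_generated_pow)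
  have "is_ideal q" unfolding q by (rule is_ideal_gen)
  note pow_step = len_pow_step[OF this fin gen]
  note pow_step(1)
  also have "of_nat (card ?G) * len {1} q UNIV \<le> enat (Suc n * L)"
    unfolding L of_nat_eq_enat times_enat_simps using card mult_le_mono1[OF card, of L] by (simp del: mult_Suc)
  finally have step: "len {1} (ideal_pow q (Suc n)) (ideal_pow q n) \<le> enat (Suc n * L)" .
  note pow_step(2)
  also have "len {1} (ideal_pow q (Suc n)) (ideal_pow q n) + len {1} (ideal_pow q n) UNIV
    \<le> enat (Suc n * L) + enat (n\<^sup>2 * L)" using step Suc by (rule add_mono)
  also have "\<dots> = enat ((Suc n + n\<^sup>2) * L)" by (simp add: algebra_simps)
  also have "\<dots> \<le> enat ((Suc n)\<^sup>2 * L)" by (simp add: power2_eq_square)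
  finally show ?case .
qed

text \<open>Supplies the convergence behind \<open>hs_mult\<close>. With a two-generated
  \<open>q\<close> inside the maximal ideal, \<open>q^d\<close> lies in \<open>I\<close>, so the
  length of \<open>R/I^n\<close> is at most that of \<open>R/q^(d n)\<close>, and the eventual
  polynomial has degree at most 2.\<close>

lemma hilbert_samuel:
  assumes noeth: "noetherian TYPE('a::comm_ring_1)" and loc: "local_ring TYPE('a)"
    and dim: "krull_dim TYPE('a) \<le> 2" and I: "is_ideal (I :: 'a set)" "ideal_pow max_ideal d \<subseteq> I"
  shows "len {1} (ideal_pow I n) UNIV \<noteq> \<infinity>"
    and "\<exists>a b c. a \<ge> 0 \<and> hs_mult 2 I = 2 * a \<and> (\<lambda>n. rlen (ideal_pow I n) UNIV / (real n)\<^sup>2) \<longlonglongrightarrow> a \<and>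
      (\<forall>\<^sub>F n in sequentially. rlen (ideal_pow I n) UNIV = a * (real n)\<^sup>2 + b * real n + c)"
proof -
  have fin: "len {1} (ideal_pow I n) UNIV \<noteq> \<infinity>" for n
    by (rule len_finite_mono[OF is_ideal_pow is_ideal_pow ideal_pow_pow_subset[OF I(2)]
          len_max_pow_finite[OF noeth loc]])
  then show "len {1} (ideal_pow I n) UNIV \<noteq> \<infinity>" by blast
  obtain x y :: 'a and c where xy: "x \<in> max_ideal" "y \<in> max_ideal" "ideal_pow max_ideal c \<subseteq> ideal_gen {x, y}"
    using system_of_parameters[OF noeth loc dim] by blast
  define q where "q = ideal_gen {x, y}"
  have iq: "is_ideal q" unfolding q_def by (rule is_ideal_gen)
  have "len {1} q UNIV \<noteq> \<infinity>"
    by (rule len_finite_mono[OF is_ideal_pow iq _ len_max_pow_finite[OF noeth loc]]) (use xy(3) q_def in simp)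
  then obtain L where L: "len {1} q UNIV = enat L" by auto
  have qm: "q \<subseteq> max_ideal" unfolding q_def using xy max_ideal_is_ideal[OF loc] by (intro ideal_gen_least) auto
  have qI: "ideal_pow q d \<subseteq> I" using ideal_pow_mono[OF qm] I(2) by blast
  have bound: "rlen (ideal_pow I n) UNIV \<le> (real d)\<^sup>2 * real L * (real n)\<^sup>2" for n
  proof -
    have "len {1} (ideal_pow I n) UNIV \<le> len {1} (ideal_pow q (d * n)) UNIV"
      using ideal_pow_pow_subset[OF qI, of n]
      by (intro one.len_mono) (simp_all add: wideal_one is_ideal_pow is_ideal_UNIV)
    also have "\<dots> \<le> enat ((d * n)\<^sup>2 * L)" by (rule two_generated_len[OF q_def L])
    finally have "the_enat (len {1} (ideal_pow I n) UNIV) \<le> (d * n)\<^sup>2 * L" using fin[of n] by auto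
    then have "rlen (ideal_pow I n) UNIV \<le> real ((d * n)\<^sup>2 * L)" unfolding rlen_def by (subst of_nat_le_iff)
    then show ?thesis by (simp add: power_mult_distrib ac_simps)
  qed
  have "\<exists>a b c. \<forall>\<^sub>F n in sequentially. rlen (ideal_pow I n) UNIV = a * (real n)\<^sup>2 + b * real n + c"
  proof (rule eventually_poly_quadratic[OF eventually_poly_colength[OF noeth I(1) fin]])
    fix n
    have "(real d)\<^sup>2 * real L * (real n)\<^sup>2 \<le> (real d)\<^sup>2 * real L * (real n + 1)\<^sup>2"
      by (intro mult_left_mono power_mono) auto
    then show "\<bar>rlen (ideal_pow I n) UNIV\<bar> \<le> (real d)\<^sup>2 * real L * (real n + 1)\<^sup>2"
      using bound[of n] by (simp add: rlen_def)
  qed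
  then obtain a b c where abc: "\<forall>\<^sub>F n in sequentially. rlen (ideal_pow I n) UNIV = a * (real n)\<^sup>2 + b * real n + c"
    by blast
  have "(\<lambda>n. a + b / real n + c / (real n)\<^sup>2) \<longlonglongrightarrow> a + 0 + 0"
    by (intro tendsto_intros tendsto_divide_0[OF tendsto_const] filterlim_real_at_infinity_sequentially
        filterlim_compose[OF filterlim_power_at_infinity filterlim_real_at_infinity_sequentially])
      (auto intro!: tendsto_divide_0[OF tendsto_const] filterlim_power_at_infinity filterlim_real_at_infinity_sequentially)
  moreover have "\<forall>\<^sub>F n in sequentially. a + b / real n + c / (real n)\<^sup>2 = rlen (ideal_pow I n) UNIV / (real n)\<^sup>2"
    using abc eventually_gt_at_top[of 0]
    by eventually_elim (simp add: field_simps power2_eq_square)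
  ultimately have lim: "(\<lambda>n. rlen (ideal_pow I n) UNIV / (real n)\<^sup>2) \<longlonglongrightarrow> a"
    using Lim_transform_eventually by fastforce
  have "a \<ge> 0" by (rule tendsto_lowerbound[OF lim]) (auto simp: rlen_def)
  moreover have "(\<lambda>n. fact 2 * colen (ideal_pow I n) / real n ^ 2) \<longlonglongrightarrow> 2 * a"
    using tendsto_mult[OF tendsto_const[of 2] lim] by (simp add: colen_def rlen_def colength_eq_len)
  then have "hs_mult 2 I = 2 * a" unfolding hs_mult_def by (rule limI)
  ultimately show "\<exists>a b c. a \<ge> 0 \<and> hs_mult 2 I = 2 * a \<and> (\<lambda>n. rlen (ideal_pow I n) UNIV / (real n)\<^sup>2) \<longlonglongrightarrow> a \<and>
      (\<forall>\<^sub>F n in sequentially. rlen (ideal_pow I n) UNIV = a * (real n)\<^sup>2 + b * real n + c)"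
    using lim abc by blast
qed

section \<open>Extension to the polynomial ring\<close>

abbreviation "coef \<equiv> Poly_Mapping.lookup"

text \<open>For an ideal \<open>J\<close> this is the extension \<open>J R[t]\<close>, in a form
  where membership is tested coefficient by coefficient.\<close>

definition coeffs_in :: "'a::comm_ring_1 set \<Rightarrow> 'a mpoly set" where
  "coeffs_in J = {f. \<forall>a. coef f a \<in> J}"

lemma poly_mapping_sum_single: "f = (\<Sum>a\<in>Poly_Mapping.keys f. Poly_Mapping.single a (coef f a))"
  by (rule poly_mapping_eqI) (simp add: lookup_sum lookup_single when_def in_keys_iff)

lemma lookup_mult_sum:
  "coef (f * g) c = (\<Sum>a\<in>Poly_Mapping.keys f. \<Sum>b\<in>Poly_Mapping.keys g. coef f a * coef g b when a + b = c)"
proof -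
  have "f * g = (\<Sum>a\<in>Poly_Mapping.keys f. \<Sum>b\<in>Poly_Mapping.keys g. Poly_Mapping.single (a + b) (coef f a * coef g b))"
    by (subst poly_mapping_sum_single[of f], subst poly_mapping_sum_single[of g])
      (simp add: sum_product mult_single)
  then show ?thesis by (simp add: lookup_sum lookup_single)
qed

lemma lookup_mult_mem:
  assumes "is_ideal J" "\<And>a b. a + b = c \<Longrightarrow> coef f a * coef g b \<in> J"
  shows "coef (f * g) c \<in> J"
  unfolding lookup_mult_sum
  by (intro is_ideal_sum[OF assms(1)]) (auto simp: when_def assms(2) is_ideal_0[OF assms(1)])

lemma lookup_single_mult: "coef (Poly_Mapping.single d c * f) (d + a) = c * coef f (a :: nat \<Rightarrow>\<^sub>0 nat)"
proof (cases "c = 0")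
  case False
  have "coef (Poly_Mapping.single d c * f) (d + a) = (\<Sum>b\<in>Poly_Mapping.keys f. c * coef f b when b = a)"
    using False by (simp add: lookup_mult_sum)
  also have "\<dots> = c * coef f a" by (simp add: when_def in_keys_iff)
  finally show ?thesis .
qed simp

lemma lookup_single_mult_nonzero:
  assumes "coef (Poly_Mapping.single d c * f) e \<noteq> 0" obtains b where "e = d + b"
proof -
  have "Poly_Mapping.keys (Poly_Mapping.single d c * f) \<subseteq> {a + b | a b. a \<in> Poly_Mapping.keys (Poly_Mapping.single d c) \<and> b \<in> Poly_Mapping.keys f}"
    by (rule keys_mult)
  moreover have "e \<in> Poly_Mapping.keys (Poly_Mapping.single d c * f)" using assms by (simp add: in_keys_iff)
  ultimately have "e \<in> {a + b | a b. a \<in> Poly_Mapping.keys (Poly_Mapping.single d c) \<and> b \<in> Poly_Mapping.keys f}"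
    by (rule subsetD)
  then show ?thesis using that by (auto split: if_splits)
qed

lemma lookup_const_mult: "coef (const_poly c * f) a = c * coef f a"
  using lookup_single_mult[of 0 c f a] by (simp add: const_poly_def)

lemma const_poly_mult: "const_poly (a * b) = const_poly a * const_poly b"
  by (simp add: const_poly_def mult_single)

lemma const_poly_add: "const_poly (a + b) = const_poly a + const_poly b"
  by (simp add: const_poly_def single_add)

lemma const_poly_0: "const_poly 0 = 0" and const_poly_1: "const_poly 1 = 1"
  by (simp_all add: const_poly_def)

lemma is_ideal_coeffs_in: assumes "is_ideal J" shows "is_ideal (coeffs_in J)"
  unfolding is_ideal_def coeffs_in_def
proof (intro conjI ballI allI impI CollectI)
  show "coef 0 a \<in> J" for a using is_ideal_0[OF assms] by simp
  show "coef (f + g) a \<in> J" if "f \<in> {f. \<forall>a. coef f a \<in> J}" "g \<in> {f. \<forall>a. coef f a \<in> J}" for f g a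
    using that is_ideal_add[OF assms] by (simp add: lookup_add)
  show "coef (r * f) a \<in> J" if "f \<in> {f. \<forall>a. coef f a \<in> J}" for r f a
    using that by (intro lookup_mult_mem assms) (auto intro: is_ideal_mult assms)
qed

lemma const_poly_mem: "is_ideal J \<Longrightarrow> const_poly c \<in> coeffs_in J \<longleftrightarrow> c \<in> J"
  by (auto simp: coeffs_in_def const_poly_def lookup_single when_def is_ideal_0 dest: spec[of _ 0])

lemma coeffs_in_mono: "J \<subseteq> K \<Longrightarrow> coeffs_in J \<subseteq> coeffs_in K"
  by (auto simp: coeffs_in_def)

lemma coeffs_in_UNIV: "coeffs_in UNIV = UNIV" by (simp add: coeffs_in_def)

lemma coeffs_in_psubset: assumes "is_ideal J" "is_ideal K" "J \<subset> K" shows "coeffs_in J \<subset> coeffs_in K"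
proof -
  obtain c where "c \<in> K" "c \<notin> J" using assms by blast
  then have "const_poly c \<in> coeffs_in K" "const_poly c \<notin> coeffs_in J" using assms by (simp_all add: const_poly_mem)
  then show ?thesis using coeffs_in_mono assms by blast
qed

lemma coeffs_in_least:
  assumes "is_ideal L" "\<And>c. c \<in> J \<Longrightarrow> const_poly c \<in> L" shows "coeffs_in J \<subseteq> L"
proof
  fix f assume "f \<in> coeffs_in J"
  then have "const_poly (coef f a) \<in> L" for a using assms(2) by (auto simp: coeffs_in_def)
  then have "Poly_Mapping.single a 1 * const_poly (coef f a) \<in> L" for a using is_ideal_mult[OF assms(1)] by blast
  then have "Poly_Mapping.single a (coef f a) \<in> L" for a by (simp add: const_poly_def mult_single)
  then show "f \<in> L" by (subst poly_mapping_sum_single) (intro is_ideal_sum assms)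
qed

lemma ext_ideal_eq: assumes "is_ideal J" shows "ext_ideal J = coeffs_in J"
proof
  show "ext_ideal J \<subseteq> coeffs_in J" unfolding ext_ideal_def
    using assms by (intro ideal_gen_least is_ideal_coeffs_in) (auto simp: const_poly_mem)
  show "coeffs_in J \<subseteq> ext_ideal J" unfolding ext_ideal_def
    by (intro coeffs_in_least is_ideal_gen subsetD[OF ideal_gen_superset]) simp
qed

lemma coeffs_in_mult:
  assumes "is_ideal K" "\<And>x y. x \<in> I \<Longrightarrow> y \<in> J \<Longrightarrow> x * y \<in> K" "f \<in> coeffs_in I" "g \<in> coeffs_in J"
  shows "f * g \<in> coeffs_in K"
  using assms by (auto simp: coeffs_in_def intro!: lookup_mult_mem)

text \<open>The leading coefficients outside the maximal ideal and outside \<open>J\<close> multiply to a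
  coefficient of \<open>s * f\<close> modulo \<open>J\<close>; any linear order on monomials will do.\<close>
lemma coeffs_in_cancel:
  assumes J: "is_ideal J" and s: "s \<notin> coeffs_in max_ideal"
    and f: "\<And>m b. m \<in> max_ideal \<Longrightarrow> m * coef f b \<in> J" and sf: "s * f \<in> coeffs_in J"
  shows "f \<in> coeffs_in J"
proof (rule ccontr)
  assume "f \<notin> coeffs_in J"
  define A where "A = {a. coef s a \<notin> max_ideal}"
  define B where "B = {b. coef f b \<notin> J}"
  have "(0::'a) \<in> max_ideal" by (simp add: max_ideal_mem)
  then have "A \<subseteq> Poly_Mapping.keys s" by (auto simp: A_def in_keys_iff)
  then have A: "finite A" "A \<noteq> {}" using s finite_subset[OF _ finite_keys] by (auto simp: A_def coeffs_in_def)
  have "B \<subseteq> Poly_Mapping.keys f" using is_ideal_0[OF J] by (auto simp: B_def in_keys_iff)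
  then have B: "finite B" "B \<noteq> {}" using \<open>f \<notin> coeffs_in J\<close> finite_subset[OF _ finite_keys]
    by (auto simp: B_def coeffs_in_def)
  define a0 where "a0 = Max A"
  define b0 where "b0 = Max B"
  have a0: "a0 \<in> A" "\<And>a. a \<in> A \<Longrightarrow> a \<le> a0" using A by (auto simp: a0_def)
  have b0: "b0 \<in> B" "\<And>b. b \<in> B \<Longrightarrow> b \<le> b0" using B by (auto simp: b0_def)
  have other: "coef s a * coef f b \<in> J" if "a + b = a0 + b0" "a \<noteq> a0" for a b
  proof (cases "a \<in> A")
    case False
    then show ?thesis using f by (simp add: A_def)
  next
    case True
    then have "a < a0" using a0(2) that by fastforce
    then have "b \<notin> B" using add_less_le_mono[of a a0 b b0] b0(2)[of b] that by auto
    then show ?thesis using is_ideal_mult[OF J] by (simp add: B_def)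
  qed
  let ?m = "Poly_Mapping.single a0 (coef s a0)"
  have "coef ((s - ?m) * f) (a0 + b0) \<in> J"
  proof (rule lookup_mult_mem[OF J])
    fix a b assume "a + b = a0 + b0"
    then show "coef (s - ?m) a * coef f b \<in> J"
      using other[of a b] is_ideal_0[OF J] by (cases "a = a0") (auto simp: lookup_minus lookup_single)
  qed
  moreover have "coef (s * f) (a0 + b0) \<in> J" using sf by (simp add: coeffs_in_def)
  ultimately have "coef (s * f) (a0 + b0) - coef ((s - ?m) * f) (a0 + b0) \<in> J"
    by (intro is_ideal_diff[OF J])
  then have "coef (?m * f) (a0 + b0) \<in> J" by (simp add: left_diff_distrib lookup_minus)
  then have u: "coef s a0 * coef f b0 \<in> J" by (simp add: lookup_single_mult)
  have "coef s a0 dvd 1" using a0(1) by (simp add: A_def max_ideal_mem)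
  then obtain v where "1 = coef s a0 * v" by (rule dvdE)
  then have "coef f b0 = v * (coef s a0 * coef f b0)" by (metis mult.assoc mult.commute mult_1)
  then have "coef f b0 \<in> J" using is_ideal_mult[OF J u, of v] by simp
  then show False using b0(1) by (simp add: B_def)
qed

section \<open>Lengths over \<open>R(t)\<close>\<close>

locale noetherian_local =
  fixes ty :: "'a::comm_ring_1 itself"
  assumes noeth: "noetherian TYPE('a)" and loc: "local_ring TYPE('a)"
begin

abbreviation "M \<equiv> (max_ideal :: 'a set)"

definition W :: "'a mpoly set" where "W = - coeffs_in M"

lemma M: "is_ideal M" by (rule max_ideal_is_ideal[OF loc])

sublocale mult_set W
proof
  show "1 \<in> W" using const_poly_mem[OF M, of 1] one_notin_max_ideal by (simp add: W_def const_poly_1)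
  fix s t assume st: "s \<in> W" "t \<in> W"
  have "t \<in> coeffs_in M" if "s * t \<in> coeffs_in M"
    by (rule coeffs_in_cancel[OF M _ is_ideal_mult'[OF M] that]) (use st in \<open>auto simp: W_def\<close>)
  then show "s * t \<in> W" using st by (auto simp: W_def)
qed

abbreviation mpow :: "nat \<Rightarrow> 'a set" where "mpow k \<equiv> ideal_pow M k"

abbreviation mext :: "nat \<Rightarrow> 'a mpoly set" where "mext k \<equiv> coeffs_in (mpow k)"

text \<open>In a Noetherian local ring these are the ideals of finite colength, the unit ideal
  included.\<close>

definition cofinite :: "'a set \<Rightarrow> bool" where
  "cofinite J \<longleftrightarrow> is_ideal J \<and> (\<exists>e. mpow e \<subseteq> J)"

lemma cofinite_ideal: "cofinite J \<Longrightarrow> is_ideal J" by (simp add: cofinite_def)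
lemma cofinite_mono: "cofinite J \<Longrightarrow> is_ideal K \<Longrightarrow> J \<subseteq> K \<Longrightarrow> cofinite K"
  by (auto simp: cofinite_def)
lemma cofinite_pow_max: "cofinite (mpow n)" by (auto simp: cofinite_def is_ideal_pow)
lemma cofinite_pow: "cofinite J \<Longrightarrow> cofinite (ideal_pow J n)"
  unfolding cofinite_def using is_ideal_pow ideal_pow_pow_subset by blast

lemma cofinite_fin: "cofinite J \<Longrightarrow> len {1} J UNIV \<noteq> \<infinity>"
  unfolding cofinite_def using len_finite_mono[OF is_ideal_pow _ _ len_max_pow_finite[OF noeth loc]] by blast

text \<open>\<open>coeffs_in_cancel\<close> asks that the maximal ideal carry the coefficients of
  \<open>f\<close> into the target. This holds modulo \<open>J + m^(i+1)\<close> once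
  \<open>f\<close> is in \<open>J + m^i\<close>, so the cancellation is repeated until
  \<open>m^e \<subseteq> J\<close>.\<close>

lemma wideal_coeffs_in: assumes "cofinite J" shows "wideal W (coeffs_in J)"
  unfolding wideal_def
proof (intro conjI ballI allI impI)
  have J: "is_ideal J" using assms by (rule cofinite_ideal)
  then show "is_ideal (coeffs_in J)" by (rule is_ideal_coeffs_in)
  obtain e where e: "mpow e \<subseteq> J" using assms by (auto simp: cofinite_def)
  fix s f assume s: "s \<in> W" and sf: "s * f \<in> coeffs_in J"
  have "f \<in> coeffs_in (isum J (mpow i))" for i
  proof (induction i)
    case 0
    then show ?case using isum_upper2[OF J, of UNIV] by (auto simp: coeffs_in_def)
  next
    case (Suc i)
    let ?J = "isum J (mpow (Suc i))"
    have iJ: "is_ideal ?J" using J is_ideal_pow by (rule is_ideal_isum)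
    show ?case
    proof (rule coeffs_in_cancel[OF iJ])
      show "s \<notin> coeffs_in M" using s by (simp add: W_def)
      show "s * f \<in> coeffs_in ?J" using sf coeffs_in_mono[OF isum_upper1[OF is_ideal_pow]] by blast
      fix m b assume m: "m \<in> M"
      have "coef f b \<in> isum J (mpow i)" using Suc by (simp add: coeffs_in_def)
      then obtain j k where jk: "coef f b = j + k" "j \<in> J" "k \<in> mpow i"
        by (auto simp: isum_def)
      have "m * j \<in> J" using jk is_ideal_mult[OF J] by blast
      moreover have "m * k \<in> mpow (Suc i)" using m jk by (simp add: ideal_prod_mem)
      ultimately show "m * coef f b \<in> ?J" unfolding isum_def jk(1) distrib_left by blast
    qed
  qed
  from this[of e] show "f \<in> coeffs_in J"
    using coeffs_in_mono[OF isum_least[OF J order_refl e]] by blast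
qed

text \<open>Extension is strictly monotone because constants detect the original ideal, so chains in
  \<open>R\<close> stay chains.\<close>

lemma len_coeffs_in_ge:
  assumes "cofinite J" shows "len {1} J UNIV \<le> len W (coeffs_in J) UNIV"
proof -
  have J: "is_ideal J" using assms by (rule cofinite_ideal)
  have "len {1} J UNIV \<le> len W (coeffs_in J) (coeffs_in UNIV)"
  proof (rule len_le_map)
    show "wideal {1} J" "wideal {1} (UNIV :: 'a set)" using J is_ideal_UNIV by (simp_all add: wideal_one)
    show "wideal W (coeffs_in L)" if "wideal {1} L" "J \<subseteq> L" for L
      using that cofinite_mono[OF assms] by (intro wideal_coeffs_in) (simp add: wideal_one)
    show "coeffs_in L \<subset> coeffs_in K" if "wideal {1} L" "wideal {1} K" "L \<subset> K" for L K
      using that by (intro coeffs_in_psubset) (simp_all add: wideal_one)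
  qed
  then show ?thesis by (simp add: coeffs_in_UNIV)
qed

lemma cofinite_M: "cofinite M" using cofinite_pow_max[of 1] ideal_pow_one[OF M] by simp

lemma len_ext_max_le: "len W (coeffs_in M) UNIV \<le> 1"
proof (rule len_maximal_le)
  fix L assume L: "wideal W L" "coeffs_in M \<subset> L"
  then obtain s where "s \<in> L" "s \<in> W" by (auto simp: W_def)
  then have "1 \<in> L" using wideal_cancel[OF L(1), of s 1] by simp
  then show "L = UNIV" using L wideal_is_ideal is_ideal_one by blast
qed

text \<open>A direct substitute for flatness of \<open>R -> R(t)\<close> with closed fibre a field:
  a socle element \<open>g\<close> of \<open>K/J\<close> is split off, and adjoining it costs at
  most one unit of length over \<open>W\<close>, since \<open>coeffs_in M\<close> annihilates
  it.\<close>

lemma len_coeffs_in_le: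
  assumes "len {1} J K = enat k" "cofinite J" "is_ideal K" "J \<subseteq> K"
  shows "len W (coeffs_in J) (coeffs_in K) \<le> enat k"
  using assms
proof (induction k arbitrary: J rule: less_induct)
  case (less k)
  have J: "is_ideal J" using less.prems(2) by (rule cofinite_ideal)
  note K = less.prems(3) and JK = less.prems(4)
  show ?case
  proof (cases "J = K")
    case True
    then show ?thesis by (simp add: len_refl)
  next
    case False
    obtain e where e: "mpow e \<subseteq> J" using less.prems(2) by (auto simp: cofinite_def)
    \<comment> \<open>The last power of \<open>M\<close> that does not carry \<open>K\<close> into
      \<open>J\<close> provides a product \<open>g\<close> in \<open>K\<close> but not in
      \<open>J\<close> with \<open>M g \<subseteq> J\<close>.\<close>
    let ?P = "\<lambda>i. \<forall>a\<in>mpow i. \<forall>b\<in>K. a * b \<in> J"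
    have "?P e" using e is_ideal_mult'[OF J] by blast
    moreover have "\<not> ?P 0"
    proof
      assume "?P 0"
      then have *: "\<forall>a. \<forall>b\<in>K. a * b \<in> J" by simp
      have "b \<in> J" if "b \<in> K" for b using bspec[OF spec[OF *, of 1] that] by simp
      then show False using False JK by auto
    qed
    ultimately obtain i where i: "\<not> ?P i" "?P (Suc i)"
      using ex_least_nat_less[of ?P e] by blast
    then obtain a b where ab: "a \<in> mpow i" "b \<in> K" "a * b \<notin> J" by blast
    define g where "g = a * b"
    have gK: "g \<in> K" unfolding g_def using is_ideal_mult[OF K ab(2)] .
    have mg: "m * g \<in> J" if "m \<in> M" for m
    proof -
      have "m * a \<in> mpow (Suc i)" using that ab by (simp add: ideal_prod_mem)
      then have "(m * a) * b \<in> J" using i(2) ab by blast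
      then show ?thesis by (simp add: g_def mult.assoc)
    qed
    define J' where "J' = isum J (principal g)"
    have iJ': "is_ideal J'" unfolding J'_def using J is_ideal_principal by (rule is_ideal_isum)
    have JJ': "J \<subseteq> J'" unfolding J'_def by (rule isum_upper1[OF is_ideal_principal])
    have "g \<in> J'" unfolding J'_def using isum_upper2[OF J] principal_self by blast
    then have ss: "J \<subset> J'" using JJ' ab(3) g_def by blast
    have J'K: "J' \<subseteq> K" unfolding J'_def using K JK gK by (intro isum_least principal_least)
    have cJ': "cofinite J'" using less.prems(2) iJ' JJ' by (rule cofinite_mono)
    have add: "len {1} J K = len {1} J J' + len {1} J' K"
      using J iJ' K JJ' J'K by (intro one.len_add) (simp_all add: wideal_one)
    have "1 \<le> len {1} J J'" using J iJ' ss by (intro one.len_pos) (simp_all add: wideal_one)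
    moreover obtain p q where pq: "len {1} J J' = enat p" "len {1} J' K = enat q"
      using add less.prems(1) by (cases "len {1} J J'"; cases "len {1} J' K") auto
    ultimately have p: "1 \<le> p" "k = p + q" using add less.prems(1) by (simp_all add: one_enat_def)
    have IH: "len W (coeffs_in J') (coeffs_in K) \<le> enat q"
      using p pq cJ' K J'K by (intro less.IH) auto
    let ?c = "const_poly g"
    let ?S = "wsum (coeffs_in J) (principal ?c)"
    have wJ: "wideal W (coeffs_in J)" "wideal W (coeffs_in J')"
      using less.prems(2) cJ' by (auto intro: wideal_coeffs_in)
    have wS: "wideal W ?S" using wJ(1) by (intro wideal_wsum is_ideal_principal wideal_is_ideal)
    have iS: "is_ideal ?S" using wS by (rule wideal_is_ideal)
    have JS: "coeffs_in J \<subseteq> ?S" by (rule wsum_upper1[OF is_ideal_principal])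
    have cS: "?c \<in> ?S" using wsum_upper2[OF wideal_is_ideal[OF wJ(1)]] principal_self by blast
    have "coeffs_in J' \<subseteq> ?S"
    proof (rule coeffs_in_least[OF iS])
      fix c assume "c \<in> J'"
      then obtain j r where "c = j + g * r" "j \<in> J" unfolding J'_def isum_def principal_def by blast
      then have c: "const_poly c = const_poly j + ?c * const_poly r" "const_poly j \<in> coeffs_in J"
        by (simp_all add: const_poly_add const_poly_mult const_poly_mem[OF J])
      then show "const_poly c \<in> ?S" using JS is_ideal_mult'[OF iS cS] by (auto intro: is_ideal_add[OF iS])
    qed
    then have "len W (coeffs_in J) (coeffs_in J') \<le> len W (coeffs_in J) ?S"
      using wJ wS coeffs_in_mono[OF JJ'] by (intro len_mono) simp_all
    also have "\<dots> = len W (colon (coeffs_in J) ?c) UNIV" by (rule len_colon[OF wJ(1), symmetric])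
    also have "\<dots> \<le> len W (coeffs_in M) UNIV"
    proof (rule len_mono)
      show "coeffs_in M \<subseteq> colon (coeffs_in J) ?c"
        using mg by (auto simp: colon_def coeffs_in_def lookup_const_mult mult.commute[of g])
    qed (auto intro: wideal_colon wJ wideal_UNIV wideal_coeffs_in cofinite_M)
    also have "\<dots> \<le> 1" by (rule len_ext_max_le)
    finally have 1: "len W (coeffs_in J) (coeffs_in J') \<le> 1" .
    have "len W (coeffs_in J) (coeffs_in K) = len W (coeffs_in J) (coeffs_in J') + len W (coeffs_in J') (coeffs_in K)"
      using wJ wideal_coeffs_in[OF cofinite_mono[OF less.prems(2) K JK]] coeffs_in_mono[OF JJ'] coeffs_in_mono[OF J'K]
      by (intro len_add)
    also have "\<dots> \<le> 1 + enat q" using 1 IH by (rule add_mono)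
    also have "\<dots> \<le> enat k" using p by (simp add: one_enat_def)
    finally show ?thesis .
  qed
qed

lemma len_coeffs_in_UNIV: assumes "cofinite J" shows "len W (coeffs_in J) UNIV = len {1} J UNIV"
proof (rule antisym)
  obtain k where k: "len {1} J UNIV = enat k" using cofinite_fin[OF assms] by auto
  show "len W (coeffs_in J) UNIV \<le> len {1} J UNIV"
    using len_coeffs_in_le[OF k assms is_ideal_UNIV] k by (simp add: coeffs_in_UNIV)
qed (rule len_coeffs_in_ge[OF assms])

text \<open>In degree \<open>n\<close>, the associated graded ring has no nonzero form annihilated
  by all linear forms.\<close>

definition socle_free :: "nat \<Rightarrow> bool" where
  "socle_free n \<longleftrightarrow> (\<forall>x\<in>mpow n. (\<forall>y\<in>M. y * x \<in> mpow (Suc (Suc n))) \<longrightarrow> x \<in> mpow (Suc n))"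

text \<open>The socle lifts to a graded family \<open>P\<close> over the Rees algebra. For large
  \<open>n\<close>, stability gives \<open>P (n+1) \<subseteq> m P n\<close>, and the defining
  property of \<open>P n\<close> puts the right side into \<open>m^(n+2)\<close>.\<close>

lemma socle_eventually: "\<exists>n0. \<forall>n\<ge>n0. socle_free n"
proof -
  obtain S where S: "finite S" "M = ideal_gen S" using noeth M unfolding noetherian_def by blast
  then obtain gs where gs: "set gs = S" using finite_list by blast
  have Mg: "M = ideal_gen (set gs)" using S gs by simp
  define P where "P n = {x\<in>mpow n. \<forall>y\<in>M. y * x \<in> mpow (Suc (Suc n))}" for n
  have "rees_family M P"
    unfolding rees_family_def
  proof (intro conjI allI ballI)
    show "P n \<subseteq> mpow n" for n by (auto simp: P_def)
    show "is_ideal (P n)" for n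
      unfolding is_ideal_def P_def
    proof (intro conjI ballI allI impI CollectI)
      fix r x assume "x \<in> {x \<in> mpow n. \<forall>y\<in>M. y * x \<in> mpow (Suc (Suc n))}"
      then show "r * x \<in> mpow n" "\<And>y. y \<in> M \<Longrightarrow> y * (r * x) \<in> mpow (Suc (Suc n))"
        using is_ideal_mult[OF is_ideal_pow[of M n], of x r] is_ideal_mult[OF is_ideal_pow[of M "Suc (Suc n)"], of _ r]
        by (simp_all only: mem_Collect_eq mult.left_commute[of _ r x])
    qed (auto simp: distrib_left simp del: ideal_pow.simps intro: is_ideal_0[OF is_ideal_pow] is_ideal_add[OF is_ideal_pow])
    fix n x y assume xy: "x \<in> M" "y \<in> P n"
    then have "x * y \<in> mpow (Suc n)" by (auto simp: P_def ideal_prod_mem)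
    moreover have "z * (x * y) \<in> mpow (Suc (Suc (Suc n)))" if "z \<in> M" for z
    proof -
      have "x * y \<in> mpow (Suc (Suc n))" using xy by (simp add: P_def del: ideal_pow.simps)
      then show ?thesis using that ideal_prod_mem by (subst ideal_pow.simps) blast
    qed
    ultimately show "x * y \<in> P (Suc n)" by (simp add: P_def del: ideal_pow.simps)
  qed
  then obtain n0 where n0: "\<forall>n\<ge>n0. P (Suc n) \<subseteq> ideal_prod M (P n)"
    using rees_family_stable[OF noeth, of gs P] unfolding Mg[symmetric] by blast
  have "x \<in> mpow (Suc n)" if n: "n \<ge> Suc n0" and x: "x \<in> P n" for n x
  proof -
    obtain m where m: "n = Suc m" "m \<ge> n0" using n by (cases n) auto
    have "x \<in> ideal_prod M (P m)" using n0 m x by blast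
    moreover have "ideal_prod M (P m) \<subseteq> mpow (Suc (Suc m))"
      by (intro ideal_prod_least is_ideal_pow) (simp add: P_def del: ideal_pow.simps)
    ultimately show ?thesis unfolding m(1) by (rule subsetD[rotated])
  qed
  then show ?thesis unfolding P_def socle_free_def by (intro exI[of _ "Suc n0"]) blast
qed

end

section \<open>The generic linear form is superficial\<close>

locale generic_element = noetherian_local ty for ty :: "'a::comm_ring_1 itself" +
  fixes xs :: "'a list"
  assumes xs: "ideal_gen (set xs) = (max_ideal :: 'a set)"
begin

definition z :: "'a mpoly" where
  "z = (\<Sum>i<length xs. var_poly i * const_poly (xs ! i))"

lemma z_eq: "z = (\<Sum>i<length xs. Poly_Mapping.single (Poly_Mapping.single i 1) (xs ! i))"
  unfolding z_def by (simp add: var_poly_def const_poly_def mult_single)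

lemma xs_mem: "i < length xs \<Longrightarrow> xs ! i \<in> M"
  using xs ideal_gen_superset[of "set xs"] by auto

lemma z_mem: "z \<in> coeffs_in M"
proof -
  have "var_poly i * const_poly (xs ! i) \<in> coeffs_in M" if "i < length xs" for i
    using const_poly_mem[OF M] xs_mem[OF that] is_ideal_mult[OF is_ideal_coeffs_in[OF M]] by blast
  then show ?thesis unfolding z_def by (intro is_ideal_sum is_ideal_coeffs_in M) auto
qed

text \<open>McCoy's argument: if \<open>z\<close> annihilates \<open>f\<close> modulo a higher power, then so does it
  \<open>x\<^sub>i * f\<close>, which has fewer nonzero terms for the largest \<open>i\<close> with \<open>x\<^sub>i * f \<noteq> 0\<close>.\<close>
lemma superficial_step:
  assumes n0: "\<forall>n\<ge>n0. socle_free n"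
    and "n \<ge> n0" "f \<in> mext n" "z * f \<in> mext (Suc (Suc n))"
  shows "f \<in> mext (Suc n)"
  using assms(2-)
proof (induction "card {a. coef f a \<notin> mpow (Suc n)}" arbitrary: f n rule: less_induct)
  case less
  let ?J = "\<lambda>k. mpow k"
  let ?e = "\<lambda>i. Poly_Mapping.single i (1::nat)"
  have iJ: "is_ideal (?J k)" for k by (rule is_ideal_pow)
  have mulJ: "x * y \<in> ?J (Suc k)" if "x \<in> M" "y \<in> ?J k" for x y k
    using that by (simp add: ideal_prod_mem)
  show ?case
  proof (rule ccontr)
    assume neg: "f \<notin> coeffs_in (?J (Suc n))"
    define X where "X = {i. i < length xs \<and> (\<exists>a. xs ! i * coef f a \<notin> ?J (Suc (Suc n)))}"
    \<comment> \<open>If every \<open>xs ! i\<close> annihilated the classes of the coefficients of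
      \<open>f\<close>, these would be socle elements of the associated graded ring.\<close>
    have "X \<noteq> {}"
    proof
      assume "X = {}"
      then have *: "xs ! i * coef f a \<in> ?J (Suc (Suc n))" if "i < length xs" for i a using that by (auto simp: X_def)
      have "coef f a \<in> ?J (Suc n)" for a
      proof -
        have "set xs \<subseteq> colon (?J (Suc (Suc n))) (coef f a)"
          using * by (auto simp: colon_def in_set_conv_nth mult.commute simp del: ideal_pow.simps)
        then have "ideal_gen (set xs) \<subseteq> colon (?J (Suc (Suc n))) (coef f a)"
          by (intro ideal_gen_least is_ideal_colon iJ)
        then have "M \<subseteq> colon (?J (Suc (Suc n))) (coef f a)" by (simp only: xs)
        then have "\<forall>y\<in>M. y * coef f a \<in> ?J (Suc (Suc n))"
          by (auto simp: colon_def mult.commute simp del: ideal_pow.simps)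
        moreover have "coef f a \<in> ?J n" using less.prems(2) by (simp add: coeffs_in_def)
        ultimately show ?thesis using n0 less.prems(1) unfolding socle_free_def by blast
      qed
      then show False using neg by (simp add: coeffs_in_def del: ideal_pow.simps)
    qed
    have finX: "finite X" by (simp add: X_def)
    define i where "i = Max X"
    have i: "i < length xs" "\<exists>a. xs ! i * coef f a \<notin> ?J (Suc (Suc n))"
      using Max_in[OF finX \<open>X \<noteq> {}\<close>] by (auto simp: X_def i_def simp del: ideal_pow.simps)
    have above: "xs ! j * coef f a \<in> ?J (Suc (Suc n))" if "i < j" "j < length xs" for j a
      using Max_ge[OF finX, of j] that unfolding i_def[symmetric] by (auto simp: X_def simp del: ideal_pow.simps)
    define T where "T = {a. coef f a \<notin> ?J (Suc n)}"
    have "T \<subseteq> Poly_Mapping.keys f" using is_ideal_0[OF iJ[of "Suc n"]] by (auto simp: T_def in_keys_iff simp del: ideal_pow.simps)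
    then have finT: "finite T" using finite_subset[OF _ finite_keys] by blast
    have T: "T \<noteq> {}" using neg by (auto simp: T_def coeffs_in_def simp del: ideal_pow.simps)
    \<comment> \<open>The coefficient of \<open>t_i t^a\<close> in \<open>z * f\<close> is examined
      for exponents \<open>a\<close> whose \<open>i\<close>-th entry is \<open>D\<close>.
      Contributions from \<open>j > i\<close> are negligible by maximality of \<open>i\<close>,
      those from \<open>j < i\<close> involve a term of \<open>f\<close> with \<open>i\<close>-th
      entry \<open>D + 1\<close>, outside \<open>T\<close>. So multiplication by
      \<open>xs ! i\<close> removes the top terms from \<open>T\<close>.\<close>
    define D where "D = Max ((\<lambda>a. coef a i) ` T)"
    have D_le: "coef a i \<le> D" if "a \<in> T" for a unfolding D_def using finT that by (intro Max_ge) auto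
    have "D \<in> (\<lambda>a. coef a i) ` T" unfolding D_def using finT T by (intro Max_in) auto
    then obtain a0 where a0: "a0 \<in> T" "coef a0 i = D" by blast
    have top: "xs ! i * coef f a \<in> ?J (Suc (Suc n))" if a: "coef a i = D" for a
    proof -
      let ?t = "\<lambda>j. Poly_Mapping.single (?e j) (xs ! j) * f"
      have other: "coef (?t j) (?e i + a) \<in> ?J (Suc (Suc n))" if j: "j < length xs" "j \<noteq> i" for j
      proof (cases "coef (?t j) (?e i + a) = 0")
        case True
        then show ?thesis using is_ideal_0[OF iJ[of "Suc (Suc n)"]] by (simp del: ideal_pow.simps)
      next
        case False
        then obtain b where b: "?e i + a = ?e j + b" by (rule lookup_single_mult_nonzero)
        then have c: "coef (?t j) (?e i + a) = xs ! j * coef f b" by (simp add: lookup_single_mult)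
        show ?thesis
        proof (cases "i < j")
          case True
          then show ?thesis unfolding c using above j by blast
        next
          case False
          have "coef (?e i + a) i = coef (?e j + b) i" by (simp only: b)
          then have "coef b i = Suc D" using j a by (simp add: lookup_add lookup_single)
          then have "b \<notin> T" using D_le[of b] by auto
          then have "coef f b \<in> ?J (Suc n)" by (simp add: T_def del: ideal_pow.simps)
          then show ?thesis unfolding c using mulJ xs_mem[OF j(1)] by blast
        qed
      qed
      have "coef (z * f) (?e i + a) = (\<Sum>j<length xs. coef (?t j) (?e i + a))"
        by (simp add: z_eq sum_distrib_right lookup_sum)
      also have "\<dots> = coef (?t i) (?e i + a) + (\<Sum>j\<in>{..<length xs} - {i}. coef (?t j) (?e i + a))"
        using i(1) by (intro sum.remove) auto
      also have "coef (?t i) (?e i + a) = xs ! i * coef f a" by (rule lookup_single_mult)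
      finally have eq: "xs ! i * coef f a = coef (z * f) (?e i + a) - (\<Sum>j\<in>{..<length xs} - {i}. coef (?t j) (?e i + a))"
        by simp
      have "coef (z * f) (?e i + a) \<in> ?J (Suc (Suc n))" using less.prems(3) unfolding coeffs_in_def by blast
      moreover have "(\<Sum>j\<in>{..<length xs} - {i}. coef (?t j) (?e i + a)) \<in> ?J (Suc (Suc n))"
        by (intro is_ideal_sum iJ other) auto
      ultimately show ?thesis unfolding eq by (rule is_ideal_diff[OF iJ])
    qed
    define g where "g = const_poly (xs ! i) * f"
    have cg: "coef g a = xs ! i * coef f a" for a by (simp add: g_def lookup_const_mult)
    have "coef f a \<in> ?J n" for a using less.prems(2) by (simp add: coeffs_in_def)
    then have "coef g a \<in> ?J (Suc n)" for a unfolding cg by (intro mulJ[OF xs_mem[OF i(1)]])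
    then have G1: "g \<in> coeffs_in (?J (Suc n))" unfolding coeffs_in_def by blast
    have "coef (z * g) a \<in> ?J (Suc (Suc (Suc n)))" for a
    proof -
      have "z * g = const_poly (xs ! i) * (z * f)" by (simp add: g_def mult.left_commute)
      then have "coef (z * g) a = xs ! i * coef (z * f) a" by (simp add: lookup_const_mult)
      moreover have "coef (z * f) a \<in> ?J (Suc (Suc n))" using less.prems(3) unfolding coeffs_in_def by blast
      ultimately show ?thesis using mulJ xs_mem[OF i(1)] by presburger
    qed
    then have G2: "z * g \<in> coeffs_in (?J (Suc (Suc (Suc n))))" unfolding coeffs_in_def by blast
    have G3: "card {a. coef g a \<notin> ?J (Suc (Suc n))} < card {a. coef f a \<notin> ?J (Suc n)}"
    proof (rule psubset_card_mono)
      show "finite {a. coef f a \<notin> ?J (Suc n)}" using finT unfolding T_def .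
      have "{a. coef g a \<notin> ?J (Suc (Suc n))} \<subseteq> T"
        unfolding T_def cg using mulJ[OF xs_mem[OF i(1)], of _ "Suc n"] by blast
      moreover have "a0 \<notin> {a. coef g a \<notin> ?J (Suc (Suc n))}" unfolding cg using top[OF a0(2)] by blast
      ultimately show "{a. coef g a \<notin> ?J (Suc (Suc n))} \<subset> {a. coef f a \<notin> ?J (Suc n)}"
        using a0(1) unfolding T_def by blast
    qed
    have "n0 \<le> Suc n" using less.prems(1) by simp
    then have "g \<in> coeffs_in (?J (Suc (Suc n)))" by (rule less.hyps[OF G3 _ G1 G2])
    then have "xs ! i * coef f a \<in> ?J (Suc (Suc n))" for a unfolding coeffs_in_def cg[symmetric] by blast
    then show False using i(2) by blast
  qed
qed

text \<open>\<open>superficial_step\<close> raises the order of \<open>f\<close> by one; it is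
  repeated from \<open>n0\<close> up to \<open>c\<close>.\<close>

lemma superficial:
  "\<exists>n0. \<forall>c\<ge>n0. \<forall>f\<in>mext n0. z * f \<in> mext (Suc c) \<longrightarrow>
    f \<in> mext c"
proof -
  obtain n0 where n0: "\<forall>n\<ge>n0. socle_free n" using socle_eventually by blast
  have "f \<in> mext n"
    if f: "f \<in> mext n0" "z * f \<in> mext (Suc c)" and "n0 \<le> n" "n \<le> c" for c f n
    using that(3,4)
  proof (induction n rule: dec_induct)
    case (step n)
    have "mpow (Suc c) \<subseteq> mpow (Suc (Suc n))" using step by (intro ideal_pow_antimono) simp
    then have zf: "z * f \<in> mext (Suc (Suc n))" by (rule subsetD[OF coeffs_in_mono f(2)])
    have "f \<in> mext n" using step by simp
    then show ?case by (rule superficial_step[OF n0 step.hyps(1) _ zf])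
  qed (rule f(1))
  then show ?thesis by (intro exI[of _ n0]) blast
qed

end

section \<open>The multiplicity estimate\<close>

lemma sum_enat: "(\<Sum>j<m. enat (f j)) = enat (\<Sum>j<m. f j)" for m :: nat
  by (induction m) (simp_all add: zero_enat_def)

text \<open>Iterates \<open>len_colon_add\<close>: the summands are the lengths of the pieces of the
  filtration of \<open>S/J\<close> by powers of \<open>x\<close>.\<close>

lemma (in mult_set) len_colon_power:
  assumes "wideal W J"
  shows "len W J UNIV = (\<Sum>j<k. len W (wsum (colon J (x ^ j)) (principal x)) UNIV) + len W (colon J (x ^ k)) UNIV"
proof (induction k)
  case 0
  then show ?case by (simp add: colon_def)
next
  case (Suc k)
  have "colon (colon J (x ^ k)) x = colon J (x ^ Suc k)"
    by (auto simp: colon_def ac_simps)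
  then have "len W (colon J (x ^ k)) UNIV = len W (colon J (x ^ Suc k)) UNIV + len W (wsum (colon J (x ^ k)) (principal x)) UNIV"
    using len_colon_add[OF wideal_colon[OF assms], of "x ^ k" x] by simp
  then show ?case using Suc by (simp add: ac_simps)
qed

text \<open>A product is tested on the two summands separately; the denominator of \<open>a\<close>
  is cancelled at the end because \<open>L\<close> is saturated.\<close>

lemma (in mult_set) wsum_mult_mem:
  assumes "a \<in> wsum J K" "\<And>x. x \<in> J \<Longrightarrow> x * b \<in> L" "\<And>x. x \<in> K \<Longrightarrow> x * b \<in> L" "wideal W L"
  shows "a * b \<in> L"
proof -
  obtain s j k where s: "s \<in> W" "j \<in> J" "k \<in> K" "s * a = j + k" using assms(1) by (rule wsumE)
  have "s * (a * b) = j * b + k * b" using s by (simp add: distrib_right flip: mult.assoc)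
  also have "\<dots> \<in> L" using s assms by (intro is_ideal_add wideal_is_ideal[OF assms(4)]) auto
  finally show ?thesis using wideal_cancel[OF assms(4) s(1)] by blast
qed

context noetherian_local
begin

lemma is_ideal_contraction: assumes "is_ideal L" shows "is_ideal {c. const_poly c \<in> L}"
  unfolding is_ideal_def
proof (intro conjI ballI allI impI CollectI)
  show "const_poly 0 \<in> L" using is_ideal_0[OF assms] by (simp add: const_poly_0)
  show "const_poly (a + b) \<in> L" if "a \<in> {c. const_poly c \<in> L}" "b \<in> {c. const_poly c \<in> L}" for a b
    using that is_ideal_add[OF assms] by (simp add: const_poly_add)
  show "const_poly (r * a) \<in> L" if "a \<in> {c. const_poly c \<in> L}" for r a
    using that is_ideal_mult[OF assms] by (simp add: const_poly_mult)
qed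

text \<open>An extended ideal is generated by its constants, so an inclusion of powers over
  \<open>R[t]\<close> reduces to products of elements of \<open>R\<close>.\<close>

lemma coeffs_in_pow_add_least:
  assumes "is_ideal L" "\<And>x y. x \<in> mpow a \<Longrightarrow> y \<in> mpow b \<Longrightarrow> const_poly x * const_poly y \<in> L"
  shows "mext (a + b) \<subseteq> L"
proof -
  have "mpow (a + b) \<subseteq> {c. const_poly c \<in> L}"
    using assms by (intro ideal_pow_add_least is_ideal_contraction) (simp_all add: const_poly_mult)
  then show ?thesis by (intro coeffs_in_least assms(1)) blast
qed

lemma const_mult_mem_pow:
  assumes "x \<in> mpow a" "f \<in> mext b"
  shows "const_poly x * f \<in> mext (a + b)"
  using assms(2) ideal_pow_mult[OF assms(1)] by (simp add: coeffs_in_def lookup_const_mult)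

text \<open>Powers of the maximal ideal of an Artinian local ring decrease strictly until they vanish.\<close>
lemma pow_subset_of_len_le:
  assumes L: "wideal W L" and e: "mext e \<subseteq> L" and len: "len W L UNIV \<le> enat i"
  shows "mext i \<subseteq> L"
proof (rule ccontr)
  assume neg: "\<not> mext i \<subseteq> L"
  define B where "B s = wsum L (mext s)" for s
  have iL: "is_ideal L" using L by (rule wideal_is_ideal)
  have iE: "is_ideal (mext s)" for s by (intro is_ideal_coeffs_in is_ideal_pow)
  have wB: "wideal W (B s)" for s unfolding B_def using iL iE by (rule wideal_wsum)
  have iB: "is_ideal (B s)" for s using wB by (rule wideal_is_ideal)
  have LB: "L \<subseteq> B s" for s unfolding B_def using iE by (rule wsum_upper1)
  have EB: "mext s \<subseteq> B s" for s unfolding B_def using iL by (rule wsum_upper2)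
  have anti: "B t \<subseteq> B s" if "s \<le> t" for s t
    unfolding B_def using that by (intro wsum_mono coeffs_in_mono ideal_pow_antimono order_refl)
  \<comment> \<open>Multiplying the inclusion by powers of \<open>M\<close> repeats it in all higher
    degrees, until \<open>B e = L\<close> is reached.\<close>
  have stable: "B s \<subseteq> L" if "B s \<subseteq> B (Suc s)" for s
  proof -
    have "B (t + s) \<subseteq> B (t + Suc s)" for t
    proof -
      have "mext (t + s) \<subseteq> B (t + Suc s)"
      proof (rule coeffs_in_pow_add_least[OF iB])
        fix x y assume x: "x \<in> mpow t" and y: "y \<in> mpow s"
        have "const_poly y \<in> wsum L (mext (Suc s))"
          using y EB[of s] that const_poly_mem[OF is_ideal_pow, of y M s] unfolding B_def[of "Suc s"] by blast
        then have "const_poly y * const_poly x \<in> B (t + Suc s)"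
        proof (rule wsum_mult_mem)
          show "f * const_poly x \<in> B (t + Suc s)" if "f \<in> L" for f
            using LB is_ideal_mult'[OF iL that] by blast
          show "f * const_poly x \<in> B (t + Suc s)" if "f \<in> mext (Suc s)" for f
          proof -
            have "const_poly x * f \<in> mext (t + Suc s)" using x that by (rule const_mult_mem_pow)
            then show ?thesis using EB by (subst mult.commute) blast
          qed
        qed (rule wB)
        then show "const_poly x * const_poly y \<in> B (t + Suc s)" by (simp only: mult.commute)
      qed
      then show ?thesis unfolding B_def[of "t + s"] using wB LB by (intro wsum_least)
    qed
    then have "B (t + s) \<subseteq> B (Suc t + s)" for t by simp
    then have "B s \<subseteq> B (t + s)" for t by (induction t) (simp, blast)
    then have "B s \<subseteq> B (e + s)" .
    also have "\<dots> \<subseteq> B e" by (rule anti) simp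
    also have "\<dots> = L" unfolding B_def using L iE e by (rule wsum_absorb2)
    finally show ?thesis .
  qed
  have nL: "\<not> B s \<subseteq> L" if "s \<le> i" for s
    using neg EB[of i] anti[OF that] by blast
  \<comment> \<open>\<open>B i\<close> is strictly above \<open>L\<close>, and each of the
    \<open>i\<close> steps up to \<open>B 0\<close> is strict: length at least \<open>i + 1\<close>
    in total.\<close>
  have "enat (Suc t) \<le> len W L (B (i - t))" if "t \<le> i" for t
    using that
  proof (induction t)
    case 0
    have "L \<subset> B i" using LB nL by blast
    then show ?case using len_pos[OF L wB] by (simp add: one_enat_def)
  next
    case (Suc t)
    define s where "s = i - Suc t"
    have s: "Suc s = i - t" "s \<le> i" using Suc.prems by (auto simp: s_def)
    have "B (Suc s) \<subset> B s" using anti[of s "Suc s"] stable[of s] nL[OF s(2)] by auto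
    then have "1 \<le> len W (B (Suc s)) (B s)" by (rule len_pos[OF wB wB])
    moreover have "enat (Suc t) \<le> len W L (B (Suc s))" using Suc s by simp
    ultimately have "enat (Suc t) + 1 \<le> len W L (B (Suc s)) + len W (B (Suc s)) (B s)" by (intro add_mono)
    also have "\<dots> = len W L (B s)" using L wB LB anti[of s "Suc s"] by (intro len_add[symmetric]) auto
    finally show ?case by (simp add: s_def one_enat_def)
  qed
  from this[of i] have "enat (Suc i) \<le> len W L (B 0)" by simp
  moreover have "B 0 = UNIV" using EB[of 0] by (auto simp: coeffs_in_UNIV)
  ultimately have "enat (Suc i) \<le> enat i" using len by (metis order_trans)
  then show False by simp
qed

lemma len_ext_finite:
  assumes "cofinite J" "coeffs_in J \<subseteq> L" "wideal W L" shows "len W L UNIV \<noteq> \<infinity>"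
proof (rule enat_le_finite)
  show "len W L UNIV \<le> len W (coeffs_in J) UNIV"
    using assms by (intro len_mono wideal_coeffs_in wideal_UNIV) auto
  show "len W (coeffs_in J) UNIV \<noteq> \<infinity>" using len_coeffs_in_UNIV cofinite_fin assms(1) by simp
qed

definition wlen :: "'a mpoly set \<Rightarrow> nat" where
  "wlen L = the_enat (len W L UNIV)"

lemma wlen_eq: "cofinite J \<Longrightarrow> coeffs_in J \<subseteq> L \<Longrightarrow> wideal W L \<Longrightarrow> len W L UNIV = enat (wlen L)"
  using len_ext_finite[of J L] by (auto simp: wlen_def)

lemma wlen_mono:
  assumes "cofinite J" "coeffs_in J \<subseteq> L" "wideal W L" "wideal W K" "L \<subseteq> K"
  shows "wlen K \<le> wlen L"
proof -
  have "len W K UNIV \<le> len W L UNIV" using assms by (intro len_mono wideal_UNIV) auto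
  moreover have "coeffs_in J \<subseteq> K" using assms by blast
  ultimately show ?thesis using wlen_eq[OF assms(1)] assms by simp
qed

end

section \<open>Growth of the lengths of \<open>S/(m^c + z)\<close>\<close>

context generic_element
begin

definition A :: "nat \<Rightarrow> 'a mpoly set" where
  "A c = wsum (mext c) (principal z)"

lemma wideal_A: "wideal W (A c)"
  unfolding A_def by (intro wideal_wsum is_ideal_coeffs_in is_ideal_pow is_ideal_principal)
lemma A_upper: "mext c \<subseteq> A c" "z * f \<in> A c"
proof -
  show "mext c \<subseteq> A c" unfolding A_def by (rule wsum_upper1[OF is_ideal_principal])
  have "principal z \<subseteq> A c" unfolding A_def
    by (rule wsum_upper2[OF is_ideal_coeffs_in[OF is_ideal_pow]])
  then show "z * f \<in> A c" by (auto simp: principal_def)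
qed
lemma A_antimono: "c \<le> d \<Longrightarrow> A d \<subseteq> A c"
  unfolding A_def by (intro wsum_mono coeffs_in_mono ideal_pow_antimono order_refl)

lemma wlen_A_mono: "c \<le> d \<Longrightarrow> wlen (A c) \<le> wlen (A d)"
  using wlen_mono[OF cofinite_pow_max A_upper(1) wideal_A wideal_A A_antimono] .

lemma wlen_A_0: "wlen (A 0) = 0"
proof -
  have "A 0 = UNIV" using A_upper(1)[of 0] by (auto simp: coeffs_in_UNIV)
  then show ?thesis by (simp add: wlen_def len_refl zero_enat_def)
qed

text \<open>With \<open>J = m^(c+1)S\<close>, the length of \<open>S/(J + z)\<close> equals that of
  \<open>(J : z)/J\<close>. This consists of \<open>m^c/m^(c+1)\<close> and a remainder
  \<open>(J : z)/m^cS\<close> bounded independently of \<open>c\<close>.\<close>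

lemma wlen_A_Suc:
  "\<exists>C n0. \<forall>c\<ge>n0. real (wlen (A (Suc c))) \<le> rlen (mpow (Suc c)) (mpow c) + real C"
proof -
  obtain n0 where n0: "\<And>c f. c \<ge> n0 \<Longrightarrow> f \<in> mext n0 \<Longrightarrow>
    z * f \<in> mext (Suc c) \<Longrightarrow> f \<in> mext c"
    using superficial by blast
  define C where "C = wlen (mext n0)"
  have "real (wlen (A (Suc c))) \<le> rlen (mpow (Suc c)) (mpow c) + real C" if c: "c \<ge> n0" for c
  proof -
    define J where "J = mext (Suc c)"
    define K where "K = mext c"
    define Y where "Y = mext n0"
    define X where "X = colon J z"
    have w: "wideal W J" "wideal W K" "wideal W Y"
      unfolding J_def K_def Y_def by (intro wideal_coeffs_in cofinite_pow_max)+
    have wX: "wideal W X" unfolding X_def using w(1) by (rule wideal_colon)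
    have JK: "J \<subseteq> K" unfolding J_def K_def by (rule coeffs_in_mono[OF ideal_pow_Suc_subset])
    have KX: "K \<subseteq> X"
    proof
      fix f assume "f \<in> K"
      then have "z * f \<in> J" unfolding K_def J_def
        by (intro coeffs_in_mult[OF is_ideal_pow _ z_mem]) (simp_all add: ideal_prod_mem)
      then show "f \<in> X" by (simp add: X_def colon_def)
    qed
    have KY: "K \<subseteq> Y" unfolding K_def Y_def using c by (intro coeffs_in_mono ideal_pow_antimono)
    \<comment> \<open>Superficiality: within \<open>Y\<close> the colon ideal is no larger than
      \<open>K\<close>. Hence \<open>X/K\<close> embeds in \<open>S/Y\<close>, whose length is the
      constant \<open>C\<close>.\<close>
    have XY: "X \<inter> Y = K" using KX KY n0[OF c] by (auto simp: X_def Y_def J_def K_def colon_def simp del: ideal_pow.simps)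
    have "len W K X \<le> len W Y (wsum X Y)" using len_Int_le[OF wX w(3)] by (simp add: XY)
    also have "\<dots> \<le> len W Y UNIV"
      using w wX by (intro len_mono wideal_wsum wideal_is_ideal wideal_UNIV wsum_upper2) auto
    also have "\<dots> = enat C" unfolding C_def Y_def
      by (rule wlen_eq[OF cofinite_pow_max order_refl]) (use w Y_def in simp)
    finally have KX_len: "len W K X \<le> enat C" .
    have fin1: "len {1} (mpow (Suc c)) (mpow c) \<noteq> \<infinity>"
    proof (rule enat_le_finite)
      show "len {1} (mpow (Suc c)) (mpow c) \<le> len {1} (mpow (Suc c)) UNIV"
        using ideal_pow_Suc_subset[of M c]
        by (intro one.len_mono) (simp_all add: wideal_one is_ideal_pow is_ideal_prod is_ideal_UNIV)
    qed (rule cofinite_fin[OF cofinite_pow_max])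
    then obtain h where h: "len {1} (mpow (Suc c)) (mpow c) = enat h" by auto
    have JK_len: "len W J K \<le> enat h" unfolding J_def K_def
      using h cofinite_pow_max is_ideal_pow ideal_pow_Suc_subset by (rule len_coeffs_in_le)
    \<comment> \<open>Two decompositions of the length of \<open>S/J\<close> share the finite length
      of \<open>S/X\<close>, which is cancelled.\<close>
    have "len W J UNIV = len W X UNIV + len W (A (Suc c)) UNIV"
      using len_colon_add[OF w(1), of z] by (simp add: X_def A_def J_def)
    moreover have "len W J UNIV = len W J X + len W X UNIV"
      using w wX JK KX by (intro len_add wideal_UNIV) auto
    moreover have "len W X UNIV \<noteq> \<infinity>"
      using cofinite_pow_max JK KX wX by (intro len_ext_finite[of "mpow (Suc c)"]) (auto simp: J_def simp del: ideal_pow.simps)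
    ultimately have "len W (A (Suc c)) UNIV = len W J X"
      by (metis add.commute enat_add_left_cancel)
    also have "\<dots> = len W J K + len W K X" using w wX JK KX by (intro len_add)
    also have "\<dots> \<le> enat h + enat C" using JK_len KX_len by (rule add_mono)
    finally have "wlen (A (Suc c)) \<le> h + C"
      using wlen_eq[OF cofinite_pow_max A_upper(1) wideal_A] by simp
    then show ?thesis using h by (simp add: rlen_def)
  qed
  then show ?thesis by blast
qed

lemma wlen_A_linear:
  assumes dim: "krull_dim TYPE('a) \<le> 2"
  shows "\<exists>C. \<forall>c. real (wlen (A c)) \<le> hs_mult 2 M * real c + C"
proof -
  have M1: "mpow 1 \<subseteq> M" using ideal_pow_one[OF M] by simp
  obtain a b d where a: "a \<ge> 0" "hs_mult 2 M = 2 * a"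
    and ev: "\<forall>\<^sub>F n in sequentially. rlen (mpow n) UNIV = a * (real n)\<^sup>2 + b * real n + d"
    using hilbert_samuel(2)[OF noeth loc dim M M1] by blast
  obtain N where N: "\<And>n. n \<ge> N \<Longrightarrow> rlen (mpow n) UNIV = a * (real n)\<^sup>2 + b * real n + d"
    using ev by (auto simp: eventually_sequentially)
  obtain C n0 where C: "\<And>c. c \<ge> n0 \<Longrightarrow> real (wlen (A (Suc c))) \<le> rlen (mpow (Suc c)) (mpow c) + real C"
    using wlen_A_Suc by blast
  define m where "m = max N n0"
  \<comment> \<open>The last summand covers the exponents up to \<open>Suc m\<close>, where the
    polynomial formula is not yet available, by monotonicity.\<close>
  define C' where "C' = \<bar>a + b\<bar> + real C + real (wlen (A (Suc m)))"
  have "real (wlen (A c)) \<le> hs_mult 2 M * real c + C'" for c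
  proof (cases "c \<le> Suc m")
    case True
    then have "real (wlen (A c)) \<le> real (wlen (A (Suc m)))" using wlen_A_mono by simp
    moreover have "0 \<le> hs_mult 2 M * real c" using a by simp
    ultimately show ?thesis unfolding C'_def by linarith
  next
    case False
    then obtain k where k: "c = Suc k" "k \<ge> m" by (cases c) auto
    have "rlen (mpow (Suc k)) UNIV = rlen (mpow (Suc k)) (mpow k) + rlen (mpow k) UNIV"
      using ideal_pow_Suc_subset cofinite_fin[OF cofinite_pow_max]
      by (intro rlen_add is_ideal_pow is_ideal_UNIV subset_UNIV)
    \<comment> \<open>The first difference of the Hilbert-Samuel polynomial; its slope
      \<open>2 * a\<close> is the multiplicity.\<close>
    then have "rlen (mpow (Suc k)) (mpow k) = 2 * a * real k + a + b"
      using N[of k] N[of "Suc k"] k by (simp add: m_def power2_eq_square algebra_simps)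
    then have "real (wlen (A c)) \<le> 2 * a * real k + a + b + real C" using C[of k] k by (simp add: m_def)
    also have "\<dots> \<le> 2 * a * real c + (\<bar>a + b\<bar> + real C)" using k a(1) by (simp add: algebra_simps)
    finally show ?thesis using a unfolding C'_def by simp
  qed
  then show ?thesis by blast
qed

end

section \<open>The filtration of \<open>S/I^nS\<close> by powers of \<open>z\<close>\<close>

locale generic_element_ideal = generic_element ty xs for ty :: "'a::comm_ring_1 itself" and xs +
  fixes I :: "'a set" and e :: nat
  assumes I: "is_ideal I" and e: "ideal_pow max_ideal e \<subseteq> I"
begin

lemma cofinite_I: "cofinite I" using I e by (auto simp: cofinite_def)

text \<open>\<open>S/Q n j\<close> is isomorphic to \<open>(I^n + z^j S)/(I^n + z^(j+1) S)\<close>,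
  the \<open>j\<close>-th piece of the filtration.\<close>

definition Q :: "nat \<Rightarrow> nat \<Rightarrow> 'a mpoly set" where
  "Q n j = wsum (colon (coeffs_in (ideal_pow I n)) (z ^ j)) (principal z)"

definition D :: "nat \<Rightarrow> nat \<Rightarrow> nat \<Rightarrow> bool" where
  "D n j c \<longleftrightarrow> mext c \<subseteq> Q n j"

lemma wideal_pow_I: "wideal W (coeffs_in (ideal_pow I n))"
  by (intro wideal_coeffs_in cofinite_pow cofinite_I)
lemma wideal_Q: "wideal W (Q n j)"
  unfolding Q_def by (intro wideal_wsum is_ideal_colon wideal_is_ideal[OF wideal_pow_I] is_ideal_principal)
lemma Q_upper1: "colon (coeffs_in (ideal_pow I n)) (z ^ j) \<subseteq> Q n j"
  unfolding Q_def by (rule wsum_upper1[OF is_ideal_principal])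
lemma Q_upper2: "principal z \<subseteq> Q n j"
  unfolding Q_def by (intro wsum_upper2 is_ideal_colon wideal_is_ideal[OF wideal_pow_I])
lemma pow_I_Q: "coeffs_in (ideal_pow I n) \<subseteq> Q n j"
proof -
  have "coeffs_in (ideal_pow I n) \<subseteq> colon (coeffs_in (ideal_pow I n)) (z ^ j)"
    using is_ideal_mult[OF wideal_is_ideal[OF wideal_pow_I]] by (auto simp: colon_def)
  then show ?thesis using Q_upper1 by blast
qed

lemma z_pow_mem: "z ^ (e * n) \<in> coeffs_in (ideal_pow I n)"
proof -
  have "z ^ k \<in> mext k" for k
    by (induction k) (auto simp: coeffs_in_UNIV intro!: coeffs_in_mult[OF is_ideal_prod _ z_mem] ideal_prod_mem)
  then show ?thesis using coeffs_in_mono[OF ideal_pow_pow_subset[OF e]] by blast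
qed

lemma colon_z_pow: "colon (coeffs_in (ideal_pow I n)) (z ^ (e * n)) = UNIV"
  using z_pow_mem[of n] is_ideal_mult'[OF wideal_is_ideal[OF wideal_pow_I]] by (auto simp: colon_def)

lemma colon_mono_pow: assumes "j \<le> j'"
  shows "colon (coeffs_in (ideal_pow I n)) (z ^ j) \<subseteq> colon (coeffs_in (ideal_pow I n)) (z ^ j')"
proof
  fix f assume "f \<in> colon (coeffs_in (ideal_pow I n)) (z ^ j)"
  then have "z ^ (j' - j) * (z ^ j * f) \<in> coeffs_in (ideal_pow I n)"
    using is_ideal_mult[OF wideal_is_ideal[OF wideal_pow_I], of "z ^ j * f" n] by (simp add: colon_def)
  moreover have "z ^ (j' - j) * (z ^ j * f) = z ^ j' * f" using assms by (simp flip: mult.assoc power_add)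
  ultimately show "f \<in> colon (coeffs_in (ideal_pow I n)) (z ^ j')" by (simp add: colon_def)
qed

lemma D_mono_j: "D n j c \<Longrightarrow> j \<le> j' \<Longrightarrow> D n j' c"
  unfolding D_def Q_def using wsum_mono[OF colon_mono_pow order_refl] by (meson order_trans)

lemma D_mono_c: "D n j c \<Longrightarrow> c \<le> c' \<Longrightarrow> D n j c'"
  unfolding D_def using coeffs_in_mono[OF ideal_pow_antimono] by (meson order_trans)

lemma D_colon: "D n (e * n) c"
  unfolding D_def using Q_upper1[of n "e * n"] by (auto simp: colon_z_pow)

lemma D_0: "D 0 0 0"
  unfolding D_def using pow_I_Q[of 0 0] by (simp add: coeffs_in_UNIV)

text \<open>If \<open>z^j f\<close> is in \<open>I^m\<close> and \<open>z^j' g\<close> in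
  \<open>I^n\<close>, then \<open>z^(j+j') f g\<close> is in \<open>I^(m+n)\<close>; multiples of
  \<open>z\<close> are absorbed by \<open>Q\<close>.\<close>

lemma D_add: assumes "D m j c" "D n j' c'" shows "D (m + n) (j + j') (c + c')"
  unfolding D_def
proof (rule coeffs_in_pow_add_least[OF wideal_is_ideal[OF wideal_Q]])
  fix x y assume x: "x \<in> mpow c" and y: "y \<in> mpow c'"
  let ?Q = "Q (m + n) (j + j')"
  have iQ: "is_ideal ?Q" by (rule wideal_is_ideal[OF wideal_Q])
  have z: "z * f * g \<in> ?Q" for f g
  proof -
    have "z * f * g \<in> principal z" unfolding principal_def mult.assoc by (rule rangeI)
    then show ?thesis using Q_upper2 by blast
  qed
  have "const_poly x \<in> Q m j" using assms(1) x const_poly_mem[OF is_ideal_pow, of x M c] unfolding D_def by blast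
  then have x': "const_poly x \<in> wsum (colon (coeffs_in (ideal_pow I m)) (z ^ j)) (principal z)" unfolding Q_def .
  have "const_poly y \<in> Q n j'" using assms(2) y const_poly_mem[OF is_ideal_pow, of y M c'] unfolding D_def by blast
  then have y': "const_poly y \<in> wsum (colon (coeffs_in (ideal_pow I n)) (z ^ j')) (principal z)" unfolding Q_def .
  show "const_poly x * const_poly y \<in> ?Q"
    using x'
  proof (rule wsum_mult_mem[OF _ _ _ wideal_Q])
    show "f * const_poly y \<in> ?Q" if "f \<in> principal z" for f using that z by (auto simp: principal_def)
    show "f * const_poly y \<in> ?Q" if f: "f \<in> colon (coeffs_in (ideal_pow I m)) (z ^ j)" for f
    proof -
      have "const_poly y * f \<in> ?Q"
        using y'
      proof (rule wsum_mult_mem[OF _ _ _ wideal_Q])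
        show "g * f \<in> ?Q" if "g \<in> principal z" for g using that z by (auto simp: principal_def)
        show "g * f \<in> ?Q" if g: "g \<in> colon (coeffs_in (ideal_pow I n)) (z ^ j')" for g
        proof -
          have "(z ^ j * f) * (z ^ j' * g) \<in> coeffs_in (ideal_pow I (m + n))"
            using f g by (intro coeffs_in_mult[OF is_ideal_pow ideal_pow_mult]) (simp_all add: colon_def)
          moreover have "(z ^ j * f) * (z ^ j' * g) = z ^ (j + j') * (g * f)" by (simp add: power_add ac_simps)
          ultimately have "g * f \<in> colon (coeffs_in (ideal_pow I (m + n))) (z ^ (j + j'))" by (simp add: colon_def)
          then show ?thesis using Q_upper1 by blast
        qed
      qed
      then show ?thesis by (simp only: mult.commute)
    qed
  qed
qed

lemma D_times: "D 1 j c \<Longrightarrow> D n (n * j) (n * c)"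
proof (induction n)
  case (Suc n)
  then show ?case using D_add[of 1 j c n "n * j" "n * c"] by simp
qed (simp add: D_0)

lemma wlen_Q_le: assumes "D n j c" shows "wlen (Q n j) \<le> wlen (A c)"
proof -
  have "A c \<subseteq> Q n j" unfolding A_def
    using assms Q_upper2 by (intro wsum_least wideal_Q) (simp_all add: D_def)
  then show ?thesis by (intro wlen_mono[OF cofinite_pow_max A_upper(1) wideal_A wideal_Q])
qed

text \<open>The filtration has at most \<open>e * n\<close> nonzero pieces because
  \<open>z ^ (e * n)\<close> lies in the extension of \<open>I^n\<close>.\<close>

lemma wlen_pow_I: "wlen (coeffs_in (ideal_pow I n)) = (\<Sum>j<e * n. wlen (Q n j))"
proof -
  have eq: "len W (Q n j) UNIV = enat (wlen (Q n j))" for j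
    by (rule wlen_eq[OF cofinite_pow[OF cofinite_I] pow_I_Q wideal_Q])
  have "len W (coeffs_in (ideal_pow I n)) UNIV = (\<Sum>j<e * n. len W (Q n j) UNIV)"
    using len_colon_power[OF wideal_pow_I, where k = "e * n" and x = z] by (simp add: Q_def colon_z_pow len_refl)
  also have "\<dots> = enat (\<Sum>j<e * n. wlen (Q n j))"
    unfolding eq by (rule sum_enat)
  finally show ?thesis by (simp add: wlen_def)
qed

section \<open>Lattice point counts and the polygon\<close>

definition b :: "nat \<Rightarrow> nat" where "b i = (LEAST j. D 1 j i)"

lemma D_b: "D 1 j i \<longleftrightarrow> b i \<le> j"
proof
  show "b i \<le> j" if "D 1 j i" unfolding b_def using that by (rule Least_le)
  have "D 1 (b i) i" unfolding b_def using D_colon[of 1 i] by (rule LeastI)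
  then show "D 1 j i" if "b i \<le> j" using that D_mono_j by blast
qed

text \<open>Pairs \<open>(i, j)\<close> with \<open>j < b i\<close> are counted by columns and by
  rows. For fixed \<open>j\<close> these are the \<open>i\<close> with \<open>m^i\<close> not inside
  \<open>Q 1 j\<close>; there are at most as many as the length of \<open>S/Q 1 j\<close>, and these
  lengths add up to that of \<open>S/I\<close>.\<close>

lemma sum_b_le: "(\<Sum>i<k. b i) \<le> wlen (coeffs_in I)"
proof -
  have b: "b i \<le> e" for i using D_colon[of 1 i] D_b[of e i] by simp
  have "(\<Sum>i<k. b i) = (\<Sum>i<k. \<Sum>j<e. if j < b i then 1 else 0)"
  proof (rule sum.cong[OF refl])
    fix i
    have "{j\<in>{..<e}. j < b i} = {..<b i}" using b[of i] by auto
    then show "b i = (\<Sum>j<e. if j < b i then 1 else 0)" by (simp add: sum.If_cases Int_def)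
  qed
  also have "\<dots> = (\<Sum>j<e. \<Sum>i<k. if j < b i then 1 else 0)" by (rule sum.swap)
  also have "\<dots> \<le> (\<Sum>j<e. wlen (Q 1 j))"
  proof (rule sum_mono)
    fix j
    have "i < wlen (Q 1 j)" if "j < b i" for i
    proof (rule ccontr)
      assume "\<not> ?thesis"
      then have l: "len W (Q 1 j) UNIV \<le> enat i"
        using wlen_eq[OF cofinite_pow[OF cofinite_I] pow_I_Q wideal_Q, of 1 j] by simp
      have "mext e \<subseteq> Q 1 j"
        using coeffs_in_mono[OF e] pow_I_Q[of 1 j] ideal_pow_one[OF I] by simp
      then have "D 1 j i" unfolding D_def using l by (rule pow_subset_of_len_le[OF wideal_Q])
      then show False using that D_b by simp
    qed
    then have "{i\<in>{..<k}. j < b i} \<subseteq> {..<wlen (Q 1 j)}" by auto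
    then have "card {i\<in>{..<k}. j < b i} \<le> wlen (Q 1 j)" using card_mono[of "{..<wlen (Q 1 j)}"] by simp
    then show "(\<Sum>i<k. if j < b i then 1 else 0) \<le> wlen (Q 1 j)" by (simp add: sum.If_cases Int_def)
  qed
  also have "\<dots> = wlen (coeffs_in I)" using wlen_pow_I[of 1] ideal_pow_one[OF I] by simp
  finally show ?thesis .
qed

text \<open>The boundary of the \<open>n\<close>-fold dilation of the lattice polygon with vertices \<open>(b i, i)\<close>.\<close>
definition B :: "nat \<Rightarrow> nat \<Rightarrow> nat" where
  "B n c = (n - c mod n) * b (c div n) + (c mod n) * b (Suc (c div n))"

text \<open>Linear interpolation: with \<open>c = n i + q\<close>, take \<open>n - q\<close> copies
  of the inclusion at vertex \<open>i\<close> and \<open>q\<close> copies of the one at vertex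
  \<open>i + 1\<close>.\<close>

lemma D_B: assumes "n > 0" shows "D n (B n c) c"
proof -
  define i q where "i = c div n" and "q = c mod n"
  have q: "q < n" "c = n * i + q" using assms by (simp_all add: i_def q_def)
  have "D ((n - q) + q) ((n - q) * b i + q * b (Suc i)) ((n - q) * i + q * Suc i)"
    by (intro D_add D_times) (simp_all add: D_b del: One_nat_def)
  moreover have "(n - q) * i + q * Suc i = c"
    using q by (metis add.assoc add.commute add_mult_distrib le_add_diff_inverse2 less_imp_le mult_Suc_right)
  ultimately show ?thesis using q(1) by (simp add: B_def i_def q_def)
qed

text \<open>Groups \<open>c\<close> into blocks of length \<open>n\<close>, one trapezoid between
  neighbouring vertices per block; \<open>b k = 0\<close> closes the polygon, so the shifted sum
  loses just \<open>b 0\<close>.\<close>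

lemma sum_B:
  assumes "b k = 0"
  shows "real (\<Sum>c<k * n. B n c) = (real n)\<^sup>2 * real (\<Sum>i<k. b i) - real n * (real n - 1) / 2 * real (b 0)"
proof -
  have "(\<Sum>c<k * n. B n c) = (\<Sum>i<k. sum (B n) {i * n..<i * n + n})" by (rule sum.nat_group[symmetric])
  also have "\<dots> = (\<Sum>i<k. \<Sum>q<n. (n - q) * b i + q * b (Suc i))"
  proof (rule sum.cong[OF refl])
    fix i
    have "sum (B n) {i * n..<i * n + n} = (\<Sum>q<n. B n (q + i * n))"
      using sum.shift_bounds_nat_ivl[of "B n" 0 "i * n" n] by (simp add: atLeast0LessThan add.commute)
    also have "\<dots> = (\<Sum>q<n. (n - q) * b i + q * b (Suc i))"
      by (intro sum.cong refl) (simp add: B_def)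
    finally show "sum (B n) {i * n..<i * n + n} = (\<Sum>q<n. (n - q) * b i + q * b (Suc i))" .
  qed
  finally have eq: "real (\<Sum>c<k * n. B n c) = (\<Sum>i<k. \<Sum>q<n. (real n - real q) * real (b i) + real q * real (b (Suc i)))"
    by (simp add: of_nat_diff)
  have sq: "(\<Sum>q<n. real q) = real n * (real n - 1) / 2"
    by (induction n) (simp_all add: field_simps)
  have inner: "(\<Sum>q<n. (real n - real q) * x + real q * y) = real n * (real n + 1) / 2 * x + real n * (real n - 1) / 2 * y" for x y
  proof -
    have "(\<Sum>q<n. (real n - real q) * x + real q * y) = (\<Sum>q<n. real n * x) + (\<Sum>q<n. real q) * (y - x)"
      unfolding sum_distrib_right sum.distrib[symmetric] by (intro sum.cong refl) (simp add: algebra_simps)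
    then show ?thesis unfolding sq by (simp add: field_simps)
  qed
  have shift: "(\<Sum>i<k. real (b (Suc i))) = (\<Sum>i<k. real (b i)) - real (b 0)"
    using sum.lessThan_Suc_shift[of "\<lambda>i. real (b i)" k] assms by simp
  have "real (\<Sum>c<k * n. B n c) = real n * (real n + 1) / 2 * (\<Sum>i<k. real (b i)) + real n * (real n - 1) / 2 * (\<Sum>i<k. real (b (Suc i)))"
    unfolding eq inner by (simp add: sum.distrib sum_distrib_left)
  then show ?thesis unfolding shift by (simp add: field_simps power2_eq_square)
qed

lemma wlen_pow_I_le:
  assumes k: "b k = 0" and n: "n > 0" and g: "g \<ge> 0"
    and lin: "\<And>c. real (wlen (A c)) \<le> g * real c + C"
  shows "real (wlen (coeffs_in (ideal_pow I n))) \<le>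
    g * ((real n)\<^sup>2 * real (\<Sum>i<k. b i) - real n * (real n - 1) / 2 * real (b 0)) + C * real n * real (b 0)"
proof -
  have C: "C \<ge> 0" using lin[of 0] by simp
  have "D n (n * b k) (n * k)" by (rule D_times) (simp add: D_b del: One_nat_def)
  then have Dk: "D n j (k * n)" for j using D_mono_j[of n 0 "k * n" j] k by (simp add: mult.commute)
  \<comment> \<open>The polygon seen along the other axis: \<open>c < h j\<close> forces
    \<open>j < B n c\<close>, so the sum of the \<open>h j\<close> is at most the sum of the
    \<open>B n c\<close>.\<close>
  define h where "h j = (LEAST c. D n j c)" for j
  have Dh: "D n j (h j)" for j unfolding h_def using Dk by (rule LeastI)
  have h_le: "h j \<le> c" if "D n j c" for j c unfolding h_def using that by (rule Least_le)
  have hB: "c < h j \<Longrightarrow> j < B n c" for j c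
    using h_le[of j c] D_mono_j[OF D_B[OF n], of c j] by force
  \<comment> \<open>The constant \<open>C\<close> is charged only where \<open>h j > 0\<close>,
    since \<open>A 0\<close> is the whole ring; at most \<open>B n 0 = n * b 0\<close> indices
    \<open>j\<close> are affected.\<close>
  have pos: "real (wlen (Q n j)) \<le> g * real (h j) + C * (if 0 < h j then 1 else 0)" for j
  proof (cases "h j = 0")
    case True
    then show ?thesis using wlen_Q_le[OF Dh[of j]] by (simp add: wlen_A_0)
  next
    case False
    have "real (wlen (Q n j)) \<le> real (wlen (A (h j)))" using wlen_Q_le[OF Dh[of j]] by simp
    also have "\<dots> \<le> g * real (h j) + C" by (rule lin)
    finally show ?thesis using False by simp
  qed
  have count: "(\<Sum>j<e * n. if c < h j then 1 else 0) \<le> B n c" for c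
  proof -
    have "{j\<in>{..<e * n}. c < h j} \<subseteq> {..<B n c}" using hB by auto
    then have "card {j\<in>{..<e * n}. c < h j} \<le> B n c" using card_mono[of "{..<B n c}"] by simp
    then show ?thesis by (simp add: sum.If_cases Int_def)
  qed
  have "(\<Sum>j<e * n. h j) = (\<Sum>j<e * n. \<Sum>c<k * n. if c < h j then 1 else 0)"
  proof (rule sum.cong[OF refl])
    fix j
    have "{c\<in>{..<k * n}. c < h j} = {..<h j}" using h_le[OF Dk, of j] by auto
    then show "h j = (\<Sum>c<k * n. if c < h j then 1 else 0)" by (simp add: sum.If_cases Int_def)
  qed
  also have "\<dots> = (\<Sum>c<k * n. \<Sum>j<e * n. if c < h j then 1 else 0)" by (rule sum.swap)
  also have "\<dots> \<le> (\<Sum>c<k * n. B n c)" by (intro sum_mono count)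
  finally have h_sum: "real (\<Sum>j<e * n. h j) \<le> real (\<Sum>c<k * n. B n c)" by (rule of_nat_mono)
  have "real (wlen (coeffs_in (ideal_pow I n))) = (\<Sum>j<e * n. real (wlen (Q n j)))" by (simp add: wlen_pow_I)
  also have "\<dots> \<le> (\<Sum>j<e * n. g * real (h j) + C * (if 0 < h j then 1 else 0))" by (intro sum_mono pos)
  also have "\<dots> = g * real (\<Sum>j<e * n. h j) + C * real (\<Sum>j<e * n. if 0 < h j then 1 else 0)"
  proof -
    have "real (\<Sum>j<e * n. if 0 < h j then 1 else 0) = (\<Sum>j<e * n. if 0 < h j then 1 else 0)"
      unfolding of_nat_sum by (intro sum.cong refl) simp
    then show ?thesis by (simp only: sum.distrib sum_distrib_left of_nat_sum)
  qed
  also have "\<dots> \<le> g * real (\<Sum>c<k * n. B n c) + C * real (B n 0)"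
    by (intro add_mono mult_left_mono h_sum of_nat_mono[OF count] g C)
  also have "B n 0 = n * b 0" by (simp add: B_def)
  finally show ?thesis unfolding sum_B[OF k] by simp
qed

text \<open>The linear bound is a parameter: the slope \<open>g\<close> is the multiplicity of the
  ring in the generic case, and 0 when the lengths of \<open>S/(m^c + z)\<close> stay
  bounded.\<close>

lemma hs_mult_le:
  assumes dim: "krull_dim TYPE('a) \<le> 2" and k: "D 1 0 k" "k > 0" and g: "g \<ge> 0"
    and lin: "\<And>c. real (wlen (A c)) \<le> g * real c + C"
  shows "hs_mult 2 I \<le> 2 * (1 - 1 / (2 * real k)) * g * colen I"
proof -
  have bk: "b k = 0" using k(1) D_b[of 0 k] by simp
  define \<beta> where "\<beta> = real (\<Sum>i<k. b i)"
  obtain a where a: "hs_mult 2 I = 2 * a" and lim: "(\<lambda>n. rlen (ideal_pow I n) UNIV / (real n)\<^sup>2) \<longlonglongrightarrow> a"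
    using hilbert_samuel(2)[OF noeth loc dim I e] by blast
  have rl: "rlen J UNIV = real (wlen (coeffs_in J))" if "cofinite J" for J
    using len_coeffs_in_UNIV[OF that] by (simp add: rlen_def wlen_def)
  \<comment> \<open>Collects the terms linear in \<open>n\<close>, which disappear after division by
    \<open>n^2\<close>.\<close>
  define R where "R = g * real (b 0) / 2 + C * real (b 0)"
  have "a \<le> g * (\<beta> - real (b 0) / 2) + 0"
  proof (rule tendsto_le[OF sequentially_bot _ lim])
    show "(\<lambda>n. g * (\<beta> - real (b 0) / 2) + R / real n) \<longlonglongrightarrow> g * (\<beta> - real (b 0) / 2) + 0"
      by (intro tendsto_intros tendsto_divide_0[OF tendsto_const] filterlim_real_at_infinity_sequentially)
    show "\<forall>\<^sub>F n in sequentially. rlen (ideal_pow I n) UNIV / (real n)\<^sup>2 \<le> g * (\<beta> - real (b 0) / 2) + R / real n"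
      using eventually_gt_at_top[of 0]
    proof eventually_elim
      case (elim n)
      have "rlen (ideal_pow I n) UNIV \<le>
        g * ((real n)\<^sup>2 * \<beta> - real n * (real n - 1) / 2 * real (b 0)) + C * real n * real (b 0)"
        using wlen_pow_I_le[OF bk elim g lin] by (simp add: rl[OF cofinite_pow[OF cofinite_I]] \<beta>_def)
      also have "\<dots> = (g * (\<beta> - real (b 0) / 2) + R / real n) * (real n)\<^sup>2"
        using elim by (simp add: R_def field_simps power2_eq_square)
      finally show ?case using elim by (simp add: pos_divide_le_eq)
    qed
  qed
  also have "\<beta> \<le> real k * real (b 0)"
  proof -
    have "b i \<le> b 0" for i using D_mono_c[of 1 "b 0" 0 i] D_b by simp
    then have "(\<Sum>i<k. b i) \<le> (\<Sum>i<k. b 0)" by (intro sum_mono)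
    then have "real (\<Sum>i<k. b i) \<le> real (k * b 0)" by (intro of_nat_mono) simp
    then show ?thesis by (simp add: \<beta>_def)
  qed
  then have "\<beta> / real k \<le> real (b 0)" using k(2) by (simp add: field_simps)
  then have "\<beta> - real (b 0) / 2 \<le> \<beta> * (1 - 1 / (2 * real k))" by (simp add: algebra_simps)
  then have "g * (\<beta> - real (b 0) / 2) + 0 \<le> g * (\<beta> * (1 - 1 / (2 * real k)))"
    using mult_left_mono[OF _ g] by simp
  also have "\<beta> * (1 - 1 / (2 * real k)) \<le> colen I * (1 - 1 / (2 * real k))"
  proof (rule mult_right_mono)
    have "colen I = real (wlen (coeffs_in I))"
      using rl[OF cofinite_I] by (simp add: colen_def rlen_def colength_eq_len)
    then show "\<beta> \<le> colen I" unfolding \<beta>_def using sum_b_le[of k] by (simp del: of_nat_sum)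
    show "0 \<le> 1 - 1 / (2 * real k)" using k(2) by (simp add: field_simps)
  qed
  then have "g * (\<beta> * (1 - 1 / (2 * real k))) \<le> g * (colen I * (1 - 1 / (2 * real k)))"
    using g by (rule mult_left_mono)
  finally have "2 * a \<le> 2 * (g * (colen I * (1 - 1 / (2 * real k))))" by simp
  also have "\<dots> = 2 * (1 - 1 / (2 * real k)) * g * colen I" by (simp only: ac_simps)
  finally show ?thesis unfolding a .
qed

end


section \<open>Consequences of fullness\<close>

context generic_element_ideal
begin

lemma loc_contr_eq: "loc_contr L = sat W L"
  by (auto simp: loc_contr_def sat_def W_def ext_ideal_eq[OF M])

lemma cofinite_prod: "cofinite (ideal_prod M I)"
proof -
  have "mpow (Suc e) \<subseteq> ideal_prod M I" using e by (simp add: ideal_prod_mono)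
  then show ?thesis unfolding cofinite_def using is_ideal_prod by blast
qed

text \<open>\<open>m_full\<close> compares contractions of localized ideals; \<open>I\<close> and
  \<open>m I\<close> are cofinite, so their extensions are already saturated and contraction leaves
  them unchanged.\<close>

lemma m_full_colon:
  assumes "m_full xs I" shows "colon (coeffs_in (ideal_prod M I)) z = coeffs_in I"
proof -
  have "{f. z * f \<in> loc_contr (ext_ideal (ideal_prod M I))} = loc_contr (ext_ideal I)"
    using assms unfolding m_full_def Let_def z_def[symmetric] .
  then show ?thesis
    by (simp add: loc_contr_eq colon_def ext_ideal_eq I is_ideal_prod
        sat_wideal wideal_coeffs_in cofinite_I cofinite_prod)
qed

text \<open>Cancelling the length of \<open>S/IS\<close> from two expressions for that of
  \<open>S/mIS\<close> leaves the length of \<open>I/mI\<close>; each listed generator contributes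
  at most the length of the residue field to it.\<close>

lemma m_full_len:
  assumes "m_full xs I" and gens: "I = ideal_gen (set gs)"
  shows "len W (wsum (coeffs_in (ideal_prod M I)) (principal z)) UNIV \<le> enat (length gs)"
proof -
  let ?P = "ideal_prod M I"
  have w: "wideal W (coeffs_in ?P)" "wideal W (coeffs_in I)"
    by (intro wideal_coeffs_in cofinite_prod cofinite_I)+
  have P: "?P \<subseteq> I" using I by (rule ideal_prod_subset)
  have "len {1} ?P (sat {1} (isum ?P (ideal_gen (set gs)))) \<le> of_nat (card (set gs)) * len {1} M UNIV"
  proof (rule one.len_span_le)
    show "a * g \<in> ?P" if "a \<in> M" "g \<in> set gs" for a g
      using that ideal_gen_superset[of "set gs"] gens by (intro ideal_prod_mem) auto
  qed (simp_all add: wideal_one is_ideal_prod M)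
  also have "isum ?P (ideal_gen (set gs)) = I"
    unfolding gens[symmetric] using isum_least[OF I P order_refl] isum_upper2[OF is_ideal_prod] by blast
  also have "of_nat (card (set gs)) * len {1} M UNIV \<le> of_nat (length gs) * 1"
    using len_max_ideal_le by (intro mult_mono) (simp_all add: of_nat_eq_enat card_length)
  finally have PI: "len {1} ?P I \<le> enat (length gs)" by (simp add: sat_one of_nat_eq_enat)
  then obtain k where k: "len {1} ?P I = enat k" "k \<le> length gs" by (cases "len {1} ?P I") auto
  have "len W (coeffs_in ?P) (coeffs_in I) \<le> enat k"
    by (rule len_coeffs_in_le[OF k(1) cofinite_prod I P])
  moreover have "len W (coeffs_in ?P) UNIV = len W (coeffs_in I) UNIV + len W (wsum (coeffs_in ?P) (principal z)) UNIV"
    using len_colon_add[OF w(1), of z] by (simp add: m_full_colon[OF assms(1)])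
  moreover have "len W (coeffs_in ?P) UNIV = len W (coeffs_in ?P) (coeffs_in I) + len W (coeffs_in I) UNIV"
    using w wideal_UNIV coeffs_in_mono[OF P] subset_UNIV by (rule len_add)
  moreover have "len W (coeffs_in I) UNIV \<noteq> \<infinity>"
    using len_ext_finite[OF cofinite_I order_refl w(2)] .
  ultimately have "len W (wsum (coeffs_in ?P) (principal z)) UNIV \<le> enat k"
    by (metis add.commute enat_add_left_cancel)
  then show ?thesis using k(2) by (meson enat_ord_simps(1) order_trans)
qed

text \<open>Nakayama's lemma modulo \<open>z\<close>, without Krull's intersection theorem.\<close>
lemma I_subset_A:
  assumes "coeffs_in I \<subseteq> wsum (coeffs_in (ideal_prod M I)) (principal z)"
  shows "coeffs_in I \<subseteq> A t"
proof (induction t)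
  case 0
  then show ?case using A_upper(1)[of 0] by (auto simp: coeffs_in_UNIV)
next
  case (Suc t)
  have iA: "is_ideal (A (Suc t))" by (rule wideal_is_ideal[OF wideal_A])
  have "ideal_prod M I \<subseteq> {c. const_poly c \<in> A (Suc t)}"
  proof (rule ideal_prod_least[OF is_ideal_contraction[OF iA]])
    fix m y assume m: "m \<in> M" and y: "y \<in> I"
    have "const_poly y \<in> A t" using Suc const_poly_mem[OF I] y by blast
    then have "const_poly y * const_poly m \<in> A (Suc t)"
      unfolding A_def[of t]
    proof (rule wsum_mult_mem[OF _ _ _ wideal_A])
      show "f * const_poly m \<in> A (Suc t)" if "f \<in> principal z" for f
        using that A_upper(2) by (auto simp: principal_def mult.assoc)
      show "f * const_poly m \<in> A (Suc t)" if "f \<in> mext t" for f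
      proof -
        have "const_poly m * f \<in> mext (1 + t)"
          using m that by (intro const_mult_mem_pow) (simp_all only: ideal_pow_one[OF M])
        then show ?thesis using A_upper(1)[of "Suc t"] by (auto simp: mult.commute simp del: ideal_pow.simps)
      qed
    qed
    then show "m * y \<in> {c. const_poly c \<in> A (Suc t)}" by (simp add: const_poly_mult mult.commute)
  qed
  then have "coeffs_in (ideal_prod M I) \<subseteq> A (Suc t)" by (intro coeffs_in_least iA) blast
  moreover have "principal z \<subseteq> A (Suc t)" using A_upper(2) by (auto simp: principal_def)
  ultimately have "wsum (coeffs_in (ideal_prod M I)) (principal z) \<subseteq> A (Suc t)"
    by (rule wsum_least[OF wideal_A])
  with assms show ?case by (rule order_trans)
qed

end

theorem theorem3p9:
  fixes I :: "'a::comm_ring_1 set" and xs :: "'a list" and N :: nat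
  assumes "noetherian TYPE('a)"
    and "local_ring TYPE('a)"
    and "krull_dim TYPE('a) = 2"
    and "ideal_gen (set xs) = (max_ideal :: 'a set)"
    and "m_primary I"
    and "m_full xs I"
    and "\<exists>gs :: 'a list. length gs = N \<and> I = ideal_gen (set gs)"
  shows "hs_mult 2 I \<le> 2 * (1 - 1 / (2 * real N - 2)) * hs_mult 2 (max_ideal :: 'a set) * colen I"
proof -
  interpret generic_element "TYPE('a)" xs
    using assms by unfold_locales
  obtain e where e: "mpow e \<subseteq> I" using m_primary_max_pow[OF noeth assms(5)] by blast
  have I0: "is_ideal I" "I \<subseteq> M" using assms(5) by (simp_all add: m_primary_def)
  interpret generic_element_ideal "TYPE('a)" xs I e
    using I0 e by unfold_locales
  have dim: "krull_dim TYPE('a) \<le> 2" using assms(3) by simp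
  have eM: "hs_mult 2 M \<ge> 0"
    using hilbert_samuel(2)[OF noeth loc dim M, of 1] ideal_pow_one[OF M] by auto
  obtain gs where gs: "length gs = N" "I = ideal_gen (set gs)" using assms(7) by blast
  let ?U = "wsum (coeffs_in (ideal_prod M I)) (principal z)"
  let ?V = "wsum (coeffs_in I) (principal z)"
  have iI: "is_ideal (coeffs_in I)" using I0(1) by (rule is_ideal_coeffs_in)
  have wU: "wideal W ?U" by (intro wideal_wsum is_ideal_coeffs_in is_ideal_prod is_ideal_principal)
  have wV: "wideal W ?V" by (intro wideal_wsum iI is_ideal_principal)
  have UV: "?U \<subseteq> ?V" by (intro wsum_mono coeffs_in_mono ideal_prod_subset I0(1) order_refl)
  have U: "len W ?U UNIV \<le> enat N" using m_full_len[OF assms(6) gs(2)] gs(1) by simp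
  have IV: "coeffs_in I \<subseteq> ?V" by (rule wsum_upper1[OF is_ideal_principal])
  have V_eq: "Q 1 0 = ?V" unfolding Q_def using ideal_pow_one[OF I0(1)] by (simp add: colon_def)
  show ?thesis
  proof (cases "?U = ?V")
    case True
    have A: "coeffs_in I \<subseteq> A c" for c by (rule I_subset_A) (use IV True in blast)
    \<comment> \<open>Every \<open>A c\<close> contains the extension of \<open>I\<close>, so the
      lengths are bounded by that of \<open>S/IS\<close> and slope 0 is admissible.\<close>
    have lin: "real (wlen (A c)) \<le> 0 * real c + real (wlen (coeffs_in I))" for c
      using wlen_mono[OF cofinite_I order_refl wideal_coeffs_in[OF cofinite_I] wideal_A A] by simp
    \<comment> \<open>Any positive exponent will do, as slope 0 kills the factor depending on it;
      \<open>Suc e\<close> is visibly positive.\<close>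
    have "D 1 0 (Suc e)"
      unfolding D_def using coeffs_in_mono[OF e] pow_I_Q[of 1 0] coeffs_in_mono[OF ideal_pow_Suc_subset[of M e]]
      unfolding ideal_pow_one[OF I0(1)] by blast
    then have "hs_mult 2 I \<le> 2 * (1 - 1 / (2 * real (Suc e))) * 0 * colen I"
      by (rule hs_mult_le[OF dim _ _ order_refl lin]) simp
    moreover have "0 \<le> 1 - 1 / (2 * real N - 2)"
    proof -
      \<comment> \<open>At \<open>N = 1\<close> the quotient is \<open>1 / 0 = 0\<close>, at
        \<open>N = 0\<close> the divisor is negative; the factor is nonnegative each time.\<close>
      consider "N = 0" | "N = 1" | "N \<ge> 2" by linarith
      then show ?thesis by cases (auto simp: field_simps)
    qed
    then have "0 \<le> 2 * (1 - 1 / (2 * real N - 2)) * hs_mult 2 M * colen I"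
      using eM by (simp add: colen_def)
    ultimately show ?thesis by simp
  next
    case False
    then have "?U \<subset> ?V" using UV by blast
    \<comment> \<open>The strict inclusion uses up one unit of length, which turns the bound
      \<open>N\<close> into \<open>N - 1\<close>.\<close>
    then have "1 \<le> len W ?U ?V" by (rule len_pos[OF wU wV])
    then have "1 + len W ?V UNIV \<le> len W ?U ?V + len W ?V UNIV" by (rule add_right_mono)
    also have "\<dots> = len W ?U UNIV" using wU wV wideal_UNIV UV subset_UNIV by (rule len_add[symmetric])
    finally have NV: "1 + len W ?V UNIV \<le> enat N" using U by (rule order_trans)
    \<comment> \<open>\<open>?V\<close> is proper, so \<open>S/?V\<close> has length at least 1;
      this yields \<open>N \<ge> 2\<close> and makes the exponent \<open>N - 1\<close>
      positive.\<close>
    have "?V \<subseteq> coeffs_in M"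
      using I0(2) by (intro wsum_least wideal_coeffs_in cofinite_M coeffs_in_mono principal_least
          is_ideal_coeffs_in M z_mem)
    then have "?V \<subset> UNIV" using const_poly_mem[OF M, of 1] one_notin_max_ideal by blast
    then have "1 \<le> len W ?V UNIV" by (rule len_pos[OF wV wideal_UNIV])
    moreover obtain v where v: "len W ?V UNIV = enat v" using NV by (cases "len W ?V UNIV") auto
    ultimately have N: "N \<ge> 2" "v \<le> N - 1" using NV by (simp_all add: one_enat_def)
    have "D 1 0 (N - 1)"
      unfolding D_def V_eq
    proof (rule pow_subset_of_len_le[OF wV])
      show "mext e \<subseteq> ?V" using coeffs_in_mono[OF e] IV by (rule order_trans)
      show "len W ?V UNIV \<le> enat (N - 1)" using v N by simp
    qed
    moreover obtain C where "\<And>c. real (wlen (A c)) \<le> hs_mult 2 M * real c + C"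
      using wlen_A_linear[OF dim] by blast
    ultimately have "hs_mult 2 I \<le> 2 * (1 - 1 / (2 * real (N - 1))) * hs_mult 2 M * colen I"
      using N eM by (intro hs_mult_le dim) simp_all
    moreover have "2 * real (N - 1) = 2 * real N - 2" using N by (simp add: of_nat_diff)
    ultimately show ?thesis by simp
  qed
qed

end
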